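(* There is an algorithm which, given a graph $G$ with $n$ vertices that contains no odd hole, answers "no even prism" if $G$ contains no even prism, and otherwise outputs an even prism of $G$ with the minimum number of vertices among all even prisms of $G$; the algorithm runs in time $O(n^{11})$.
   Context: Graphs are finite, simple, undirected. "Contains" refers to induced subgraphs; a prism of $G$ is an induced subgraph of $G$ that is a prism. A path is a chordless path; its length is its number of edges. A hole is a chordless cycle with at least 4 vertices. A prism is a graph whose vertex set is partitioned into three sets inducing paths $P_1,P_2,P_3$, each of length at least 1, $P_i$ having ends $a_i,b_i$, such that $\{a_1,a_2,a_3\}$ and $\{b_1,b_2,b_3\}$ are triangles and there are no edges between different $P_i$'s other than those of these two triangles. It is even if the three paths all have even length. Time is worst-case number of elementary operations, up to a multiplicative constant. *)

theory Defs
  imports Complex_Main "HOL-Library.Landau_Symbols"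
begin

section \<open>Graphs, holes and prisms\<close>

text \<open>A graph is given by its vertex set \<open>V\<close> and its adjacency relation \<open>E\<close>.\<close>

definition simple_graph :: "'a set \<Rightarrow> ('a \<Rightarrow> 'a \<Rightarrow> bool) \<Rightarrow> bool" where
  "simple_graph V E \<longleftrightarrow>
     finite V \<and>
     (\<forall>x y. E x y \<longrightarrow> x \<in> V \<and> y \<in> V) \<and>
     (\<forall>x y. E x y \<longrightarrow> E y x) \<and>
     (\<forall>x. \<not> E x x)"

definition induced :: "('a \<Rightarrow> 'a \<Rightarrow> bool) \<Rightarrow> 'a set \<Rightarrow> 'a \<Rightarrow> 'a \<Rightarrow> bool" where
  "induced E S = (\<lambda>x y. x \<in> S \<and> y \<in> S \<and> E x y)"

text \<open>The list enumerates the vertices of the path in order, so the number of edges is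
  \<open>length p - 1\<close>.\<close>

definition chordless_path :: "('a \<Rightarrow> 'a \<Rightarrow> bool) \<Rightarrow> 'a list \<Rightarrow> bool" where
  "chordless_path E p \<longleftrightarrow>
     p \<noteq> [] \<and> distinct p \<and>
     (\<forall>i<length p. \<forall>j<length p. E (p ! i) (p ! j) \<longleftrightarrow> j = Suc i \<or> i = Suc j)"

definition path_length :: "'a list \<Rightarrow> nat" where
  "path_length p = length p - 1"

definition chordless_cycle :: "('a \<Rightarrow> 'a \<Rightarrow> bool) \<Rightarrow> 'a list \<Rightarrow> bool" where
  "chordless_cycle E c \<longleftrightarrow>
     3 \<le> length c \<and> distinct c \<and>
     (\<forall>i<length c. \<forall>j<length c.
        E (c ! i) (c ! j) \<longleftrightarrow> j = Suc i mod length c \<or> i = Suc j mod length c)"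

definition hole :: "'a set \<Rightarrow> ('a \<Rightarrow> 'a \<Rightarrow> bool) \<Rightarrow> bool" where
  "hole V E \<longleftrightarrow> 4 \<le> card V \<and> (\<exists>c. set c = V \<and> chordless_cycle E c)"

definition odd_hole :: "'a set \<Rightarrow> ('a \<Rightarrow> 'a \<Rightarrow> bool) \<Rightarrow> bool" where
  "odd_hole V E \<longleftrightarrow> hole V E \<and> odd (card V)"

definition contains_odd_hole :: "'a set \<Rightarrow> ('a \<Rightarrow> 'a \<Rightarrow> bool) \<Rightarrow> bool" where
  "contains_odd_hole V E \<longleftrightarrow> (\<exists>S\<subseteq>V. odd_hole S (induced E S))"

text \<open>\<open>prism_paths V E P\<close>: the graph \<open>(V, E)\<close> is a prism formed by the three paths
  \<open>P 0\<close>, \<open>P 1\<close>, \<open>P 2\<close>, where \<open>P i\<close> has the ends \<open>a\<^sub>i = hd (P i)\<close> and \<open>b\<^sub>i = last (P i)\<close>.\<close>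

definition prism_paths :: "'a set \<Rightarrow> ('a \<Rightarrow> 'a \<Rightarrow> bool) \<Rightarrow> (nat \<Rightarrow> 'a list) \<Rightarrow> bool" where
  "prism_paths V E P \<longleftrightarrow>
     V = (\<Union>i<3. set (P i)) \<and>
     (\<forall>i<3. \<forall>j<3. i \<noteq> j \<longrightarrow> set (P i) \<inter> set (P j) = {}) \<and>
     (\<forall>i<3. chordless_path E (P i) \<and> 1 \<le> path_length (P i)) \<and>
     (\<forall>i<3. \<forall>j<3. i \<noteq> j \<longrightarrow>
        E (hd (P i)) (hd (P j)) \<and> E (last (P i)) (last (P j))) \<and>
     (\<forall>i<3. \<forall>j<3. i \<noteq> j \<longrightarrow>
        (\<forall>x\<in>set (P i). \<forall>y\<in>set (P j). E x y \<longrightarrow>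
           x = hd (P i) \<and> y = hd (P j) \<or> x = last (P i) \<and> y = last (P j)))"

definition even_prism :: "'a set \<Rightarrow> ('a \<Rightarrow> 'a \<Rightarrow> bool) \<Rightarrow> bool" where
  "even_prism V E \<longleftrightarrow> (\<exists>P. prism_paths V E P \<and> (\<forall>i<3. even (path_length (P i))))"

text \<open>An even prism of \<open>(V, E)\<close> is an induced subgraph, hence determined by its vertex set.\<close>

definition even_prism_of :: "'a set \<Rightarrow> ('a \<Rightarrow> 'a \<Rightarrow> bool) \<Rightarrow> 'a set \<Rightarrow> bool" where
  "even_prism_of V E S \<longleftrightarrow> S \<subseteq> V \<and> even_prism S (induced E S)"

definition minimum_even_prism_of :: "'a set \<Rightarrow> ('a \<Rightarrow> 'a \<Rightarrow> bool) \<Rightarrow> 'a set \<Rightarrow> bool" where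
  "minimum_even_prism_of V E S \<longleftrightarrow>
     even_prism_of V E S \<and> (\<forall>S'. even_prism_of V E S' \<longrightarrow> card S \<le> card S')"


section \<open>The machine model\<close>

text \<open>
  Algorithms are while-programs for a word RAM: finitely many named registers, a random access
  memory, and unit cost for each arithmetic operation, comparison, register or memory access and
  control step. All arithmetic is on words, i.e. modulo a bound \<open>W\<close>; subtraction is truncated at
  \<open>0\<close>. In the theorem \<open>W\<close> is polynomial in the number of vertices, so that words have
  logarithmically many bits and unit cost is legitimate even for multiplication.
\<close>

datatype expr =
    Const nat
  | Reg nat
  | Load expr
  | Add expr expr
  | Sub expr expr
  | Mul expr expr
  | Less expr expr
  | Equal expr expr

datatype prog =
    Skip
  | Assign nat expr
  | Store expr expr
  | Seq prog prog
  | Cond expr prog prog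
  | While expr prog

type_synonym state = "(nat \<Rightarrow> nat) \<times> (nat \<Rightarrow> nat)"

fun eval :: "nat \<Rightarrow> state \<Rightarrow> expr \<Rightarrow> nat" where
  "eval W s (Const c) = c mod W"
| "eval W s (Reg x) = fst s x"
| "eval W s (Load e) = snd s (eval W s e)"
| "eval W s (Add e f) = (eval W s e + eval W s f) mod W"
| "eval W s (Sub e f) = eval W s e - eval W s f"
| "eval W s (Mul e f) = (eval W s e * eval W s f) mod W"
| "eval W s (Less e f) = (if eval W s e < eval W s f then 1 else 0)"
| "eval W s (Equal e f) = (if eval W s e = eval W s f then 1 else 0)"

fun cost :: "expr \<Rightarrow> nat" where
  "cost (Const c) = 1"
| "cost (Reg x) = 1"
| "cost (Load e) = 1 + cost e"
| "cost (Add e f) = 1 + cost e + cost f"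
| "cost (Sub e f) = 1 + cost e + cost f"
| "cost (Mul e f) = 1 + cost e + cost f"
| "cost (Less e f) = 1 + cost e + cost f"
| "cost (Equal e f) = 1 + cost e + cost f"

text \<open>\<open>exec W p s t s'\<close>: with word bound \<open>W\<close>, the program \<open>p\<close> started in \<open>s\<close> halts in \<open>s'\<close> after
  exactly \<open>t\<close> elementary operations. A test succeeds iff its value is nonzero.\<close>

inductive exec :: "nat \<Rightarrow> prog \<Rightarrow> state \<Rightarrow> nat \<Rightarrow> state \<Rightarrow> bool" for W :: nat where
  Skip: "exec W Skip s 1 s"
| Assign: "exec W (Assign x e) s (1 + cost e) ((fst s)(x := eval W s e), snd s)"
| Store: "exec W (Store e f) s (1 + cost e + cost f)
            (fst s, (snd s)(eval W s e := eval W s f))"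
| Seq: "exec W p s t s' \<Longrightarrow> exec W q s' t' s'' \<Longrightarrow> exec W (Seq p q) s (t + t') s''"
| CondTrue: "eval W s e \<noteq> 0 \<Longrightarrow> exec W p s t s' \<Longrightarrow>
    exec W (Cond e p q) s (1 + cost e + t) s'"
| CondFalse: "eval W s e = 0 \<Longrightarrow> exec W q s t s' \<Longrightarrow>
    exec W (Cond e p q) s (1 + cost e + t) s'"
| WhileFalse: "eval W s e = 0 \<Longrightarrow> exec W (While e p) s (1 + cost e) s"
| WhileTrue: "eval W s e \<noteq> 0 \<Longrightarrow> exec W p s t s' \<Longrightarrow> exec W (While e p) s' t' s'' \<Longrightarrow>
    exec W (While e p) s (1 + cost e + t + t') s''"

text \<open>Final state and running time are determined by the initial state.\<close>

lemma exec_deterministic: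
  "exec W p s t s' \<Longrightarrow> exec W p s u s'' \<Longrightarrow> u = t \<and> s'' = s'"
proof (induction arbitrary: u s'' rule: exec.induct)
  case (Skip s)
  then show ?case by cases auto
next
  case (Assign x e s)
  then show ?case by cases auto
next
  case (Store e f s)
  then show ?case by cases auto
next
  case (Seq p s t s' q t' s1)
  from Seq.prems show ?case by cases (use Seq.IH in blast)
next
  case (CondTrue s e p t s' q)
  from CondTrue.prems CondTrue.hyps show ?case by cases (auto dest!: CondTrue.IH)
next
  case (CondFalse s e q t s' p)
  from CondFalse.prems CondFalse.hyps show ?case by cases (auto dest!: CondFalse.IH)
next
  case (WhileFalse s e p)
  from WhileFalse.prems WhileFalse.hyps show ?case by cases auto
next
  case (WhileTrue s e p t s' t' s1)
  from WhileTrue.prems WhileTrue.hyps show ?case by cases (simp, use WhileTrue.IH in blast)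
qed

text \<open>Input: the number \<open>n\<close> of vertices in register \<open>0\<close> and the adjacency matrix, row by row, in
  the memory cells \<open>0, \<dots>, n\<^sup>2 - 1\<close>; everything else is \<open>0\<close>.\<close>

definition graph_input :: "nat \<Rightarrow> (nat \<Rightarrow> nat \<Rightarrow> bool) \<Rightarrow> state" where
  "graph_input n E =
     (\<lambda>x. if x = 0 then n else 0,
      \<lambda>a. if a < n * n \<and> E (a div n) (a mod n) then 1 else 0)"

text \<open>Output: register \<open>0\<close> holds the length of the list of vertices stored from cell \<open>0\<close> on;
  the empty list (\<open>None\<close>) encodes the answer ``no even prism''.\<close>

definition prism_output :: "state \<Rightarrow> nat set option" where
  "prism_output s = (if fst s 0 = 0 then None else Some (snd s ` {..<fst s 0}))"

end

theory Submission
  imports Defs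
begin

text \<open>
  Let \<open>p, q, r\<close> be the paths of a minimum even prism, \<open>m\<close> the middle vertex of \<open>p\<close>, and \<open>w\<close> a walk from
  an end of \<open>p\<close> to \<open>m\<close>, at most as long as the half of \<open>p\<close>, whose inner vertices are not adjacent
  to the ends of \<open>q\<close> and \<open>r\<close>. If an inner vertex of \<open>w\<close> had a neighbour on \<open>q\<close> or \<open>r\<close>, then the last such
  vertex \<open>y\<close> would be joined, by way of \<open>m\<close>, to either end of \<open>p\<close> by a path shorter than \<open>p\<close>. As there
  are no odd holes, the neighbours of \<open>y\<close> on the hole formed by \<open>q\<close> and \<open>r\<close> are two consecutive
  vertices, say of \<open>q\<close>, so each of the two paths gives a prism smaller than the minimum one, hence
  an odd one; but this makes the length of \<open>q\<close> odd. Therefore \<open>w\<close> can replace the half of \<open>p\<close>.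

  Thus it suffices to try all nine-tuples of ends and middle vertices, to join them by shortest
  paths among the vertices not adjacent to the other ends, and to test in time \<open>O(n\<^sup>2)\<close>
  whether an even prism results. The shortest paths do not depend on the middle vertices, so they
  are computed once for each six-tuple of ends, where time \<open>O(n\<^sup>5)\<close> is available.
\<close>

section \<open>Paths, cycles and prisms\<close>

text \<open>The middle vertex is what makes the argument two-sided. Beyond the last bad vertex
  \<open>y\<close>, a walk to \<open>m\<close> is free of neighbours on \<open>q\<close> and
  \<open>r\<close>, and so are both halves of \<open>p\<close> as seen from \<open>m\<close>; thus
  one clean piece of the walk leads on to both ends of \<open>p\<close>. For a walk joining the two
  ends directly this is missing, since the part beyond \<open>y\<close> leads to one end only.
  Vertices adjacent to the four ends of \<open>q\<close> and \<open>r\<close> are avoided because an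
  attachment there would touch a triangle of the prism and not yield three new paths.

  An exchanged half keeps the ends, the middle vertex and the size. The result is again a minimum
  even prism, so all six halves can be exchanged one after the other for the paths found by the
  searches.

  Correctness splits in two. Soundness is an invariant of the program: a vertex set is stored only
  after all pairs of its positions have been compared with the pattern of an even prism.
  Completeness needs the graph theory, and needs it for a single tuple: the ends and middle vertices
  of some minimum even prism.\<close>

text \<open>A repeated vertex or a chord allows a part of the walk to be cut out. The strict
  inequality matters: where minimality forbids shorter paths, the walk itself must be
  chordless.\<close>

lemma shortcut_walk:
  assumes sym: "\<And>x y. E x y \<Longrightarrow> E y x" and irr: "\<And>x. \<not> E x x"
    and w: "successively E w" "w \<noteq> []"
  shows "chordless_path E w \<or>
    (\<exists>p. chordless_path E p \<and> hd p = hd w \<and> last p = last w \<and> set p \<subseteq> set w \<and> length p < length w)"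
  using w
proof (induction "length w" arbitrary: w rule: less_induct)
  case less
  have step: "?case" if w': "successively E w'" "w' \<noteq> []" "length w' < length w" "hd w' = hd w" "last w' = last w"
    "set w' \<subseteq> set w" for w'
    using less.hyps[OF w'(3,1,2)] w' by (metis dual_order.trans order_less_trans subset_trans)
  \<comment> \<open>\<open>i\<close> is the number of vertices kept before the cut. For
    \<open>i = 0\<close> nothing is kept there, so the head survives only if \<open>w ! j\<close>
    equals it.\<close>
  have app: "?case" if ij: "i < j" "j < length w" "i \<noteq> 0 \<longrightarrow> E (w ! (i - 1)) (w ! j)" "i = 0 \<longrightarrow> w ! j = w ! 0" for i j
  proof (rule step[of "take i w @ drop j w"])
    have d: "drop j w \<noteq> []" and hd: "hd (drop j w) = w ! j" using ij by (auto simp: hd_drop_conv_nth)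
    show "successively E (take i w @ drop j w)"
      unfolding successively_append_iff
    proof (intro conjI impI)
      have "successively E (take j w @ drop j w)" using less.prems by simp
      then show "successively E (drop j w)" unfolding successively_append_iff by blast
      have "successively E (take i w @ drop i w)" using less.prems by simp
      then show "successively E (take i w)" unfolding successively_append_iff by blast
    next
      have "i \<noteq> 0 \<Longrightarrow> last (take i w) = w ! (i - 1)" using ij by (subst last_conv_nth) auto
      then have "i \<noteq> 0 \<Longrightarrow> E (last (take i w)) (hd (drop j w))" using ij hd by auto
      then show "take i w = [] \<or> drop j w = [] \<or> E (last (take i w)) (hd (drop j w))" by fastforce
    qed
    show "take i w @ drop j w \<noteq> []" using d by simp
    show "length (take i w @ drop j w) < length w" using ij by auto
    show "hd (take i w @ drop j w) = hd w"
      using ij hd d less.prems by (cases "i = 0") (auto simp: hd_append hd_conv_nth)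
    show "last (take i w @ drop j w) = last w" using d by simp
    show "set (take i w @ drop j w) \<subseteq> set w" by (auto dest: in_set_takeD in_set_dropD)
  qed
  have cons: "E (w ! i) (w ! Suc i)" if "Suc i < length w" for i
    using less.prems that by (simp add: successively_conv_nth)
  show ?case
  proof (cases "distinct w")
    case False
    then obtain i j where ij: "i < j" "j < length w" "w ! i = w ! j"
      by (metis distinct_conv_nth linorder_neqE_nat)
    \<comment> \<open>Of two equal vertices the second is kept and entered from the predecessor of
      the first.\<close>
    show ?thesis
      by (rule app[of i j]) (use ij cons[of "i - 1"] in auto)
  next
    case True
    show ?thesis
    proof (cases "chordless_path E w")
      case False
      then obtain i j where ij: "i < length w" "j < length w" "E (w ! i) (w ! j) \<noteq> (j = Suc i \<or> i = Suc j)"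
        using True less.prems unfolding chordless_path_def by blast
      then have "E (w ! i) (w ! j)" "j \<noteq> Suc i" "i \<noteq> Suc j" using cons sym by blast+
      moreover have "i \<noteq> j" using irr calculation by auto
      ultimately obtain a b where "Suc a < b" "b < length w" "E (w ! a) (w ! b)"
        using ij sym by (metis Suc_lessI linorder_neqE_nat)
      then show ?thesis using app[of "Suc a" b] by simp
    qed simp
  qed
qed

lemma chordless_path_successively: "chordless_path E p \<Longrightarrow> successively E p"
  by (auto simp: chordless_path_def successively_conv_nth)

lemma chordless_path_rev:
  assumes "chordless_path E p" shows "chordless_path E (rev p)"
proof -
  have "E (rev p ! i) (rev p ! j) \<longleftrightarrow> j = Suc i \<or> i = Suc j" if "i < length p" "j < length p" for i j
    using assms that unfolding chordless_path_def by (auto simp: rev_nth)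
  then show ?thesis using assms unfolding chordless_path_def by simp
qed

lemma chordless_path_append:
  assumes sym: "\<And>x y. E x y \<Longrightarrow> E y x" and p: "chordless_path E p" and q: "chordless_path E q"
    and dis: "set p \<inter> set q = {}"
    and cr: "\<And>x y. x \<in> set p \<Longrightarrow> y \<in> set q \<Longrightarrow> E x y \<longleftrightarrow> x = last p \<and> y = hd q"
  shows "chordless_path E (p @ q)"
proof -
  have ne: "p \<noteq> []" "q \<noteq> []" and d: "distinct p" "distinct q" using p q by (auto simp: chordless_path_def)
  have c: "E (p ! i) (q ! j) \<longleftrightarrow> Suc i = length p \<and> j = 0" if "i < length p" "j < length q" for i j
  proof -
    have "p ! i = last p \<longleftrightarrow> Suc i = length p" using that ne d
      by (subst last_conv_nth) (auto simp: nth_eq_iff_index_eq)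
    moreover have "q ! j = hd q \<longleftrightarrow> j = 0" using that ne d
      by (subst hd_conv_nth) (auto simp: nth_eq_iff_index_eq)
    ultimately show ?thesis using cr[of "p ! i" "q ! j"] that by simp
  qed
  have c': "E (q ! j) (p ! i) \<longleftrightarrow> Suc i = length p \<and> j = 0" if "i < length p" "j < length q" for i j
    using c[OF that] sym by blast
  have pp: "\<And>i j. i < length p \<Longrightarrow> j < length p \<Longrightarrow> E (p ! i) (p ! j) \<longleftrightarrow> j = Suc i \<or> i = Suc j"
    and qq: "\<And>i j. i < length q \<Longrightarrow> j < length q \<Longrightarrow> E (q ! i) (q ! j) \<longleftrightarrow> j = Suc i \<or> i = Suc j"
    using p q by (auto simp: chordless_path_def)
  have "E ((p @ q) ! i) ((p @ q) ! j) \<longleftrightarrow> j = Suc i \<or> i = Suc j"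
    if "i < length (p @ q)" "j < length (p @ q)" for i j
    using that by (auto simp: nth_append c c' pp qq)
  then show ?thesis using ne d dis unfolding chordless_path_def by auto
qed

lemma chordless_cycle_append:
  assumes sym: "\<And>x y. E x y \<Longrightarrow> E y x" and p: "chordless_path E p" and q: "chordless_path E q"
    and dis: "set p \<inter> set q = {}" and len: "length p + length q \<ge> 4"
    and cr: "\<And>x y. x \<in> set p \<Longrightarrow> y \<in> set q \<Longrightarrow> E x y \<longleftrightarrow> x = last p \<and> y = hd q \<or> x = hd p \<and> y = last q"
  shows "chordless_cycle E (p @ q)"
proof -
  have ne: "p \<noteq> []" "q \<noteq> []" and d: "distinct p" "distinct q" using p q by (auto simp: chordless_path_def)
  let ?n = "length (p @ q)"
  have c: "E (p ! i) (q ! j) \<longleftrightarrow> Suc i = length p \<and> j = 0 \<or> i = 0 \<and> Suc j = length q"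
    if "i < length p" "j < length q" for i j
  proof -
    have "p ! i = last p \<longleftrightarrow> Suc i = length p" "q ! j = last q \<longleftrightarrow> Suc j = length q" using that ne d
      by (subst last_conv_nth; auto simp: nth_eq_iff_index_eq)+
    moreover have "q ! j = hd q \<longleftrightarrow> j = 0" "p ! i = hd p \<longleftrightarrow> i = 0" using that ne d
      by (subst hd_conv_nth; auto simp: nth_eq_iff_index_eq)+
    ultimately show ?thesis using cr[of "p ! i" "q ! j"] that by simp
  qed
  have c': "E (q ! j) (p ! i) \<longleftrightarrow> Suc i = length p \<and> j = 0 \<or> i = 0 \<and> Suc j = length q"
    if "i < length p" "j < length q" for i j
    using c[OF that] sym by blast
  have pp: "\<And>i j. i < length p \<Longrightarrow> j < length p \<Longrightarrow> E (p ! i) (p ! j) \<longleftrightarrow> j = Suc i \<or> i = Suc j"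
    and qq: "\<And>i j. i < length q \<Longrightarrow> j < length q \<Longrightarrow> E (q ! i) (q ! j) \<longleftrightarrow> j = Suc i \<or> i = Suc j"
    using p q by (auto simp: chordless_path_def)
  have md: "j = Suc i mod ?n \<longleftrightarrow> j = Suc i \<or> j = 0 \<and> Suc i = ?n" if "i < ?n" "j < ?n" for i j
    using that by (cases "Suc i = ?n") auto
  have "E ((p @ q) ! i) ((p @ q) ! j) \<longleftrightarrow> j = Suc i mod ?n \<or> i = Suc j mod ?n"
    if ij: "i < ?n" "j < ?n" for i j
    unfolding md[OF ij] md[OF ij(2,1)]
    using ij ne len by (cases "i < length p"; cases "j < length p")
      (auto simp: nth_append c c' pp qq neq_Nil_conv)
  then show ?thesis using d dis len unfolding chordless_cycle_def by auto
qed

lemma chordless_cycle_nth: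
  assumes "chordless_cycle E c" "i < length c" "j < length c"
  shows "E (c ! i) (c ! j) \<longleftrightarrow> j = Suc i \<or> i = Suc j \<or> i = 0 \<and> Suc j = length c \<or> j = 0 \<and> Suc i = length c"
proof -
  have "E (c ! i) (c ! j) \<longleftrightarrow> j = Suc i mod length c \<or> i = Suc j mod length c"
    using assms unfolding chordless_cycle_def by blast
  then show ?thesis using assms(2,3) by (cases "Suc i = length c"; cases "Suc j = length c") auto
qed

lemma chordless_cycle_take:
  assumes "chordless_cycle E c" "0 < k" "k < length c" shows "chordless_path E (take k c)"
  using assms(2,3) chordless_cycle_nth[OF assms(1)] assms(1)
  unfolding chordless_path_def chordless_cycle_def by auto

lemma chordless_cycle_drop:
  assumes "chordless_cycle E c" "0 < k" "k < length c" shows "chordless_path E (drop k c)"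
  using assms(2,3) chordless_cycle_nth[OF assms(1)] assms(1)
  unfolding chordless_path_def chordless_cycle_def by (auto simp: nth_drop)

section \<open>Prisms as triples of vertex lists\<close>

text \<open>Both lists run from the first triangle of a prism to the second. The equivalence unites
  the edges that the triangles demand with the absence of all others.\<close>

definition linked :: "('a \<Rightarrow> 'a \<Rightarrow> bool) \<Rightarrow> 'a list \<Rightarrow> 'a list \<Rightarrow> bool" where
  "linked E p q \<longleftrightarrow> set p \<inter> set q = {} \<and>
     (\<forall>x\<in>set p. \<forall>y\<in>set q. E x y \<longleftrightarrow> x = hd p \<and> y = hd q \<or> x = last p \<and> y = last q)"

definition prism :: "('a \<Rightarrow> 'a \<Rightarrow> bool) \<Rightarrow> 'a list \<Rightarrow> 'a list \<Rightarrow> 'a list \<Rightarrow> bool" where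
  "prism E p q r \<longleftrightarrow> chordless_path E p \<and> chordless_path E q \<and> chordless_path E r \<and>
     2 \<le> length p \<and> 2 \<le> length q \<and> 2 \<le> length r \<and> linked E p q \<and> linked E p r \<and> linked E q r"

locale odd_hole_free =
  fixes V :: "'a set" and E :: "'a \<Rightarrow> 'a \<Rightarrow> bool"
  assumes graph: "simple_graph V E" and no_odd_hole: "\<not> contains_odd_hole V E"
begin

lemma sym: "E x y \<Longrightarrow> E y x" and irr: "\<not> E x x" and in_V: "E x y \<Longrightarrow> x \<in> V"
  using graph by (auto simp: simple_graph_def)

lemma hole_even:
  assumes "chordless_cycle E c" "set c \<subseteq> V" "4 \<le> length c"
  shows "even (length c)"
proof (rule ccontr)
  assume o: "odd (length c)"
  have c: "card (set c) = length c" using assms(1) by (simp add: chordless_cycle_def distinct_card)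
  have "chordless_cycle (induced E (set c)) c"
    using assms(1) unfolding chordless_cycle_def induced_def by auto
  then have "odd_hole (set c) (induced E (set c))"
    using assms o c unfolding odd_hole_def hole_def by auto
  then show False using no_odd_hole assms(2) unfolding contains_odd_hole_def by blast
qed

lemma linked_commute: "linked E p q \<longleftrightarrow> linked E q p"
  unfolding linked_def using sym by blast

lemma linked_rev: "p \<noteq> [] \<Longrightarrow> q \<noteq> [] \<Longrightarrow> linked E p q \<Longrightarrow> linked E (rev p) (rev q)"
  unfolding linked_def by (auto simp: hd_rev last_rev)

lemma prism_rotate: "prism E p q r \<Longrightarrow> prism E q r p"
  and prism_swap: "prism E p q r \<Longrightarrow> prism E p r q"
  unfolding prism_def using linked_commute by blast+

lemma prism_rev: "prism E p q r \<Longrightarrow> prism E (rev p) (rev q) (rev r)"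
  unfolding prism_def by (auto intro!: chordless_path_rev linked_rev)

text \<open>Three holes through \<open>y\<close> force its neighbours on an even hole to be two consecutive vertices,
  so that the path \<open>Q\<close> and the hole form a prism.\<close>

lemma attachment:
  assumes L: "chordless_cycle E L" "set L \<subseteq> V" "4 \<le> length L"
    and Q: "chordless_path E Q" "set Q \<subseteq> V" "2 \<le> length Q" "set Q \<inter> set L = {}"
    and int: "\<And>x z. x \<in> set Q \<Longrightarrow> x \<noteq> hd Q \<Longrightarrow> x \<noteq> last Q \<Longrightarrow> z \<in> set L \<Longrightarrow> \<not> E x z"
    and lst: "\<And>z. z \<in> set L \<Longrightarrow> E (last Q) z \<longleftrightarrow> z = hd L \<or> z = last L"
    and nb: "z0 \<in> set L" "E (hd Q) z0" and nhd: "\<not> E (hd Q) (hd L)" and nlast: "\<not> E (hd Q) (last L)"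
  obtains c where "0 < c" "c + 2 < length L"
    "\<And>k. k < length L \<Longrightarrow> E (hd Q) (L ! k) \<longleftrightarrow> k = c \<or> k = Suc c"
    "odd (length Q + c)" "prism E (rev Q) (take (Suc c) L) (rev (drop (Suc c) L))"
proof -
  let ?y = "hd Q" and ?n = "length L"
  have evL: "even ?n" using hole_even L by blast
  have dL: "distinct L" and neL: "L \<noteq> []" using L by (auto simp: chordless_cycle_def)
  have hl: "?y \<noteq> last Q" "Q \<noteq> []" using Q(1,3) unfolding chordless_path_def
    by (auto simp: hd_conv_nth last_conv_nth nth_eq_iff_index_eq)
  have hdL: "hd L = L ! 0" and lastL: "last L = L ! (?n - 1)" using neL by (auto simp: hd_conv_nth last_conv_nth)
  have cyc: "\<And>i j. i < ?n \<Longrightarrow> j < ?n \<Longrightarrow>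
      E (L ! i) (L ! j) \<longleftrightarrow> j = Suc i \<or> i = Suc j \<or> i = 0 \<and> Suc j = ?n \<or> j = 0 \<and> Suc i = ?n"
    using chordless_cycle_nth[OF L(1)] .
  define K where "K = {k. k < ?n \<and> E ?y (L ! k)}"
  have fK: "finite K" unfolding K_def by auto
  have "K \<noteq> {}" using nb by (auto simp: K_def in_set_conv_nth)
  define c d where "c = Min K" and "d = Max K"
  have cK: "c \<in> K" and dK: "d \<in> K" using fK \<open>K \<noteq> {}\<close> by (auto simp: c_def d_def)
  have lo: "c \<le> k" and hi: "k \<le> d" if "k \<in> K" for k using that fK by (auto simp: c_def d_def)
  have cd: "c \<le> d" using lo dK by blast
  \<comment> \<open>As \<open>?y\<close> misses both ends of the list \<open>L\<close>, at least one
    vertex of \<open>L\<close> lies before \<open>c\<close> and one after \<open>d\<close>. This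
    gives each of the three cycles below at least four vertices.\<close>
  have c0: "0 < c" using cK nhd hdL by (cases c) (auto simp: K_def)
  have dn: "d < ?n" "d \<noteq> ?n - 1" using dK nlast lastL by (auto simp: K_def)
  then have dn': "Suc d < ?n" by auto
  have yL: "?y \<notin> set L" using Q(4) hd_in_set[OF hl(2)] by blast
  have yV: "?y \<in> V" using Q(2) hd_in_set[OF hl(2)] by blast
  have idx: "L ! i = L ! j \<longleftrightarrow> i = j" if "i < ?n" "j < ?n" for i j
    using that dL by (simp add: nth_eq_iff_index_eq)
  have crossQ: "E x (L ! k) \<longleftrightarrow> x = last Q \<and> (k = 0 \<or> k = ?n - 1) \<or> x = ?y \<and> k \<in> K"
    if "x \<in> set Q" "k < ?n" for x k
  proof -
    have k: "L ! k \<in> set L" using that by simp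
    consider "x = ?y" | "x = last Q" | "x \<noteq> ?y" "x \<noteq> last Q" by blast
    then show ?thesis
    proof cases
      case 1 then show ?thesis using hl that by (simp add: K_def)
    next
      case 2 then show ?thesis using hl lst[OF k] that neL by (auto simp: neL hdL lastL idx)
    next
      case 3 then show ?thesis using int[OF that(1) _ _ k] by auto
    qed
  qed
  have tk: "x \<in> set (take (Suc i) L) \<longleftrightarrow> (\<exists>k\<le>i. x = L ! k)" if "i < ?n" for x i
    using that nth_image[of "Suc i" L, symmetric] by (simp del: take_Suc_Cons) (auto simp: less_Suc_eq_le)
  have dp: "x \<in> set (drop i L) \<longleftrightarrow> (\<exists>k. i \<le> k \<and> k < ?n \<and> x = L ! k)" if "i < ?n" for x i
  proof
    assume "x \<in> set (drop i L)"
    then obtain j where "j < ?n - i" "x = L ! (i + j)" by (auto simp: in_set_conv_nth)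
    then show "\<exists>k. i \<le> k \<and> k < ?n \<and> x = L ! k" by (intro exI[of _ "i + j"]) auto
  next
    assume "\<exists>k. i \<le> k \<and> k < ?n \<and> x = L ! k"
    then obtain k where "i \<le> k" "k < ?n" "x = L ! k" by blast
    then show "x \<in> set (drop i L)" using nth_mem[of "k - i" "drop i L"] by simp
  qed
  have hdt: "hd (take (Suc i) L) = L ! 0" "last (take (Suc i) L) = L ! i" if "i < ?n" for i
    using that by (simp add: hdL) (simp add: that take_Suc_conv_app_nth)
  have hdd: "hd (drop i L) = L ! i" "last (drop i L) = L ! (?n - 1)" if "i < ?n" for i
    using that by (auto simp: hd_drop_conv_nth lastL)
  have pt: "chordless_path E (take (Suc i) L)" if "Suc i < ?n" for i
    using chordless_cycle_take[OF L(1)] that by simp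
  have pd: "chordless_path E (drop i L)" if "0 < i" "i < ?n" for i
    using chordless_cycle_drop[OF L(1)] that by simp
  have stV: "set (take i L) \<subseteq> V" "set (drop i L) \<subseteq> V" for i
    using L(2) by (auto dest: in_set_takeD in_set_dropD)
  have stQ: "set Q \<inter> set (take i L) = {}" "set Q \<inter> set (drop i L) = {}" for i
    using Q(4) by (auto dest: in_set_takeD in_set_dropD)
  \<comment> \<open>First hole: \<open>Q\<close>, closed by the initial part of \<open>L\<close> up
    to the first neighbour of \<open>?y\<close>. The second one, in \<open>c2\<close>, is closed by
    the final part from the last neighbour on.\<close>
  have c1: "even (length Q + Suc c)"
  proof -
    have "chordless_cycle E (Q @ take (Suc c) L)"
    proof (rule chordless_cycle_append[OF sym])
      show "4 \<le> length Q + length (take (Suc c) L)" using Q(3) c0 cd dn by auto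
      fix x z assume x: "x \<in> set Q" "z \<in> set (take (Suc c) L)"
      then obtain k where k: "k \<le> c" "z = L ! k" using tk cd dn by auto
      have kn: "k < ?n" "k \<noteq> ?n - 1" using k cd dn by auto
      have "k \<in> K \<longleftrightarrow> k = c" using lo[of k] k cK by auto
      then show "E x z \<longleftrightarrow> x = last Q \<and> z = hd (take (Suc c) L) \<or> x = hd Q \<and> z = last (take (Suc c) L)"
        using crossQ[OF x(1) kn(1)] kn k cd dn c0 by (auto simp: neL hdL lastL hdt idx)
    qed (use Q pt stQ cd dn' in auto)
    then have "even (length (Q @ take (Suc c) L))"
      using hole_even[of "Q @ take (Suc c) L"] stV Q c0 cd dn by auto
    moreover have "min ?n (Suc c) = Suc c" using cd dn by auto
    ultimately show ?thesis by simp
  qed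
  have c2: "even (length Q + (?n - d))"
  proof -
    have "chordless_cycle E (rev Q @ drop d L)"
    proof (rule chordless_cycle_append[OF sym])
      show "4 \<le> length (rev Q) + length ((drop d L))" using Q(3) dn' by auto
      fix x z assume x: "x \<in> set (rev Q)" "z \<in> set ((drop d L))"
      then obtain k where k: "d \<le> k" "k < ?n" "z = L ! k" using dp dn by auto
      have "k \<in> K \<longleftrightarrow> k = d" using hi[of k] k dK by auto
      then show "E x z \<longleftrightarrow> x = last (rev Q) \<and> z = hd ((drop d L)) \<or> x = hd (rev Q) \<and> z = last ((drop d L))"
        using crossQ[of x k] x k cd c0 dn hl by (auto simp: neL hdL lastL hdd idx hd_rev last_rev)
    qed (use Q pd stQ cd c0 dn' chordless_path_rev in auto)
    then have "even (length (rev Q @ drop d L))"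
      using hole_even[of "rev Q @ drop d L"] stV Q c0 cd dn' by auto
    then show ?thesis by simp
  qed
  \<comment> \<open>The two holes have \<open>length Q + c + 1\<close> and
    \<open>length Q + ?n - d\<close> vertices, and \<open>?n\<close> is even.\<close>
  have ncd: "odd (c + d)" using c1 c2 evL dn by presburger
  have "d = Suc c"
  proof (rule ccontr)
    \<comment> \<open>Third hole: from \<open>?y\<close> to \<open>L ! d\<close>, along
      \<open>L\<close> across the edge between \<open>last L\<close> and \<open>hd L\<close> to
      \<open>L ! c\<close>, and back. Its \<open>?n - d + c + 2\<close> vertices are odd in number,
      as \<open>c + d\<close> is odd.\<close>
    assume "d \<noteq> Suc c"
    moreover have "c \<noteq> d" using ncd by auto
    ultimately have gap: "Suc c < d" using cd by auto
    have path: "chordless_path E (drop d L @ take (Suc c) L)"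
    proof (rule chordless_path_append[OF sym])
      show "set (drop d L) \<inter> set (take (Suc c) L) = {}"
      proof -
        { fix x assume x: "x \<in> set (drop d L)" "x \<in> set (take (Suc c) L)"
          then obtain k k' where "d \<le> k" "k < ?n" "x = L ! k" "k' \<le> c" "x = L ! k'"
            using tk[of c x] dp[of d x] gap dn by auto
          then have False using idx[of k k'] gap by auto }
        then show ?thesis by blast
      qed
      fix x z assume x: "x \<in> set (drop d L)" "z \<in> set (take (Suc c) L)"
      then obtain k k' where k: "d \<le> k" "k < ?n" "x = L ! k" "k' \<le> c" "z = L ! k'"
            using tk[of c z] dp[of d x] gap dn by auto
      then show "E x z \<longleftrightarrow> x = last (drop d L) \<and> z = hd (take (Suc c) L)"
        using cyc[of k k'] gap dn by (auto simp: neL hdL lastL hdt hdd idx)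
    qed (use pt pd c0 gap dn' in auto)
    have "chordless_cycle E ([?y] @ (drop d L @ take (Suc c) L))"
    proof (rule chordless_cycle_append[OF sym _ path])
      show "chordless_path E [?y]" using irr by (simp add: chordless_path_def)
      show "set [?y] \<inter> set (drop d L @ take (Suc c) L) = {}"
        using stQ hl by (auto dest: in_set_takeD in_set_dropD simp: yL)
      show "4 \<le> length [?y] + length (drop d L @ take (Suc c) L)" using dn' c0 gap by auto
      fix x z assume x: "x \<in> set [?y]" "z \<in> set (drop d L @ take (Suc c) L)"
      then have "(\<exists>k\<ge>d. k < ?n \<and> z = L ! k) \<or> (\<exists>k\<le>c. z = L ! k)"
        using tk[of c z] dp[of d z] gap dn by auto
      moreover have "k < ?n" if "k \<le> c" for k using that gap dn by simp
      ultimately obtain k where k: "k < ?n" "z = L ! k" "d \<le> k \<or> k \<le> c" by blast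
      then have "k \<in> K \<longleftrightarrow> k = c \<or> k = d" using hi[of k] lo[of k] cK dK cd by auto
      then have "E ?y z \<longleftrightarrow> z = L ! c \<or> z = L ! d" using k gap dn by (auto simp: K_def idx)
      moreover have "drop d L \<noteq> []" "take (Suc c) L \<noteq> []" using dn neL by auto
      ultimately show "E x z \<longleftrightarrow> x = last [?y] \<and> z = hd (drop d L @ take (Suc c) L) \<or>
          x = hd [?y] \<and> z = last (drop d L @ take (Suc c) L)"
        using x gap dn by (auto simp: neL hdL lastL hdd hdt)
    qed
    then have "even (length ([?y] @ (drop d L @ take (Suc c) L)))"
      using hole_even[of "[?y] @ (drop d L @ take (Suc c) L)"] stV yV c0 gap dn' by auto
    moreover have "min ?n (Suc c) = Suc c" using cd dn by auto
    ultimately have "even (Suc (?n - d + Suc c))" by simp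
    then show False using evL ncd dn by presburger
  qed
  then have d: "d = Suc c" .
  show thesis
  proof
    show "0 < c" "c + 2 < ?n" using c0 d dn' by auto
    show "E ?y (L ! k) \<longleftrightarrow> k = c \<or> k = Suc c" if "k < ?n" for k
      using lo[of k] hi[of k] cK dK d that by (auto simp: K_def)
    show "odd (length Q + c)" using c1 by auto
    \<comment> \<open>One triangle is \<open>last Q\<close>, \<open>hd L\<close>,
      \<open>last L\<close>, the other \<open>?y\<close>, \<open>L ! c\<close>,
      \<open>L ! Suc c\<close>. The second part of \<open>L\<close> is reversed so that all three
      lists start in the first triangle.\<close>
    show "prism E (rev Q) (take (Suc c) L) (rev (drop (Suc c) L))"
      unfolding prism_def
    proof (intro conjI)
      show "linked E (rev Q) (take (Suc c) L)"
        unfolding linked_def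
      proof (intro conjI ballI)
        fix x z assume x: "x \<in> set (rev Q)" "z \<in> set (take (Suc c) L)"
        then obtain k where k: "k \<le> c" "z = L ! k" using tk cd dn by auto
        then show "E x z \<longleftrightarrow> x = hd (rev Q) \<and> z = hd (take (Suc c) L) \<or> x = last (rev Q) \<and> z = last (take (Suc c) L)"
          using x crossQ[of x k] lo[of k] cK d dn' hl by (auto simp: neL hdL lastL hdt idx hd_rev last_rev)
      qed (use stQ in auto)
      show "linked E (rev Q) (rev (drop (Suc c) L))"
        unfolding linked_def
      proof (intro conjI ballI)
        fix x z assume x: "x \<in> set (rev Q)" "z \<in> set (rev (drop (Suc c) L))"
        then obtain k where k: "d \<le> k" "k < ?n" "z = L ! k" using dp dn d by auto
        then show "E x z \<longleftrightarrow> x = hd (rev Q) \<and> z = hd (rev (drop (Suc c) L)) \<or> x = last (rev Q) \<and> z = last (rev (drop (Suc c) L))"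
          using x crossQ[of x k] hi[of k] dK d dn' hl by (auto simp: neL hdL lastL hdd idx hd_rev last_rev)
      qed (use stQ in auto)
      show "linked E (take (Suc c) L) (rev (drop (Suc c) L))"
        unfolding linked_def
      proof (intro conjI ballI)
        show "set (take (Suc c) L) \<inter> set (rev (drop (Suc c) L)) = {}"
          using dL by (simp add: set_take_disj_set_drop_if_distinct)
        fix x z assume x: "x \<in> set (take (Suc c) L)" "z \<in> set (rev (drop (Suc c) L))"
        then obtain k k' where k: "d \<le> k" "k < ?n" "z = L ! k" "k' \<le> c" "x = L ! k'"
          using dp[of d z] tk[of c x] dn d by auto
        then show "E x z \<longleftrightarrow> x = hd (take (Suc c) L) \<and> z = hd (rev (drop (Suc c) L)) \<or> x = last (take (Suc c) L) \<and> z = last (rev (drop (Suc c) L))"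
          using cyc[of k' k] d dn' by (auto simp: neL hdL lastL hdd hdt idx hd_rev last_rev)
      qed
      show "chordless_path E (rev (drop (Suc c) L))"
        using chordless_path_rev[OF pd[of "Suc c"]] d dn' by simp
    qed (use Q pt chordless_path_rev d dn' c0 in auto)
  qed
qed

end

section \<open>Minimum even prisms\<close>

context odd_hole_free begin

text \<open>\<open>length\<close> counts vertices, so a path of even length is a list of odd
  \<open>length\<close>.\<close>

definition even_prism_paths :: "'a list \<Rightarrow> 'a list \<Rightarrow> 'a list \<Rightarrow> bool" where
  "even_prism_paths p q r \<longleftrightarrow> prism E p q r \<and> odd (length p) \<and> odd (length q) \<and> odd (length r) \<and>
     set p \<subseteq> V \<and> set q \<subseteq> V \<and> set r \<subseteq> V"

definition min_prism :: "'a list \<Rightarrow> 'a list \<Rightarrow> 'a list \<Rightarrow> bool" where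
  "min_prism p q r \<longleftrightarrow> even_prism_paths p q r \<and>
     (\<forall>p' q' r'. even_prism_paths p' q' r' \<longrightarrow>
        length p + length q + length r \<le> length p' + length q' + length r')"

lemma min_prism_rotate: "min_prism p q r \<Longrightarrow> min_prism q r p"
  unfolding min_prism_def even_prism_paths_def using prism_rotate by (auto simp: add_ac)

lemma min_prism_swap: "min_prism p q r \<Longrightarrow> min_prism p r q"
  unfolding min_prism_def even_prism_paths_def using prism_swap by (auto simp: add_ac)

lemma min_prism_rev: "min_prism p q r \<Longrightarrow> min_prism (rev p) (rev q) (rev r)"
  unfolding min_prism_def even_prism_paths_def using prism_rev by auto

text \<open>Two paths of a prism close up to a hole once one of them is reversed. Together with
  \<open>hole_even\<close> this gives them the same parity.\<close>

lemma linked_cycle: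
  assumes "chordless_path E p" "chordless_path E q" "linked E p q" "4 \<le> length p + length q"
  shows "chordless_cycle E (p @ rev q)"
proof (rule chordless_cycle_append[OF sym assms(1) chordless_path_rev[OF assms(2)]])
  have ne: "p \<noteq> []" "q \<noteq> []" using assms by (auto simp: chordless_path_def)
  fix x y assume "x \<in> set p" "y \<in> set (rev q)"
  then show "E x y \<longleftrightarrow> x = last p \<and> y = hd (rev q) \<or> x = hd p \<and> y = last (rev q)"
    using assms(3) ne by (auto simp: linked_def hd_rev last_rev)
qed (use assms in \<open>auto simp: linked_def\<close>)

text \<open>Converts absence of edges into disjointness: a vertex without neighbours on such a path
  cannot lie on it.\<close>

lemma path_neighbour:
  assumes "chordless_path E p" "2 \<le> length p" "x \<in> set p"
  shows "\<exists>z\<in>set p. E x z"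
proof -
  obtain i where i: "i < length p" "x = p ! i" using assms by (auto simp: in_set_conv_nth)
  define j where "j = (if i = 0 then 1 else i - 1)"
  have "j < length p" "j = Suc i \<or> i = Suc j" using i assms by (auto simp: j_def)
  then show ?thesis using assms i unfolding chordless_path_def by (metis nth_mem)
qed

abbreviation four_ends :: "'a list \<Rightarrow> 'a list \<Rightarrow> 'a set" where
  "four_ends q r \<equiv> {hd q, hd r, last q, last r}"

lemma linked_no_edge:
  assumes "linked E p q" "x \<in> set p" "x \<noteq> hd p" "x \<noteq> last p" "z \<in> set q" shows "\<not> E x z"
  using assms unfolding linked_def by blast

text \<open>The hole \<open>q @ rev r\<close> is seen by \<open>hd p\<close> exactly in its first
  and last entry, so \<open>attachment\<close> applies. If \<open>c\<close> were even, all three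
  paths of the new prism would have an odd number of vertices; it would be an even prism in which
  \<open>Q\<close> takes the place of the longer \<open>p\<close>, against minimality.\<close>

lemma attachment_odd:
  assumes K: "min_prism p q r"
    and Q: "chordless_path E Q" "set Q \<subseteq> V" "2 \<le> length Q" "length Q < length p" "last Q = hd p"
    and int: "\<And>x z. x \<in> set Q \<Longrightarrow> x \<noteq> hd Q \<Longrightarrow> x \<noteq> last Q \<Longrightarrow> z \<in> set q \<union> set r \<Longrightarrow> \<not> E x z"
    and y: "hd Q \<notin> set q \<union> set r" "\<not> E (hd Q) (hd q)" "\<not> E (hd Q) (hd r)"
      "\<not> E (hd Q) (last q)" "\<not> E (hd Q) (last r)"
    and z0: "z0 \<in> set q" "E (hd Q) z0"
  obtains c where "odd c" "Suc c < length q"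
    "\<And>k. k < length q \<Longrightarrow> E (hd Q) (q ! k) \<longleftrightarrow> k = c \<or> k = Suc c"
proof -
  let ?L = "q @ rev r"
  have pr: "prism E p q r" and odd: "odd (length q)" "odd (length r)" "odd (length p)"
    and V: "set q \<subseteq> V" "set r \<subseteq> V"
    using K by (auto simp: min_prism_def even_prism_paths_def)
  have cp: "chordless_path E q" "chordless_path E r" "2 \<le> length q" "2 \<le> length r"
    and lk: "linked E p q" "linked E p r" "linked E q r" and pne: "p \<noteq> []"
    using pr by (auto simp: prism_def)
  then have ne: "q \<noteq> []" "r \<noteq> []" by auto
  have cyc: "chordless_cycle E ?L" using linked_cycle cp lk by simp
  have hp: "hd p \<in> set p" using pne by simp
  have qr: "set q \<inter> set r = {}" "set p \<inter> set q = {}" "set p \<inter> set r = {}" using lk by (auto simp: linked_def)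
  have Qne: "Q \<noteq> []" using Q by auto
  have disj: "set Q \<inter> set ?L = {}"
  proof -
    { fix x assume x: "x \<in> set Q" "x \<in> set ?L"
      then obtain z where "z \<in> set q \<union> set r" "E x z"
        using path_neighbour[of q x] path_neighbour[of r x] cp by auto
      then have "x = hd Q \<or> x = last Q" using int x by blast
      then have False using y(1) Q(5) hp qr x by auto }
    then show ?thesis by blast
  qed
  obtain c where c: "0 < c" "c + 2 < length ?L"
    "\<And>k. k < length ?L \<Longrightarrow> E (hd Q) (?L ! k) \<longleftrightarrow> k = c \<or> k = Suc c"
    "odd (length Q + c)" "prism E (rev Q) (take (Suc c) ?L) (rev (drop (Suc c) ?L))"
  proof (rule attachment[OF cyc _ _ Q(1,2,3) disj])
    show "E (last Q) z \<longleftrightarrow> z = hd ?L \<or> z = last ?L" if "z \<in> set ?L" for z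
    proof -
      have "hd p \<noteq> last p" using pr pne
        by (auto simp: prism_def chordless_path_def hd_conv_nth last_conv_nth nth_eq_iff_index_eq)
      moreover have "hd q \<in> set q" "hd r \<in> set r" using ne by auto
      ultimately show ?thesis
        using that Q(5) lk hp ne qr unfolding linked_def by (auto simp: last_rev)
    qed
    show "z0 \<in> set ?L" "E (hd Q) z0" using z0 by auto
    show "\<not> E (hd Q) (hd ?L)" "\<not> E (hd Q) (last ?L)" using y ne by (auto simp: last_rev)
    show "\<And>x z. x \<in> set Q \<Longrightarrow> x \<noteq> hd Q \<Longrightarrow> x \<noteq> last Q \<Longrightarrow> z \<in> set ?L \<Longrightarrow> \<not> E x z"
      using int by auto
  qed (use V cp in auto)
  have oc: "odd c"
  proof
    assume "even c"
    then have "even_prism_paths (rev Q) (take (Suc c) ?L) (rev (drop (Suc c) ?L))"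
      unfolding even_prism_paths_def using c(2,4,5) Q(2) V odd
      by (auto dest!: in_set_takeD in_set_dropD simp: min_def)
    then have "length p + length q + length r \<le> length (rev Q) + length (take (Suc c) ?L) + length (rev (drop (Suc c) ?L))"
      using K unfolding min_prism_def by blast
    then show False using Q(4) c(2) by auto
  qed
  obtain k0 where k0: "k0 < length q" "z0 = q ! k0" using z0 by (auto simp: in_set_conv_nth)
  have cq: "k0 = c \<or> k0 = Suc c" using c(3)[of k0] k0 z0 by (auto simp: nth_append)
  \<comment> \<open>The only consecutive positions of \<open>?L\<close> that lie on different paths
    are those of \<open>last q\<close> and \<open>last r\<close>, which \<open>hd Q\<close> does not
    see. As one neighbour is on \<open>q\<close>, both are.\<close>
  have "length q - 1 \<noteq> c"
    using c(3)[of "length q - 1"] y ne cp(3) by (auto simp: nth_append last_conv_nth)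
  moreover have "length q \<noteq> Suc c"
    using c(3)[of "length q"] y ne by (auto simp: nth_append rev_nth last_conv_nth)
  ultimately have "Suc c < length q" using cq k0 by auto
  moreover have "E (hd Q) (q ! k) \<longleftrightarrow> k = c \<or> k = Suc c" if "k < length q" for k
    using c(3)[of k] that by (auto simp: nth_append)
  ultimately show thesis using that oc by blast
qed

text \<open>\<open>attachment_odd\<close> is applied with \<open>Q\<close> and, in the reversed
  prism, with \<open>R\<close>. The two neighbours of \<open>y\<close> on \<open>q\<close> are then
  at \<open>c\<close>, \<open>c + 1\<close> from the front and at \<open>d\<close>,
  \<open>d + 1\<close> from the back, with \<open>c\<close> and \<open>d\<close> odd. So
  \<open>q\<close> has \<open>c + d + 2\<close> vertices, an even number.\<close>

lemma no_attachment:
  assumes K: "min_prism p q r"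
    and Q: "chordless_path E Q" "set Q \<subseteq> V" "2 \<le> length Q" "length Q < length p" "last Q = hd p"
    and R: "chordless_path E R" "set R \<subseteq> V" "2 \<le> length R" "length R < length p" "last R = last p"
    and y: "hd Q = y" "hd R = y" "y \<notin> set q \<union> set r" "\<not> E y (hd q)" "\<not> E y (hd r)" "\<not> E y (last q)" "\<not> E y (last r)"
    and int: "\<And>x z. x \<in> set Q \<union> set R \<Longrightarrow> x \<noteq> y \<Longrightarrow> x \<noteq> hd p \<Longrightarrow> x \<noteq> last p \<Longrightarrow> z \<in> set q \<union> set r \<Longrightarrow> \<not> E x z"
    and lp: "last p \<notin> set Q" "hd p \<notin> set R"
    and z: "z \<in> set q \<union> set r"
  shows "\<not> E y z"
proof
  assume Eyz: "E y z"
  have main: False if K: "min_prism p q r" and z0: "z \<in> set q"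
    and y': "y \<notin> set q \<union> set r" "\<not> E y (hd q)" "\<not> E y (hd r)" "\<not> E y (last q)" "\<not> E y (last r)"
    and int: "\<And>x z. x \<in> set Q \<union> set R \<Longrightarrow> x \<noteq> y \<Longrightarrow> x \<noteq> hd p \<Longrightarrow> x \<noteq> last p \<Longrightarrow> z \<in> set q \<union> set r \<Longrightarrow> \<not> E x z"
    for q r
  proof -
    have ne: "p \<noteq> []" "q \<noteq> []" "r \<noteq> []" and odd: "odd (length q)"
      using K by (auto simp: min_prism_def even_prism_paths_def prism_def)
    obtain c where c: "odd c" "Suc c < length q"
      "\<And>k. k < length q \<Longrightarrow> E y (q ! k) \<longleftrightarrow> k = c \<or> k = Suc c"
    proof (rule attachment_odd[OF K Q, unfolded y(1), OF _ y' z0 Eyz])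
      fix x z assume "x \<in> set Q" "x \<noteq> y" "x \<noteq> last Q" "z \<in> set q \<union> set r"
      then show "\<not> E x z" using int[of x z] Q(5) lp by fastforce
    qed (rule that; assumption)
    obtain d where d: "odd d" "Suc d < length (rev q)"
      "\<And>k. k < length (rev q) \<Longrightarrow> E y (rev q ! k) \<longleftrightarrow> k = d \<or> k = Suc d"
    proof (rule attachment_odd[OF min_prism_rev[OF K] R(1-3), unfolded y(2)])
      fix x z assume "x \<in> set R" "x \<noteq> y" "x \<noteq> last R" "z \<in> set (rev q) \<union> set (rev r)"
      then show "\<not> E x z" using int[of x z] R(5) lp by auto
    next
      show "last R = hd (rev p)" "length R < length (rev p)" using R ne by (auto simp: hd_rev)
      show "z \<in> set (rev q)" using z0 by simp
    qed (use Eyz y' ne in \<open>auto simp: hd_rev last_rev\<close>)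
    \<comment> \<open>The position in \<open>q\<close> of entry \<open>d\<close> of
      \<open>rev q\<close>; entry \<open>Suc d\<close> is one place before it.\<close>
    let ?k = "length q - Suc d"
    have "E y (q ! ?k)" "E y (q ! (?k - 1))" using d(3)[of d] d(3)[of "Suc d"] d(2) by (auto simp: rev_nth)
    moreover have "?k < length q" "?k - 1 < length q" "0 < ?k" using d(2) by auto
    ultimately have "(?k = c \<or> ?k = Suc c) \<and> (?k - 1 = c \<or> ?k - 1 = Suc c)" using c(3) by blast
    then have "?k = Suc c" using \<open>0 < ?k\<close> by linarith
    then show False using odd c(1) d(1,2) by presburger
  qed
  show False
  proof (cases "z \<in> set q")
    case True
    show False by (rule main[OF K True y(3-7) int])
  next
    case False
    then have "z \<in> set r" using z by blast
    show False
      by (rule main[OF min_prism_swap[OF K] \<open>z \<in> set r\<close>]) (use y int in auto)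
  qed
qed

text \<open>Parity need not be assumed for the new path: the hole \<open>p' @ rev q\<close> is even
  and \<open>q\<close> has an odd number of vertices.\<close>

lemma even_prism_paths_replace:
  assumes K: "even_prism_paths p q r"
    and p': "chordless_path E p'" "hd p' = hd p" "last p' = last p" "set p' \<subseteq> V"
    and int: "\<And>x z. x \<in> set p' \<Longrightarrow> x \<noteq> hd p \<Longrightarrow> x \<noteq> last p \<Longrightarrow> z \<in> set q \<union> set r \<Longrightarrow> \<not> E x z"
  shows "even_prism_paths p' q r"
proof -
  have pr: "prism E p q r" using K by (auto simp: even_prism_paths_def)
  have ne: "p \<noteq> []" "p' \<noteq> []" "q \<noteq> []" using pr p' by (auto simp: prism_def chordless_path_def)
  have hl: "hd p \<noteq> last p" using pr ne
        by (auto simp: prism_def chordless_path_def hd_conv_nth last_conv_nth nth_eq_iff_index_eq)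
  have lk: "linked E p' s" if s: "linked E p s" "chordless_path E s" "2 \<le> length s" "set s \<subseteq> set q \<union> set r" for s
    unfolding linked_def
  proof (intro conjI ballI)
    have pp: "hd p \<in> set p" "last p \<in> set p" using ne by auto
    show "set p' \<inter> set s = {}"
    proof -
      { fix x assume x: "x \<in> set p'" "x \<in> set s"
        then obtain z where "z \<in> set s" "E x z" using path_neighbour s by blast
        then have "x = hd p \<or> x = last p" using int x s by blast
        then have False using pp x s(1) by (auto simp: linked_def) }
      then show ?thesis by blast
    qed
    fix x z assume xz: "x \<in> set p'" "z \<in> set s"
    show "E x z \<longleftrightarrow> x = hd p' \<and> z = hd s \<or> x = last p' \<and> z = last s"
    proof (cases "x = hd p \<or> x = last p")
      case True
      then have "x \<in> set p" using pp by auto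
      then show ?thesis using s(1) xz p' unfolding linked_def by auto
    next
      case False
      then show ?thesis using int xz s p' by auto
    qed
  qed
  have l2: "2 \<le> length p'"
  proof -
    have "length p' \<noteq> 1" using hl p' by (auto simp: length_Suc_conv)
    moreover have "length p' \<noteq> 0" using ne by simp
    ultimately show ?thesis by linarith
  qed
  have "prism E p' q r" using pr p' lk l2 unfolding prism_def by auto
  moreover have "odd (length p')"
  proof -
    have "chordless_cycle E (p' @ rev q)"
      by (rule linked_cycle) (use \<open>prism E p' q r\<close> in \<open>auto simp: prism_def\<close>)
    then have "even (length (p' @ rev q))" using hole_even[of "p' @ rev q"] p' K l2 pr
      by (auto simp: even_prism_paths_def prism_def)
    then show ?thesis using K by (auto simp: even_prism_paths_def)
  qed
  ultimately show ?thesis using K p' by (auto simp: even_prism_paths_def)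
qed

text \<open>An inner vertex of \<open>w\<close> with a neighbour on \<open>q\<close> or \<open>r\<close> would attach to them both towards
  \<open>hd p\<close> and towards \<open>last p\<close>, which is impossible by parity; so \<open>w\<close> can replace the first half
  of \<open>p\<close>.\<close>

lemma replace_first_half:
  assumes K: "min_prism p q r" and e: "length p = 2 * e + 1"
    and w: "successively E w" "w \<noteq> []" "hd w = hd p" "last w = p ! e" "length w \<le> Suc e" "set w \<subseteq> V"
    and adj: "\<And>i x. 0 < i \<Longrightarrow> Suc i < length w \<Longrightarrow> x \<in> four_ends q r \<Longrightarrow> \<not> E (w ! i) x"
  shows "length w = Suc e \<and> min_prism (w @ drop (Suc e) p) q r"
proof -
  have pr: "prism E p q r" and epp: "even_prism_paths p q r" and V: "set p \<subseteq> V"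
    using K by (auto simp: min_prism_def even_prism_paths_def)
  have lk: "linked E p q" "linked E p r" and cp: "chordless_path E p" "chordless_path E q" "chordless_path E r"
    and l2: "2 \<le> length p" "2 \<le> length q" "2 \<le> length r" using pr by (auto simp: prism_def)
  have ne: "p \<noteq> []" "q \<noteq> []" "r \<noteq> []" using l2 by auto
  have e0: "0 < e" using l2 e by auto
  have dp: "distinct p" and sp: "successively E p" using cp chordless_path_successively by (auto simp: chordless_path_def)
  have hdp: "hd p = p ! 0" and lastp: "last p = p ! (2 * e)" using ne e by (auto simp: hd_conv_nth last_conv_nth)
  have inner: "\<not> E (p ! k) z" if "0 < k" "k < 2 * e" "z \<in> set q \<union> set r" for k z
  proof -
    have "p ! k \<noteq> hd p" "p ! k \<noteq> last p" using that dp e by (auto simp: hdp lastp nth_eq_iff_index_eq)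
    moreover have "p ! k \<in> set p" using that e by simp
    ultimately show ?thesis using linked_no_edge lk that(3) by blast
  qed
  have hpq: "E (hd p) (hd q)" "E (last p) (last q)" using lk ne unfolding linked_def by auto
  have lastw: "w ! (length w - 1) = p ! e" using w by (simp add: last_conv_nth)
  have consw: "E (w ! i) (w ! Suc i)" if "Suc i < length w" for i
    using w(1) that by (simp add: successively_conv_nth)
  have split: "successively E (take e p @ (p ! e) # drop (Suc e) p)"
    using sp e by (simp add: id_take_nth_drop[symmetric])
  have free: "\<not> E (w ! i) z" if i: "0 < i" "Suc i < length w" "z \<in> set q \<union> set r" for i z
  proof
    assume Ez: "E (w ! i) z"
    define S where "S = {j. 0 < j \<and> Suc j < length w \<and> (\<exists>z\<in>set q \<union> set r. E (w ! j) z)}"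
    have S: "finite S" by (rule finite_subset[of _ "{..<length w}"]) (auto simp: S_def)
    have "i \<in> S" using that Ez by (auto simp: S_def)
    define j where "j = Max S"
    have "S \<noteq> {}" using \<open>i \<in> S\<close> by blast
    then have jS: "j \<in> S" unfolding j_def using S by (rule Max_in[rotated])
    have jmax: "\<And>k. k \<in> S \<Longrightarrow> k \<le> j" using S by (auto simp: j_def)
    from jS obtain z where j: "0 < j" "Suc j < length w" and z: "z \<in> set q \<union> set r" "E (w ! j) z"
      by (auto simp: S_def)
    let ?y = "w ! j"
    \<comment> \<open>The last entry of \<open>w\<close> was not a candidate for \<open>S\<close>,
      but it is \<open>p ! e\<close>, an inner vertex of \<open>p\<close>.\<close>
    have later: "\<not> E (w ! k) z" if "j < k" "k < length w" "z \<in> set q \<union> set r" for k z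
    proof (cases "Suc k < length w")
      case True
      then show ?thesis using jmax[of k] that by (auto simp: S_def)
    next
      case False
      then have "w ! k = p ! e" using that lastw by (metis Suc_lessI diff_Suc_1)
      then show ?thesis using inner[of e z] e0 that by simp
    qed
    \<comment> \<open>If \<open>?y\<close> were on \<open>q\<close> or \<open>r\<close>, the next
      vertex of \<open>w\<close> would have the neighbour \<open>?y\<close> there, against
      \<open>later\<close>.\<close>
    have yqr: "?y \<notin> set q \<union> set r"
      using later[of "Suc j" ?y] j sym[OF consw[of j]] by auto
    have yn: "\<not> E ?y (hd q)" "\<not> E ?y (hd r)" "\<not> E ?y (last q)" "\<not> E ?y (last r)"
      using adj[OF j] by auto
    have yp: "?y \<noteq> hd p" "?y \<noteq> last p" using hpq yn by auto
    have sw: "successively E (drop j w)"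
    proof -
      have "successively E (take j w @ drop j w)" using w by simp
      then show ?thesis unfolding successively_append_iff by blast
    qed
    have dw: "drop j w \<noteq> []" "last (drop j w) = p ! e" "hd (drop j w) = ?y"
      using j w by (auto simp: hd_drop_conv_nth)
    have tp: "take e p \<noteq> []" "drop (Suc e) p \<noteq> []" using e e0 ne by auto
    \<comment> \<open>Both walks follow \<open>w\<close> from \<open>?y\<close> to the middle vertex
      and then one half of \<open>p\<close> to its end. Since \<open>0 < j\<close>, at most
      \<open>e\<close> vertices come from \<open>w\<close> and exactly \<open>e\<close> from
      \<open>p\<close>, one fewer in total than \<open>p\<close> has.\<close>
    let ?A = "drop j w @ rev (take e p)" and ?B = "drop j w @ drop (Suc e) p"
    have symE: "(\<lambda>x y. E y x) = E" using sym by blast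
    have srev: "successively E (rev xs) = successively E xs" for xs
      unfolding successively_rev by (rule arg_cong[OF symE, of "\<lambda>P. successively P xs"])
    have sA: "successively E ?A"
      using split sw dw tp
      by (auto simp: successively_append_iff successively_Cons hd_rev srev simp del: successively_rev dest: sym)
    have sB: "successively E ?B"
      using split sw dw tp by (auto simp: successively_append_iff successively_Cons)
    have setA: "set ?A \<subseteq> V" "set ?B \<subseteq> V" using w V by (auto dest: in_set_takeD in_set_dropD)
    obtain Q where Q: "chordless_path E Q" "hd Q = hd ?A" "last Q = last ?A" "set Q \<subseteq> set ?A" "length Q \<le> length ?A"
      using shortcut_walk[OF sym irr sA] dw by (metis append_is_Nil_conv less_imp_le order_refl)
    obtain R where R: "chordless_path E R" "hd R = hd ?B" "last R = last ?B" "set R \<subseteq> set ?B" "length R \<le> length ?B"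
      using shortcut_walk[OF sym irr sB] dw by (metis append_is_Nil_conv less_imp_le order_refl)
    have hdQ: "hd Q = ?y" "hd R = ?y" using Q R dw by auto
    have lQ: "last Q = hd p" "last R = last p" using Q R tp by (auto simp: last_rev)
    have len2: "2 \<le> length s" if "chordless_path E s" "hd s \<noteq> last s" for s
    proof -
      have "length s \<noteq> 1" using that by (auto simp: length_Suc_conv)
      moreover have "length s \<noteq> 0" using that by (auto simp: chordless_path_def)
      ultimately show ?thesis by linarith
    qed
    have "length ?A < length p" "length ?B < length p" using e w(5) j by auto
    then have lens: "length Q < length p" "length R < length p" using Q R by auto
    have memA: "x = ?y \<or> (\<exists>k. j < k \<and> k < length w \<and> x = w ! k) \<or> (\<exists>k<e. x = p ! k)" if "x \<in> set ?A" for x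
    proof -
      have "x \<in> set (drop j w) \<or> x \<in> set (take e p)" using that by auto
      then show ?thesis
      proof
        assume "x \<in> set (drop j w)"
        then obtain k where "k < length w - j" "x = w ! (j + k)" by (auto simp: in_set_conv_nth)
        then show ?thesis by (cases k) (auto intro!: exI[of _ "j + k"])
      next
        assume "x \<in> set (take e p)"
        then show ?thesis using e by (auto simp: in_set_conv_nth)
      qed
    qed
    have memB: "x = ?y \<or> (\<exists>k. j < k \<and> k < length w \<and> x = w ! k) \<or> (\<exists>k. e < k \<and> k \<le> 2 * e \<and> x = p ! k)" if "x \<in> set ?B" for x
    proof -
      have "x \<in> set (drop j w) \<or> x \<in> set (drop (Suc e) p)" using that by auto
      then show ?thesis
      proof
        assume "x \<in> set (drop j w)"
        then obtain k where "k < length w - j" "x = w ! (j + k)" by (auto simp: in_set_conv_nth)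
        then show ?thesis by (cases k) (auto intro!: exI[of _ "j + k"])
      next
        assume "x \<in> set (drop (Suc e) p)"
        then obtain k where "k < length p - Suc e" "x = p ! (Suc e + k)" by (auto simp: in_set_conv_nth)
        then show ?thesis using e by (intro disjI2 exI[of _ "Suc e + k"]) auto
      qed
    qed
    \<comment> \<open>The ends of \<open>p\<close> have neighbours on \<open>q\<close>, so
      \<open>later\<close> keeps them off the rest of \<open>w\<close>.\<close>
    have wk: "w ! k \<noteq> hd p" "w ! k \<noteq> last p" if "j < k" "k < length w" for k
      using later[OF that] hpq ne by (metis UnCI hd_in_set, metis UnCI last_in_set)
    have pk: "p ! k = p ! l \<longleftrightarrow> k = l" if "k \<le> 2 * e" "l \<le> 2 * e" for k l
      using that e dp by (simp add: nth_eq_iff_index_eq)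
    have "\<not> E ?y z"
    proof (rule no_attachment[OF K Q(1) _ _ lens(1) lQ(1) R(1) _ _ lens(2) lQ(2) hdQ yqr yn _ _ _ z(1)])
      show "set Q \<subseteq> V" "set R \<subseteq> V" using Q R setA by auto
      show "2 \<le> length Q" "2 \<le> length R" using len2 Q(1) R(1) hdQ lQ yp by auto
      show "last p \<notin> set Q"
      proof
        assume "last p \<in> set Q"
        then have "last p \<in> set ?A" using Q by blast
        from memA[OF this] have "\<exists>k<e. last p = p ! k" using yp wk by metis
        then show False using e0 by (auto simp: lastp pk)
      qed
      show "hd p \<notin> set R"
      proof
        assume "hd p \<in> set R"
        then have "hd p \<in> set ?B" using R by blast
        from memB[OF this] have "\<exists>k. e < k \<and> k \<le> 2 * e \<and> hd p = p ! k" using yp wk by metis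
        then show False using e0 by (auto simp: hdp pk)
      qed
      fix x z assume x: "x \<in> set Q \<union> set R" "x \<noteq> ?y" "x \<noteq> hd p" "x \<noteq> last p" "z \<in> set q \<union> set r"
      then have "x \<in> set ?A \<or> x \<in> set ?B" using Q R by blast
      moreover have "k \<le> 2 * e" if "k < e" for k using that by simp
      ultimately consider k where "j < k" "k < length w" "x = w ! k" | k where "k \<le> 2 * e" "x = p ! k"
        using memA[of x] memB[of x] x(2) by metis
      then show "\<not> E x z"
      proof cases
        case 1 then show ?thesis using later x by blast
      next
        case 2
        have "k \<noteq> 0" "k \<noteq> 2 * e" using 2(2) x(3,4) hdp lastp by metis+
        then show ?thesis using inner[of k z] 2 x(5) by simp
      qed
    qed
    then show False using z by blast
  qed
  let ?W = "w @ drop (Suc e) p"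
  have Wne: "?W \<noteq> []" using w by simp
  have dne: "drop (Suc e) p \<noteq> []" using e e0 by simp
  have sW: "successively E ?W"
    using split w dne by (auto simp: successively_append_iff successively_Cons)
  have hW: "hd ?W = hd p" "last ?W = last p" using w dne by auto
  have VW: "set ?W \<subseteq> V" using w V by (auto dest: in_set_dropD)
  have free': "\<not> E x z" if "x \<in> set ?W" "x \<noteq> hd p" "x \<noteq> last p" "z \<in> set q \<union> set r" for x z
  proof (cases "x \<in> set w")
    case True
    then obtain k where k: "k < length w" "x = w ! k" by (auto simp: in_set_conv_nth)
    have k0: "k \<noteq> 0" using that(2) k(2) w(2,3) by (metis hd_conv_nth)
    show ?thesis
    proof (cases "Suc k < length w")
      case True
      then show ?thesis using free[of k z] k k0 that(4) by simp
    next
      case False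
      then have "k = length w - 1" using k(1) by simp
      then have "x = p ! e" using k(2) lastw by simp
      then show ?thesis using inner[of e z] e0 that(4) by simp
    qed
  next
    case False
    then have "x \<in> set (drop (Suc e) p)" using that by auto
    then obtain k where k: "k < length p - Suc e" "x = p ! (Suc e + k)" by (auto simp: in_set_conv_nth)
    then have "Suc e + k \<noteq> 2 * e" using that(3) lastp by metis
    then have "0 < Suc e + k" "Suc e + k < 2 * e" using k(1) e by linarith+
    then show ?thesis using inner[of "Suc e + k" z] that(4) k(2) by metis
  qed
  have rep: "even_prism_paths p' q r"
    if "chordless_path E p'" "hd p' = hd ?W" "last p' = last ?W" "set p' \<subseteq> set ?W" for p'
    by (rule even_prism_paths_replace[OF epp]) (use that hW VW free' in auto)
  have lenp: "length p \<le> length p'" if "even_prism_paths p' q r" for p'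
    using K that unfolding min_prism_def by fastforce
  have lenW: "length ?W \<le> length p" using w e by auto
  \<comment> \<open>Otherwise \<open>shortcut_walk\<close> gives a strictly shorter path with the
    same ends, and by \<open>rep\<close> an even prism smaller than the minimum.\<close>
  have "chordless_path E ?W"
    using shortcut_walk[OF sym irr sW Wne] rep lenp lenW by (metis leD order_less_le_trans)
  then have eW: "even_prism_paths ?W q r" using rep by blast
  have eq: "length ?W = length p" using lenp[OF eW] lenW by linarith
  then have "length w = Suc e" using e by simp
  then show ?thesis using eW K unfolding min_prism_def eq by blast
qed

text \<open>\<open>replace_first_half\<close> is used for \<open>w\<close>, then for
  \<open>u\<close> in the reversal of the prism so obtained. Both walks end in the middle vertex, so
  \<open>butlast\<close> keeps it from occurring twice.\<close>

lemma replace_path: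
  assumes K: "min_prism p q r" and e: "length p = 2 * e + 1"
    and w: "successively E w" "w \<noteq> []" "hd w = hd p" "last w = p ! e" "length w \<le> Suc e" "set w \<subseteq> V"
      "\<And>i x. 0 < i \<Longrightarrow> Suc i < length w \<Longrightarrow> x \<in> four_ends q r \<Longrightarrow> \<not> E (w ! i) x"
    and u: "successively E u" "u \<noteq> []" "hd u = last p" "last u = p ! e" "length u \<le> Suc e" "set u \<subseteq> V"
      "\<And>i x. 0 < i \<Longrightarrow> Suc i < length u \<Longrightarrow> x \<in> four_ends q r \<Longrightarrow> \<not> E (u ! i) x"
  shows "length w = Suc e" "length u = Suc e" "min_prism (butlast w @ rev u) q r"
    "hd (butlast w @ rev u) = hd p" "last (butlast w @ rev u) = last p"
proof -
  have ne: "p \<noteq> []" "q \<noteq> []" "r \<noteq> []" and e0: "0 < e"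
    using K e by (auto simp: min_prism_def even_prism_paths_def prism_def)
  let ?p = "w @ drop (Suc e) p"
  have 1: "length w = Suc e" "min_prism ?p q r"
    using replace_first_half[OF K e w] by auto
  \<comment> \<open>As \<open>w\<close> has exactly \<open>Suc e\<close> entries,
    \<open>p ! e\<close> is the middle vertex of the new path too.\<close>
  then have pe: "?p ! e = p ! e" "length ?p = 2 * e + 1" using w e by (auto simp: nth_append last_conv_nth)
  have dne: "drop (Suc e) p \<noteq> []" using e e0 by simp
  have 2: "length u = Suc e \<and> min_prism (u @ drop (Suc e) (rev ?p)) (rev q) (rev r)"
  proof (rule replace_first_half[OF min_prism_rev[OF 1(2)] _ u(1,2) _ _ u(5,6)])
    show "last u = rev ?p ! e" using pe u by (simp add: rev_nth del: rev_append)
    show "\<not> E (u ! i) x" if "0 < i" "Suc i < length u" "x \<in> four_ends (rev q) (rev r)" for i x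
      using u(7)[OF that(1,2)] that(3) ne by (auto simp: hd_rev last_rev)
  qed (use pe u dne in \<open>auto simp: hd_rev\<close>)
  have "rev (u @ drop (Suc e) (rev ?p)) = butlast w @ rev u"
    using 1(1) e by (simp add: drop_rev rev_drop butlast_conv_take)
  then show "length w = Suc e" "length u = Suc e" "min_prism (butlast w @ rev u) q r"
    using 1 2 min_prism_rev[of "u @ drop (Suc e) (rev ?p)" "rev q" "rev r"] by auto
  show "hd (butlast w @ rev u) = hd p" "last (butlast w @ rev u) = last p"
    using u w 1 e0 by (auto simp: last_rev hd_append butlast_conv_take)
qed

end

section \<open>Candidate prisms given by positions on three paths\<close>

lemma all3: "(\<forall>i<3. R i) \<longleftrightarrow> R 0 \<and> R 1 \<and> R (2 :: nat)"
  by (auto simp: numeral_3_eq_3 numeral_2_eq_2 less_Suc_eq)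

text \<open>Distinctness, disjointness, chordlessness and the edges of the two triangles all become
  one condition on pairs of positions, which is what the program can test in quadratic time.
  Position \<open>2 * e i\<close> is the last one on path \<open>i\<close>.\<close>

definition fits :: "('a \<Rightarrow> 'a \<Rightarrow> bool) \<Rightarrow> (nat \<Rightarrow> nat \<Rightarrow> 'a) \<Rightarrow> (nat \<Rightarrow> nat) \<Rightarrow> nat \<Rightarrow> nat \<Rightarrow> nat \<Rightarrow> nat \<Rightarrow> bool" where
  "fits E Q e i j x y \<longleftrightarrow> (Q i x = Q j y \<longleftrightarrow> i = j \<and> x = y) \<and>
     (E (Q i x) (Q j y) \<longleftrightarrow>
       (if i = j then Suc x = y \<or> Suc y = x else x = 0 \<and> y = 0 \<or> x = 2 * e i \<and> y = 2 * e j))"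

definition fits_all :: "('a \<Rightarrow> 'a \<Rightarrow> bool) \<Rightarrow> (nat \<Rightarrow> nat \<Rightarrow> 'a) \<Rightarrow> (nat \<Rightarrow> nat) \<Rightarrow> bool" where
  "fits_all E Q e \<longleftrightarrow> (\<forall>i<3. \<forall>j<3. \<forall>x\<le>2 * e i. \<forall>y\<le>2 * e j. fits E Q e i j x y)"

definition path_list :: "(nat \<Rightarrow> nat \<Rightarrow> 'a) \<Rightarrow> (nat \<Rightarrow> nat) \<Rightarrow> nat \<Rightarrow> 'a list" where
  "path_list Q e i = map (Q i) [0..<2 * e i + 1]"

lemma set_path_list: "set (path_list Q e i) = Q i ` {..2 * e i}"
  unfolding path_list_def by (auto simp: less_Suc_eq_le simp del: upt_Suc)

lemma nth_path_list: "x \<le> 2 * e i \<Longrightarrow> path_list Q e i ! x = Q i x"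
  by (simp add: path_list_def nth_append)

lemma length_path_list [simp]: "length (path_list Q e i) = 2 * e i + 1"
  by (simp add: path_list_def)

lemma ends_path_list: "hd (path_list Q e i) = Q i 0" "last (path_list Q e i) = Q i (2 * e i)"
proof -
  have "path_list Q e i \<noteq> []" by (simp add: path_list_def)
  then show "hd (path_list Q e i) = Q i 0" "last (path_list Q e i) = Q i (2 * e i)"
    by (simp_all add: hd_conv_nth last_conv_nth nth_path_list)
qed

lemma chordless_path_list:
  "chordless_path E (path_list Q e i) \<longleftrightarrow> (\<forall>x\<le>2 * e i. \<forall>y\<le>2 * e i. fits E Q e i i x y)" (is "?l \<longleftrightarrow> ?r")
proof -
  have d: "distinct (path_list Q e i) \<longleftrightarrow> (\<forall>x\<le>2 * e i. \<forall>y\<le>2 * e i. Q i x = Q i y \<longleftrightarrow> x = y)"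
    unfolding path_list_def distinct_map inj_on_def by (auto simp: less_Suc_eq_le simp del: upt_Suc)
  have "path_list Q e i \<noteq> []" by (simp add: path_list_def)
  then show ?thesis unfolding chordless_path_def d
    by (auto simp: fits_def nth_path_list less_Suc_eq_le)
qed

lemma linked_path_list:
  assumes "chordless_path E (path_list Q e i)" "chordless_path E (path_list Q e j)" "i \<noteq> j"
  shows "linked E (path_list Q e i) (path_list Q e j) \<longleftrightarrow> (\<forall>x\<le>2 * e i. \<forall>y\<le>2 * e j. fits E Q e i j x y)"
proof -
  have eq: "Q k x = Q k y \<longleftrightarrow> x = y" if "k = i \<or> k = j" "x \<le> 2 * e k" "y \<le> 2 * e k" for k x y
    using assms that unfolding chordless_path_list fits_def by blast
  show ?thesis
  proof
    assume l: "linked E (path_list Q e i) (path_list Q e j)"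
    show "\<forall>x\<le>2 * e i. \<forall>y\<le>2 * e j. fits E Q e i j x y"
    proof (intro allI impI)
      fix x y assume xy: "x \<le> 2 * e i" "y \<le> 2 * e j"
      then have m: "Q i x \<in> Q i ` {..2 * e i}" "Q j y \<in> Q j ` {..2 * e j}" by auto
      note l' = l[unfolded linked_def set_path_list ends_path_list]
      have "Q i x \<noteq> Q j y" using conjunct1[OF l'] m by (metis disjoint_iff)
      moreover note conjunct2[OF l', rule_format, OF m]
      ultimately show "fits E Q e i j x y"
        using eq[of i x] eq[of j y] xy assms(3) by (auto simp: fits_def)
    qed
  next
    assume r: "\<forall>x\<le>2 * e i. \<forall>y\<le>2 * e j. fits E Q e i j x y"
    show "linked E (path_list Q e i) (path_list Q e j)"
      unfolding linked_def set_path_list ends_path_list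
    proof (intro conjI ballI)
      show "Q i ` {..2 * e i} \<inter> Q j ` {..2 * e j} = {}" using r assms(3) unfolding fits_def by auto
      fix u v assume "u \<in> Q i ` {..2 * e i}" "v \<in> Q j ` {..2 * e j}"
      then obtain x y where xy: "x \<le> 2 * e i" "u = Q i x" "y \<le> 2 * e j" "v = Q j y" by auto
      then show "E u v \<longleftrightarrow> u = Q i 0 \<and> v = Q j 0 \<or> u = Q i (2 * e i) \<and> v = Q j (2 * e j)"
        using r eq[of i x] eq[of j y] assms(3) unfolding fits_def by auto
    qed
  qed
qed

text \<open>\<open>R\<close> and \<open>R'\<close> will be the predecessor functions of the searches
  from the two ends of a path. Iterating them from the middle vertex \<open>m\<close> traces the two
  halves, with \<open>m\<close> at position \<open>e\<close>.\<close>

definition route :: "'a \<Rightarrow> nat \<Rightarrow> ('a \<Rightarrow> 'a) \<Rightarrow> ('a \<Rightarrow> 'a) \<Rightarrow> nat \<Rightarrow> 'a" where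
  "route m e R R' k = (if k \<le> e then (R ^^ (e - k)) m else (R' ^^ (k - e)) m)"

context odd_hole_free begin

lemma fits_all_prism:
  assumes "\<And>i. i < 3 \<Longrightarrow> 0 < e i"
  shows "fits_all E Q e \<longleftrightarrow> prism E (path_list Q e 0) (path_list Q e 1) (path_list Q e 2)"
proof -
  have fs: "fits E Q e i j x y \<longleftrightarrow> fits E Q e j i y x" for i j x y
  proof -
    have "E (Q i x) (Q j y) = E (Q j y) (Q i x)" using sym by blast
    then show ?thesis unfolding fits_def by (cases "i = j") auto
  qed
  have e: "0 < e 0" "0 < e (Suc 0)" "0 < e 2" using assms by auto
  define F where "F i j \<longleftrightarrow> (\<forall>x\<le>2 * e i. \<forall>y\<le>2 * e j. fits E Q e i j x y)" for i j
  have F: "F i j = F j i" for i j using fs unfolding F_def by blast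
  have fa: "fits_all E Q e \<longleftrightarrow> F 0 0 \<and> F 1 1 \<and> F 2 2 \<and> F 0 1 \<and> F 0 2 \<and> F 1 2"
    unfolding fits_all_def F_def[symmetric] all3 using F[of 1 0] F[of 2 0] F[of 2 1] by blast
  have cp: "chordless_path E (path_list Q e i) \<longleftrightarrow> F i i" for i
    unfolding chordless_path_list F_def ..
  have lk: "linked E (path_list Q e i) (path_list Q e j) \<longleftrightarrow> F i j" if "F i i" "F j j" "i \<noteq> j" for i j
    using linked_path_list[of E Q e i j] that unfolding cp F_def[symmetric] by blast
  show ?thesis
    unfolding prism_def cp fa using lk[of 0 1] lk[of 0 2] lk[of 1 2] e by auto
qed

text \<open>\<open>replace_path\<close> for walks given by predecessors. That \<open>e\<close> and
  \<open>e'\<close> both come out as \<open>h\<close> is the reason why the program may insist on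
  equal distances from the two ends.\<close>

lemma replace_route:
  assumes K: "min_prism p q r" and h: "length p = 2 * h + 1" and m: "m = p ! h"
    and R: "(R ^^ e) m = hd p" "e \<le> h" "\<And>k. k < e \<Longrightarrow> E ((R ^^ k) m) ((R ^^ Suc k) m)"
      "\<And>k x. 0 < k \<Longrightarrow> k < e \<Longrightarrow> x \<in> four_ends q r \<Longrightarrow> \<not> E ((R ^^ k) m) x"
    and R': "(R' ^^ e') m = last p" "e' \<le> h" "\<And>k. k < e' \<Longrightarrow> E ((R' ^^ k) m) ((R' ^^ Suc k) m)"
      "\<And>k x. 0 < k \<Longrightarrow> k < e' \<Longrightarrow> x \<in> four_ends q r \<Longrightarrow> \<not> E ((R' ^^ k) m) x"
  shows "e = h \<and> e' = h \<and> min_prism (map (route m h R R') [0..<2 * h + 1]) q r \<and>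
     hd (map (route m h R R') [0..<2 * h + 1]) = hd p \<and> last (map (route m h R R') [0..<2 * h + 1]) = last p"
proof -
  \<comment> \<open>The iteration runs outwards from \<open>m\<close>, whereas
    \<open>replace_path\<close> expects walks that start at an end of \<open>p\<close>; hence the
    exponent \<open>e - k\<close>.\<close>
  define leg where "leg R e = map (\<lambda>k. (R ^^ (e - k)) m) [0..<e + 1]" for R :: "'a \<Rightarrow> 'a" and e
  have len: "length (leg R e) = Suc e" and ne: "leg R e \<noteq> []" for R e by (simp_all add: leg_def)
  have nth: "leg R e ! k = (R ^^ (e - k)) m" if "k \<le> e" for R e k
    using that by (simp add: leg_def del: upt_Suc)
  have hdl: "hd (leg R e) = (R ^^ e) m" "last (leg R e) = m" for R e
    by (simp_all add: hd_conv_nth last_conv_nth ne nth len)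
  have mV: "m \<in> V" using K h by (auto simp: m min_prism_def even_prism_paths_def)
  have legs: "successively E (leg R e) \<and> set (leg R e) \<subseteq> V"
    if R: "\<And>k. k < e \<Longrightarrow> E ((R ^^ k) m) ((R ^^ Suc k) m)" for R e
  proof
    show "successively E (leg R e)"
      unfolding successively_conv_nth
    proof (intro allI impI)
      fix i assume "Suc i < length (leg R e)"
      then have i: "i < e" by (simp add: len)
      have "e - i = Suc (e - Suc i)" using i by simp
      then show "E (leg R e ! i) (leg R e ! Suc i)"
        using sym[OF R[of "e - Suc i"]] i by (simp add: nth)
    qed
    have "(R ^^ k) m \<in> V" if "k \<le> e" for k
    proof (cases k)
      case 0
      then show ?thesis using mV by simp
    next
      case (Suc k')
      then show ?thesis using in_V[OF sym[OF R[of k']]] that by simp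
    qed
    then show "set (leg R e) \<subseteq> V" by (auto simp: leg_def simp del: upt_Suc)
  qed
  have inner: "\<not> E (leg R e ! i) x" if "0 < i" "Suc i < length (leg R e)" "x \<in> A"
    "\<And>k x. 0 < k \<Longrightarrow> k < e \<Longrightarrow> x \<in> A \<Longrightarrow> \<not> E ((R ^^ k) m) x" for R e i x A
    using that(4)[of "e - i" x] that(1-3) by (simp add: len nth)
  have w: "successively E (leg R e)" "set (leg R e) \<subseteq> V" using legs[OF R(3)] by auto
  have u: "successively E (leg R' e')" "set (leg R' e') \<subseteq> V" using legs[OF R'(3)] by auto
  have ends: "hd (leg R e) = hd p" "last (leg R e) = p ! h" "length (leg R e) \<le> Suc h"
    "hd (leg R' e') = last p" "last (leg R' e') = p ! h" "length (leg R' e') \<le> Suc h"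
    using R R' m by (simp_all add: hdl len)
  let ?A = "four_ends q r"
  have adj: "\<not> E (leg R e ! i) x" if "0 < i" "Suc i < length (leg R e)" "x \<in> ?A" for i x
    by (rule inner[where A = ?A, OF that]) (rule R(4))
  have adj': "\<not> E (leg R' e' ! i) x" if "0 < i" "Suc i < length (leg R' e')" "x \<in> ?A" for i x
    by (rule inner[where A = ?A, OF that]) (rule R'(4))
  note * = replace_path[OF K h w(1) ne ends(1-3) w(2) adj u(1) ne ends(4-6) u(2) adj']
  from *(1,2) have e: "e = h" "e' = h" by (simp_all add: len)
  have bl: "butlast (leg R e) @ rev (leg R' e') = map (route m h R R') [0..<2 * h + 1]"
  proof (rule nth_equalityI)
    show "length (butlast (leg R e) @ rev (leg R' e')) = length (map (route m h R R') [0..<2 * h + 1])"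
      by (simp add: len e)
    fix i assume "i < length (butlast (leg R e) @ rev (leg R' e'))"
    then have i: "i \<le> 2 * h" by (simp add: len e)
    then have "map (route m h R R') [0..<2 * h + 1] ! i = route m h R R' i"
      by (subst nth_map) (simp_all del: upt_Suc)
    then show "(butlast (leg R e) @ rev (leg R' e')) ! i = map (route m h R R') [0..<2 * h + 1] ! i"
      using i by (auto simp: nth_append nth_butlast len nth rev_nth e route_def)
  qed
  show ?thesis using e *(3-5)[unfolded bl] by blast
qed

section \<open>From vertex sets of prisms to triples of lists and back\<close>

lemma even_prism_of_iff:
  "even_prism_of V E S \<longleftrightarrow> (\<exists>p q r. even_prism_paths p q r \<and> S = set p \<union> set q \<union> set r)"
proof
  assume "even_prism_of V E S"
  then obtain P where SV: "S \<subseteq> V" and P: "prism_paths S (induced E S) P" and ev: "\<forall>i<3. even (path_length (P i))"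
    by (auto simp: even_prism_of_def even_prism_def)
  have S: "S = set (P 0) \<union> set (P 1) \<union> set (P 2)"
    using P unfolding prism_paths_def by (auto simp: numeral_3_eq_3 numeral_2_eq_2 lessThan_Suc)
  have sub: "set (P i) \<subseteq> S" if "i < 3" for i using that P unfolding prism_paths_def by auto
  have cp: "chordless_path E (P i)" "2 \<le> length (P i)" "odd (length (P i))" if "i < 3" for i
  proof -
    have c: "chordless_path (induced E S) (P i)" "1 \<le> path_length (P i)" "even (path_length (P i))"
      using P ev that unfolding prism_paths_def by auto
    have "P i ! k \<in> S" if "k < length (P i)" for k using sub[OF \<open>i < 3\<close>] that by auto
    then show "chordless_path E (P i)" using c(1) unfolding chordless_path_def induced_def by auto
    show "2 \<le> length (P i)" "odd (length (P i))" using c(2,3) unfolding path_length_def by presburger+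
  qed
  have lk: "linked E (P i) (P j)" if "i < 3" "j < 3" "i \<noteq> j" for i j
  proof -
    have d: "set (P i) \<inter> set (P j) = {}" and c: "induced E S (hd (P i)) (hd (P j))" "induced E S (last (P i)) (last (P j))"
      and e: "\<And>x y. x \<in> set (P i) \<Longrightarrow> y \<in> set (P j) \<Longrightarrow> induced E S x y \<Longrightarrow>
         x = hd (P i) \<and> y = hd (P j) \<or> x = last (P i) \<and> y = last (P j)"
      using P that unfolding prism_paths_def by blast+
    show ?thesis unfolding linked_def using d c e sub[OF that(1)] sub[OF that(2)] unfolding induced_def by blast
  qed
  have "even_prism_paths (P 0) (P 1) (P 2)"
    unfolding even_prism_paths_def prism_def using cp lk SV S by simp
  then show "\<exists>p q r. even_prism_paths p q r \<and> S = set p \<union> set q \<union> set r" using S by blast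
next
  assume "\<exists>p q r. even_prism_paths p q r \<and> S = set p \<union> set q \<union> set r"
  then obtain p q r where K: "even_prism_paths p q r" and S: "S = set p \<union> set q \<union> set r" by blast
  define P where "P i = [p, q, r] ! i" for i
  have P: "P 0 = p" "P 1 = q" "P 2 = r" by (simp_all add: P_def)
  have pr: "prism E p q r" using K by (simp add: even_prism_paths_def)
  have cp: "chordless_path E (P i)" "2 \<le> length (P i)" "odd (length (P i))" "set (P i) \<subseteq> S" if "i < 3" for i
    using that K S pr P unfolding even_prism_paths_def prism_def
    by (auto simp: numeral_3_eq_3 less_Suc_eq numeral_2_eq_2)
  have lk: "linked E (P i) (P j)" if "i < 3" "j < 3" "i \<noteq> j" for i j
    using that pr P linked_commute unfolding prism_def
    by (auto simp: numeral_3_eq_3 less_Suc_eq numeral_2_eq_2)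
  have "prism_paths S (induced E S) P"
    unfolding prism_paths_def
  proof (intro conjI allI impI)
    show "S = (\<Union>i<3. set (P i))" using S P by (auto simp: numeral_3_eq_3 numeral_2_eq_2 lessThan_Suc)
    fix i :: nat assume i: "i < 3"
    have "P i ! k \<in> S" if "k < length (P i)" for k using cp(4)[OF i] that by auto
    then show "chordless_path (induced E S) (P i)" using cp(1)[OF i] unfolding chordless_path_def induced_def by auto
    show "1 \<le> path_length (P i)" using cp(2)[OF i] by (simp add: path_length_def)
    fix j :: nat assume j: "j < 3" "i \<noteq> j"
    note l = lk[OF i j]
    have ne: "P i \<noteq> []" "P j \<noteq> []" using cp(2) i j by force+
    then have mem: "hd (P i) \<in> set (P i)" "hd (P j) \<in> set (P j)" "last (P i) \<in> set (P i)" "last (P j) \<in> set (P j)" by auto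
    show "set (P i) \<inter> set (P j) = {}" using l by (simp add: linked_def)
    show "induced E S (hd (P i)) (hd (P j))" "induced E S (last (P i)) (last (P j))"
      using l mem cp(4)[OF i] cp(4)[OF j(1)] unfolding linked_def induced_def by blast+
    show "\<forall>x\<in>set (P i). \<forall>y\<in>set (P j). induced E S x y \<longrightarrow>
           x = hd (P i) \<and> y = hd (P j) \<or> x = last (P i) \<and> y = last (P j)"
      using l unfolding linked_def induced_def by blast
  qed
  moreover have "even (path_length (P i))" if "i < 3" for i
    using cp(3)[OF that] by (simp add: path_length_def)
  ultimately show "even_prism_of V E S"
    using K S unfolding even_prism_of_def even_prism_def even_prism_paths_def by blast
qed

text \<open>Makes the least total length of three lists the same as the least number of
  vertices.\<close>

lemma card_even_prism_paths:
  assumes "even_prism_paths p q r"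
  shows "card (set p \<union> set q \<union> set r) = length p + length q + length r"
proof -
  have "distinct p" "distinct q" "distinct r" "set p \<inter> set q = {}" "set p \<inter> set r = {}" "set q \<inter> set r = {}"
    using assms by (auto simp: even_prism_paths_def prism_def linked_def chordless_path_def)
  then show ?thesis by (simp add: card_Un_disjoint Int_Un_distrib2 distinct_card)
qed

lemma minimum_even_prism_of_iff:
  "minimum_even_prism_of V E S \<longleftrightarrow> (\<exists>p q r. min_prism p q r \<and> S = set p \<union> set q \<union> set r)"
proof
  assume m: "minimum_even_prism_of V E S"
  then obtain p q r where K: "even_prism_paths p q r" "S = set p \<union> set q \<union> set r"
    unfolding minimum_even_prism_of_def even_prism_of_iff by blast
  have "min_prism p q r"
    unfolding min_prism_def
  proof (intro conjI allI impI)
    fix p' q' r' assume K': "even_prism_paths p' q' r'"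
    then have "card S \<le> card (set p' \<union> set q' \<union> set r')"
      using m unfolding minimum_even_prism_of_def even_prism_of_iff by blast
    then show "length p + length q + length r \<le> length p' + length q' + length r'"
      using card_even_prism_paths K K' by metis
  qed (use K in simp)
  then show "\<exists>p q r. min_prism p q r \<and> S = set p \<union> set q \<union> set r" using K by blast
next
  assume "\<exists>p q r. min_prism p q r \<and> S = set p \<union> set q \<union> set r"
  then show "minimum_even_prism_of V E S"
    unfolding minimum_even_prism_of_def min_prism_def even_prism_of_iff using card_even_prism_paths by metis
qed

end

section \<open>Running programs\<close>

text \<open>Total correctness with a time bound. Execution is deterministic, so the existence of one
  halting run says everything about the program.\<close>

definition runs :: "nat \<Rightarrow> prog \<Rightarrow> state \<Rightarrow> nat \<Rightarrow> (state \<Rightarrow> bool) \<Rightarrow> bool" where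
  "runs W c s T Q \<longleftrightarrow> (\<exists>t s'. exec W c s t s' \<and> t \<le> T \<and> Q s')"

fun writes :: "prog \<Rightarrow> nat set" where
  "writes Skip = {}"
| "writes (Assign x e) = {x}"
| "writes (Store e f) = {}"
| "writes (Seq p q) = writes p \<union> writes q"
| "writes (Cond e p q) = writes p \<union> writes q"
| "writes (While e p) = writes p"

abbreviation same_regs :: "prog \<Rightarrow> state \<Rightarrow> state \<Rightarrow> bool" where
  "same_regs c s s' \<equiv> \<forall>x. x \<notin> writes c \<longrightarrow> fst s' x = fst s x"

abbreviation same_regs_but :: "nat \<Rightarrow> prog \<Rightarrow> state \<Rightarrow> state \<Rightarrow> bool" where
  "same_regs_but x c s s' \<equiv> \<forall>y. y \<noteq> x \<longrightarrow> y \<notin> writes c \<longrightarrow> fst s' y = fst s y"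

definition set_reg :: "nat \<Rightarrow> nat \<Rightarrow> state \<Rightarrow> state" where
  "set_reg x v s = ((fst s)(x := v), snd s)"

lemma set_reg_sel [simp]: "fst (set_reg x v s) = (fst s)(x := v)" "snd (set_reg x v s) = snd s"
  by (simp_all add: set_reg_def)

lemma exec_writes: "exec W c s t s' \<Longrightarrow> x \<notin> writes c \<Longrightarrow> fst s' x = fst s x"
  by (induction rule: exec.induct) auto

text \<open>The frame condition comes for free from \<open>exec_writes\<close>, so that
  postconditions need not list the registers which a program never assigns.\<close>

lemma runs_conseq:
  assumes "runs W c s T Q" "T \<le> T'" "\<And>s'. Q s' \<Longrightarrow> same_regs c s s' \<Longrightarrow> Q' s'"
  shows "runs W c s T' Q'"
  using assms exec_writes unfolding runs_def by (meson le_trans)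

lemma runs_Skip: "Q s \<Longrightarrow> 1 \<le> T \<Longrightarrow> runs W Skip s T Q"
  unfolding runs_def using exec.Skip by blast

lemma runs_Assign:
  assumes "Q (set_reg x (eval W s e) s)" "1 + cost e \<le> T"
  shows "runs W (Assign x e) s T Q"
  using assms exec.Assign[of W x e s] unfolding runs_def set_reg_def by blast

lemma runs_Store:
  assumes "Q (fst s, (snd s)(eval W s e := eval W s f))" "1 + cost e + cost f \<le> T"
  shows "runs W (Store e f) s T Q"
  using assms exec.Store unfolding runs_def by blast

lemma runs_Seq:
  assumes "runs W p s T1 (\<lambda>s'. runs W q s' T2 Q)" "T1 + T2 \<le> T"
  shows "runs W (Seq p q) s T Q"
  using assms exec.Seq unfolding runs_def by (meson add_mono le_trans)

lemma runs_Seq':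
  assumes "runs W p s T1 R"
    and "\<And>s'. R s' \<Longrightarrow> same_regs p s s' \<Longrightarrow> runs W q s' T2 Q"
    and "T1 + T2 \<le> T"
  shows "runs W (Seq p q) s T Q"
proof (rule runs_Seq[OF _ assms(3)])
  show "runs W p s T1 (\<lambda>s'. runs W q s' T2 Q)"
    by (rule runs_conseq[OF assms(1) order_refl]) (rule assms(2))
qed

lemma runs_Cond:
  assumes "eval W s e \<noteq> 0 \<Longrightarrow> runs W p s T1 Q" "eval W s e = 0 \<Longrightarrow> runs W q s T1 Q" "1 + cost e + T1 \<le> T"
  shows "runs W (Cond e p q) s T Q"
proof (cases "eval W s e = 0")
  case True
  then obtain t s' where "exec W q s t s'" "t \<le> T1" "Q s'" using assms(2) unfolding runs_def by blast
  then show ?thesis using exec.CondFalse[OF True] assms(3) unfolding runs_def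
    by (metis (no_types, lifting) add_left_mono le_trans)
next
  case False
  then obtain t s' where "exec W p s t s'" "t \<le> T1" "Q s'" using assms(1) unfolding runs_def by blast
  then show ?thesis using exec.CondTrue[OF False] assms(3) unfolding runs_def
    by (metis (no_types, lifting) add_left_mono le_trans)
qed

definition For :: "nat \<Rightarrow> expr \<Rightarrow> prog \<Rightarrow> prog" where
  "For x b c = Seq (Assign x (Const 0))
     (While (Less (Reg x) b) (Seq c (Assign x (Add (Reg x) (Const 1)))))"

lemma writes_For [simp]: "writes (For x b c) = insert x (writes c)"
  by (auto simp: For_def)

text \<open>A round takes \<open>3 + cost b\<close> for the test, \<open>B\<close> for the body and
  4 for the increment; the final failing test takes \<open>3 + cost b\<close>. The condition
  \<open>N < W\<close> prevents the counter from wrapping around. \<open>b\<close> is evaluated anew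
  in every round, hence the premise \<open>bound\<close>.\<close>

lemma runs_While_count:
  assumes x: "x \<notin> writes c" and N: "N < W"
    and bound: "\<And>i s'. I i s' \<Longrightarrow> fst s' x = i \<Longrightarrow> eval W s' b = N"
    and step: "\<And>i s'. I i s' \<Longrightarrow> i < N \<Longrightarrow> fst s' x = i \<Longrightarrow>
      runs W c s' B (\<lambda>s''. I (Suc i) (set_reg x (Suc i) s''))"
  shows "i \<le> N \<Longrightarrow> I i s \<Longrightarrow> fst s x = i \<Longrightarrow>
    runs W (While (Less (Reg x) b) (Seq c (Assign x (Add (Reg x) (Const 1))))) s
      ((N - i) * (B + 7 + cost b) + 3 + cost b) (\<lambda>s'. I N s' \<and> fst s' x = N)"
proof (induction "N - i" arbitrary: i s)
  case 0
  then have "eval W s (Less (Reg x) b) = 0" "i = N" using bound[of i s] by auto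
  then show ?case using exec.WhileFalse[of W s "Less (Reg x) b"] 0 unfolding runs_def by fastforce
next
  case (Suc k)
  then have i: "i < N" by simp
  then have ev: "eval W s (Less (Reg x) b) \<noteq> 0" using bound[of i s] Suc by auto
  from step[OF Suc.prems(2) i Suc.prems(3)] obtain t s' where
    s': "exec W c s t s'" "t \<le> B" "I (Suc i) (set_reg x (Suc i) s')" unfolding runs_def by blast
  have "fst s' x = i" using exec_writes[OF s'(1) x] Suc.prems by simp
  moreover have "Suc i < W" "1 < W" using i N by auto
  ultimately have e2: "eval W s' (Add (Reg x) (Const 1)) = Suc i" by simp
  have "exec W (Seq c (Assign x (Add (Reg x) (Const 1)))) s (t + 4) (set_reg x (Suc i) s')"
    using exec.Seq[OF s'(1) exec.Assign[of W x "Add (Reg x) (Const 1)" s']] e2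
    by (simp add: set_reg_def numeral_eq_Suc)
  moreover
  have "runs W (While (Less (Reg x) b) (Seq c (Assign x (Add (Reg x) (Const 1))))) (set_reg x (Suc i) s')
      ((N - Suc i) * (B + 7 + cost b) + 3 + cost b) (\<lambda>s'. I N s' \<and> fst s' x = N)"
    by (rule Suc.hyps(1)) (use Suc s' i in auto)
  then obtain t' s'' where s'': "exec W (While (Less (Reg x) b) (Seq c (Assign x (Add (Reg x) (Const 1))))) (set_reg x (Suc i) s') t' s''"
    "t' \<le> (N - Suc i) * (B + 7 + cost b) + 3 + cost b" "I N s'' \<and> fst s'' x = N" unfolding runs_def by blast
  ultimately have "exec W (While (Less (Reg x) b) (Seq c (Assign x (Add (Reg x) (Const 1))))) s
     (1 + cost (Less (Reg x) b) + (t + 4) + t') s''"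
    using exec.WhileTrue[OF ev] s''(1) by blast
  moreover have "N - i = Suc (N - Suc i)" using i by simp
  then have "1 + cost (Less (Reg x) b) + (t + 4) + t' \<le> (N - i) * (B + 7 + cost b) + 3 + cost b"
    using s'(2) s''(2) by simp
  ultimately show ?case using s''(3) unfolding runs_def by blast
qed

lemma runs_For:
  assumes x: "x \<notin> writes c" and N: "N < W"
    and init: "I 0 (set_reg x 0 s)"
    and bound: "\<And>i s'. I i s' \<Longrightarrow> fst s' x = i \<Longrightarrow>
      (same_regs_but x c s s') \<Longrightarrow> eval W s' b = N"
    and step: "\<And>i s'. I i s' \<Longrightarrow> i < N \<Longrightarrow> fst s' x = i \<Longrightarrow>
      (same_regs_but x c s s') \<Longrightarrow>
      runs W c s' B (\<lambda>s''. I (Suc i) (set_reg x (Suc i) s''))"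
    and final: "\<And>s'. I N s' \<Longrightarrow> fst s' x = N \<Longrightarrow>
      (same_regs_but x c s s') \<Longrightarrow> Q s'"
    and T: "N * (B + 7 + cost b) + 5 + cost b \<le> T"
  shows "runs W (For x b c) s T Q"
  unfolding For_def
proof (rule runs_Seq)
  let ?F = "\<lambda>s'. same_regs_but x c s s'"
  let ?I = "\<lambda>i s'. I i s' \<and> ?F s'"
  let ?w = "While (Less (Reg x) b) (Seq c (Assign x (Add (Reg x) (Const 1))))"
  have "runs W ?w (set_reg x 0 s)
      ((N - 0) * (B + 7 + cost b) + 3 + cost b) (\<lambda>s'. ?I N s' \<and> fst s' x = N)"
  proof (rule runs_While_count[where I = ?I, OF x N])
    fix i s' assume I: "?I i s'" "i < N" "fst s' x = i"
    show "runs W c s' B (\<lambda>s''. ?I (Suc i) (set_reg x (Suc i) s''))"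
      by (rule runs_conseq[OF step[of i s']]) (use I in auto)
  qed (use init bound in auto)
  then have "runs W ?w (set_reg x 0 s) (N * (B + 7 + cost b) + 3 + cost b) Q"
    by (rule runs_conseq) (use final in auto)
  then show "runs W (Assign x (Const 0)) s 2 (\<lambda>s'. runs W ?w s' (N * (B + 7 + cost b) + 3 + cost b) Q)"
    by (intro runs_Assign) auto
qed (use T in auto)

text \<open>A conjunction by nested conditionals. The tests do not change the state, so all of them
  can be judged in the initial one.\<close>

definition guards :: "expr list \<Rightarrow> prog \<Rightarrow> prog" where
  "guards es c = foldr (\<lambda>e p. Cond e p Skip) es c"

lemma guards_simps [simp]: "guards [] c = c" "guards (e # es) c = Cond e (guards es c) Skip"
  by (simp_all add: guards_def)

lemma writes_guards [simp]: "writes (guards es c) = writes c"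
  by (induction es) auto

lemma runs_guards:
  assumes "(\<forall>e\<in>set es. eval W s e \<noteq> 0) \<Longrightarrow> runs W c s T Q"
    and "\<not> (\<forall>e\<in>set es. eval W s e \<noteq> 0) \<Longrightarrow> Q s"
    and "T + 1 + sum_list (map (\<lambda>e. 1 + cost e) es) \<le> T'"
  shows "runs W (guards es c) s T' Q"
  using assms
proof (induction es arbitrary: T')
  case Nil
  then show ?case using runs_conseq[of W c s T Q T'] by simp
next
  case (Cons e es)
  show ?case unfolding guards_simps
  proof (rule runs_Cond)
    show "1 + cost e + (T + 1 + sum_list (map (\<lambda>e. 1 + cost e) es)) \<le> T'" using Cons.prems(3) by simp
    show "runs W (guards es c) s (T + 1 + sum_list (map (\<lambda>e. 1 + cost e) es)) Q" if "eval W s e \<noteq> 0"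
      by (rule Cons.IH) (use Cons.prems that in auto)
    show "runs W Skip s (T + 1 + sum_list (map (\<lambda>e. 1 + cost e) es)) Q" if "eval W s e = 0"
      by (rule runs_Skip) (use Cons.prems that in auto)
  qed
qed

definition seqs :: "prog list \<Rightarrow> prog" where
  "seqs ps = foldr Seq ps Skip"

lemma seqs_simps [simp]: "seqs [] = Skip" "seqs (p # ps) = Seq p (seqs ps)"
  by (simp_all add: seqs_def)

lemma writes_seqs [simp]: "writes (seqs ps) = (\<Union>p\<in>set ps. writes p)"
  by (induction ps) auto

section \<open>Memory layout\<close>

text \<open>Register 0 holds \<open>n\<close> and register 1 the common size of the arrays; array 0 is the input.\<close>

definition Cell :: "nat \<Rightarrow> expr \<Rightarrow> expr" where
  "Cell c i = Load (Add (Mul (Const c) (Reg 1)) i)"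

definition Put :: "nat \<Rightarrow> expr \<Rightarrow> expr \<Rightarrow> prog" where
  "Put c i e = Store (Add (Mul (Const c) (Reg 1)) i) e"

definition Adj :: "nat \<Rightarrow> nat \<Rightarrow> expr" where
  "Adj x y = Load (Add (Mul (Reg x) (Reg 0)) (Reg y))"

lemma cost_Cell [simp]: "cost (Cell c i) = 5 + cost i" and cost_Adj [simp]: "cost (Adj x y) = 6"
  by (simp_all add: Cell_def Adj_def)

lemma writes_Put [simp]: "writes (Put c i e) = {}" by (simp add: Put_def)

text \<open>All arrays have \<open>S\<close> cells, enough for the adjacency matrix and for the at
  most \<open>6 * n + 3\<close> entries of a candidate. The margin in \<open>32 * S < W\<close>
  keeps addresses in arrays below 31 from wrapping around.\<close>

locale machine =
  fixes n S W :: nat and E :: "nat \<Rightarrow> nat \<Rightarrow> bool"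
  assumes S: "S = (n + 4) * (n + 4)" and SW: "32 * S < W"
begin

definition arr :: "state \<Rightarrow> nat \<Rightarrow> nat \<Rightarrow> nat" where
  "arr s c v = snd s (c * S + v)"

definition set_arr :: "nat \<Rightarrow> nat \<Rightarrow> nat \<Rightarrow> state \<Rightarrow> state" where
  "set_arr c v x s = (fst s, (snd s)(c * S + v := x))"

lemma fst_set_arr [simp]: "fst (set_arr c v x s) = fst s"
  by (simp add: set_arr_def)

lemma arr_set_reg [simp]: "arr (set_reg x v s) = arr s"
  by (simp add: arr_def fun_eq_iff)

lemma arr_set_arr [simp]:
  assumes "v < S" "v' < S"
  shows "arr (set_arr c v x s) c' v' = (if c' = c \<and> v' = v then x else arr s c' v')"
proof -
  have "c * S + v = c' * S + v' \<longleftrightarrow> c = c' \<and> v = v'"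
  proof
    assume eq: "c * S + v = c' * S + v'"
    have "(c * S + v) div S = c" "(c' * S + v') div S = c'"
      "(c * S + v) mod S = v" "(c' * S + v') mod S = v'" using assms by simp_all
    then show "c = c' \<and> v = v'" using eq by metis
  qed simp
  then show ?thesis by (auto simp: arr_def set_arr_def)
qed

definition base :: "state \<Rightarrow> bool" where
  "base s \<longleftrightarrow> fst s 0 = n \<and> fst s 1 = S \<and> (\<forall>u<n. \<forall>v<n. arr s 0 (u * n + v) = of_bool (E u v))"

lemma S_bounds: "n < S" "n * n < S" "8 * n + 16 \<le> S" "W > 32" "n < W" "S < W" "2 * n + 1 < S" "2 * n + 1 < W"
proof -
  have s: "S = n * n + 8 * n + 16" by (simp add: S algebra_simps)
  show "n < S" "n * n < S" "8 * n + 16 \<le> S" "W > 32" "n < W" "S < W" "2 * n + 1 < S" "2 * n + 1 < W"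
    using SW unfolding s by simp_all
qed

lemma index_bound: assumes "u < n" "v < n" shows "u * n + v < n * n"
proof -
  have "u * n + v < Suc u * n" using assms by simp
  also have "\<dots> \<le> n * n" using assms by (intro mult_right_mono) auto
  finally show ?thesis .
qed

lemma address:
  assumes "c < 31" "i < S" shows "((c mod W * S) mod W + i) mod W = c * S + i"
proof -
  have "c * S \<le> 30 * S" using assms by (intro mult_right_mono) auto
  then have "c * S + i < W" "c * S < W" using assms SW by linarith+
  moreover have "c < W" using assms S_bounds by linarith
  ultimately show ?thesis by simp
qed

text \<open>Relies on register 1 instead of \<open>base\<close>, because the output phase overwrites
  the adjacency matrix.\<close>

lemma eval_Cell_reg:
  assumes "fst s 1 = S" "c < 31" "eval W s i < S"
  shows "eval W s (Cell c i) = arr s c (eval W s i)"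
  using assms address[of c "eval W s i"] by (simp add: Cell_def arr_def)

lemma eval_Cell [simp]:
  assumes "base s" "c < 31" "eval W s i < S"
  shows "eval W s (Cell c i) = arr s c (eval W s i)"
  using assms eval_Cell_reg unfolding base_def by blast

lemma eval_Adj [simp]:
  assumes "base s" "fst s x < n" "fst s y < n"
  shows "eval W s (Adj x y) = of_bool (E (fst s x) (fst s y))"
proof -
  have "fst s x * n + fst s y < n * n" using index_bound assms by blast
  then have "fst s x * n + fst s y < W" "fst s x * n < W" using S_bounds by linarith+
  then have "eval W s (Adj x y) = arr s 0 (fst s x * n + fst s y)"
    using assms by (simp add: Adj_def base_def arr_def)
  then show ?thesis using assms by (simp add: base_def)
qed

lemma eval_Const [simp]: "c < 32 \<Longrightarrow> eval W s (Const c) = c"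
  using S_bounds by simp

lemma runs_Put_reg:
  assumes "fst s 1 = S" "c < 31" "eval W s i < S" "Q (set_arr c (eval W s i) (eval W s e) s)"
    "5 + cost i + cost e \<le> T"
  shows "runs W (Put c i e) s T Q"
  unfolding Put_def
  by (rule runs_Store) (use assms address[of c "eval W s i"] in \<open>simp_all add: set_arr_def\<close>)

lemma runs_Put:
  assumes "base s" "c < 31" "eval W s i < S" "Q (set_arr c (eval W s i) (eval W s e) s)"
    "5 + cost i + cost e \<le> T"
  shows "runs W (Put c i e) s T Q"
  using assms runs_Put_reg unfolding base_def by blast

lemma base_set_arr [simp]: "0 < c \<Longrightarrow> v < S \<Longrightarrow> base (set_arr c v x s) = base s"
proof -
  assume c: "0 < c" "v < S"
  have "arr (set_arr c v x s) 0 (a * n + b) = arr s 0 (a * n + b)" if "a < n" "b < n" for a b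
    using c index_bound[OF that] S_bounds(2) by simp
  then show ?thesis unfolding base_def by auto
qed

lemma base_set_reg [simp]: "1 < x \<Longrightarrow> base (set_reg x v s) = base s"
  unfolding base_def by auto

text \<open>\<open>D v = n\<close> encodes that \<open>v\<close> has not been reached; \<open>C\<close> selects the edges already inspected.\<close>

definition search_inv where
  "search_inv src X C k D P \<longleftrightarrow> (\<forall>v<n. D v \<le> n \<and> P v < n \<and> (D v < n \<longrightarrow> D v \<le> Suc k) \<and>
      (D v < n \<longrightarrow> v = src \<and> D v = 0 \<or> Suc (D (P v)) = D v \<and> E (P v) v \<and> X v)) \<and> D src = 0 \<and>
     (\<forall>u<n. \<forall>v<n. C (D u) u v \<longrightarrow> E u v \<longrightarrow> X v \<longrightarrow> D v \<le> Suc (D u))"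

text \<open>What \<open>search_inv\<close> amounts to after all rounds, when every edge leaving a
  reached vertex has been inspected.\<close>

definition search_result where
  "search_result src X D P \<longleftrightarrow> (\<forall>v<n. D v \<le> n \<and> P v < n \<and>
      (D v < n \<longrightarrow> v = src \<and> D v = 0 \<or> Suc (D (P v)) = D v \<and> E (P v) v \<and> X v)) \<and> D src = 0 \<and>
     (\<forall>u<n. \<forall>v<n. D u < n \<longrightarrow> E u v \<longrightarrow> X v \<longrightarrow> D v \<le> Suc (D u))"

text \<open>The search goes by rounds \<open>k\<close>, and within a round through all pairs in
  lexicographic order; \<open>d\<close> is the distance of the tail \<open>u'\<close>.\<close>

abbreviation search_done :: "nat \<Rightarrow> nat \<Rightarrow> nat \<Rightarrow> nat \<Rightarrow> nat \<Rightarrow> nat \<Rightarrow> bool" where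
  "search_done k u v d u' v' \<equiv> d < k \<or> d = k \<and> (u' < u \<or> u' = u \<and> v' < v)"

text \<open>A newly reached \<open>v\<close> is nobody's predecessor yet, since a child would have
  distance \<open>n + 1\<close>. Its own edges do not count as inspected, as its distance
  \<open>Suc k\<close> belongs to the next round.\<close>

lemma search_inv_step:
  assumes I: "search_inv src X (search_done k u v) k D P" and "k < n" "u < n" "v < n" "src < n"
    and upd: "D u = k" "D v = n" "E u v" "X v"
  shows "search_inv src X (search_done k u (Suc v)) k (D(v := Suc k)) (P(v := u))"
proof -
  have ne: "v \<noteq> src" "u \<noteq> v" using I upd assms(2) by (auto simp: search_inv_def)
  have par: "P w \<noteq> v" if "w < n" "D w < n" "\<not> (w = src \<and> D w = 0)" for w
    using I that upd(2) unfolding search_inv_def by (metis lessI nat_less_le order_less_trans less_irrefl)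
  have le: "D w \<le> n" "P w < n" "D w < n \<Longrightarrow> D w \<le> Suc k"
    and tree: "D w < n \<Longrightarrow> w = src \<and> D w = 0 \<or> Suc (D (P w)) = D w \<and> E (P w) w \<and> X w"
    if "w < n" for w
    using I that unfolding search_inv_def by blast+
  show ?thesis
    unfolding search_inv_def
  proof (intro conjI allI impI)
    fix w assume w: "w < n"
    show "(D(v := Suc k)) w \<le> n" "(P(v := u)) w < n" "(D(v := Suc k)) w < n \<Longrightarrow> (D(v := Suc k)) w \<le> Suc k"
      using le[OF w] assms(2,3) by (cases "w = v"; simp)+
    assume *: "(D(v := Suc k)) w < n"
    show "w = src \<and> (D(v := Suc k)) w = 0 \<or>
        Suc ((D(v := Suc k)) ((P(v := u)) w)) = (D(v := Suc k)) w \<and> E ((P(v := u)) w) w \<and> X w"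
    proof (cases "w = v")
      case True
      then show ?thesis using upd ne by simp
    next
      case False
      then show ?thesis using tree[OF w] par[OF w] * by (metis fun_upd_other)
    qed
  next
    show "(D(v := Suc k)) src = 0" using I ne by (simp add: search_inv_def)
  next
    fix u' v' assume *: "u' < n" "v' < n" "search_done k u (Suc v) ((D(v := Suc k)) u') u' v'" "E u' v'" "X v'"
    then have u': "u' \<noteq> v" by auto
    show "(D(v := Suc k)) v' \<le> Suc ((D(v := Suc k)) u')"
    proof (cases "u' = u \<and> v' = v")
      case True
      then show ?thesis using upd ne by simp
    next
      case False
      then have "search_done k u v (D u') u' v'" using * u' by auto
      then have "D v' \<le> Suc (D u')" using I * unfolding search_inv_def by blast
      then show ?thesis using u' upd(2) assms(2) by auto
    qed
  qed
qed

text \<open>If the edge leaves a vertex of the current round towards an admissible \<open>v\<close>,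
  the update can fail only because \<open>v\<close> is reached already, and then
  \<open>D v \<le> Suc k\<close> is part of the invariant.\<close>

lemma search_inv_skip:
  assumes I: "search_inv src X (search_done k u v) k D P" and "k < n" "u < n" "v < n"
    and no: "\<not> (D u = k \<and> D v = n \<and> E u v \<and> X v)"
  shows "search_inv src X (search_done k u (Suc v)) k D P"
  unfolding search_inv_def
proof (intro conjI allI impI)
  fix u' v' assume *: "u' < n" "v' < n" "search_done k u (Suc v) (D u') u' v'" "E u' v'" "X v'"
  show "D v' \<le> Suc (D u')"
  proof (cases "u' = u \<and> v' = v \<and> D u' = k")
    case True
    then have "D v \<noteq> n" using no * by auto
    then have "D v < n" using I \<open>v < n\<close> by (auto simp: search_inv_def le_neq_implies_less)
    then show ?thesis using I True \<open>v < n\<close> by (auto simp: search_inv_def)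
  next
    case False
    then have "search_done k u v (D u') u' v'" using * by auto
    then show ?thesis using I * unfolding search_inv_def by blast
  qed
qed (use I in \<open>auto simp: search_inv_def\<close>)

text \<open>Serves both for arrays that agree below \<open>n\<close> and for the change of counters
  where one loop ends and the next round begins.\<close>

lemma search_inv_cong:
  assumes "search_inv src X C k D P" "\<And>v. v < n \<Longrightarrow> D' v = D v" "\<And>v. v < n \<Longrightarrow> P' v = P v" "src < n"
    "k \<le> k'" "\<And>d u v. u < n \<Longrightarrow> v < n \<Longrightarrow> C' d u v \<Longrightarrow> C d u v"
  shows "search_inv src X C' k' D' P'"
  unfolding search_inv_def
proof (intro conjI allI impI)
  fix v assume v: "v < n"
  then have Pv: "P v < n" using assms(1) by (simp add: search_inv_def)
  show "D' v \<le> n" "P' v < n" "D' v < n \<Longrightarrow> D' v \<le> Suc k'"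
    using assms v by (auto simp: search_inv_def)
  show "D' v < n \<Longrightarrow> v = src \<and> D' v = 0 \<or> Suc (D' (P' v)) = D' v \<and> E (P' v) v \<and> X v"
    using assms(1-3) v Pv by (auto simp: search_inv_def)
next
  show "D' src = 0" using assms by (auto simp: search_inv_def)
next
  fix u v assume *: "u < n" "v < n" "C' (D' u) u v" "E u v" "X v"
  then have "C (D u) u v" using assms(2,6) by auto
  then show "D' v \<le> Suc (D' u)" using assms(1,2) * by (auto simp: search_inv_def)
qed

end

section \<open>Breadth-first search\<close>

text \<open>There is no queue: round \<open>k\<close> scans the whole matrix for edges leaving
  vertices at distance \<open>k\<close>. The resulting cubic time fits into the \<open>n ^ 5\<close>
  allowed for each six-tuple of ends. Neighbours of the vertices in registers \<open>fs\<close> are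
  never entered.\<close>

definition search :: "nat \<Rightarrow> nat \<Rightarrow> nat \<Rightarrow> nat list \<Rightarrow> prog" where
  "search d p x fs = seqs
     [For 22 (Reg 0) (Seq (Put d (Reg 22) (Reg 0)) (Put p (Reg 22) (Const 0))),
      Put d (Reg x) (Const 0),
      For 20 (Reg 0) (For 21 (Reg 0) (For 22 (Reg 0)
        (guards ([Equal (Cell d (Reg 21)) (Reg 20), Equal (Cell d (Reg 22)) (Reg 0), Adj 21 22] @
             map (\<lambda>f. Equal (Adj f 22) (Const 0)) fs)
           (Seq (Put d (Reg 22) (Add (Reg 20) (Const 1))) (Put p (Reg 22) (Reg 21))))))]"

lemma writes_search [simp]: "writes (search d p x fs) = {20, 21, 22}"
  by (auto simp: search_def)

definition search_time :: "nat \<Rightarrow> nat" where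
  "search_time n = n * 22 + 6 + 7 + (n * (n * (n * 86 + 14) + 14) + 6) + 1"

context machine
begin

definition unchanged :: "nat set \<Rightarrow> state \<Rightarrow> state \<Rightarrow> bool" where
  "unchanged A s s' \<longleftrightarrow> (\<forall>c v. v < S \<longrightarrow> c \<notin> A \<longrightarrow> arr s' c v = arr s c v)"

lemma unchanged_refl [simp]: "unchanged A s s"
  by (simp add: unchanged_def)

lemma unchanged_trans: "unchanged A s s' \<Longrightarrow> unchanged B s' s'' \<Longrightarrow> A \<union> B \<subseteq> C \<Longrightarrow> unchanged C s s''"
  unfolding unchanged_def by (metis UnI1 UnI2 subsetD)

lemma unchanged_set_reg [simp]: "unchanged A s (set_reg x v s') = unchanged A s s'"
  by (simp add: unchanged_def)

lemma unchanged_set_arr: "v < S \<Longrightarrow> c \<in> A \<Longrightarrow> unchanged A s s' \<Longrightarrow> unchanged A s (set_arr c v x s')"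
  by (auto simp: unchanged_def)

lemma runs_search:
  assumes b: "base s" and dp: "0 < d" "d < 31" "0 < p" "p < 31" "d \<noteq> p"
    and x: "x < 20" "fst s x < n" and fs: "set fs \<subseteq> {..<20}" "length fs = 4" "\<And>f. f \<in> set fs \<Longrightarrow> fst s f < n"
  shows "runs W (search d p x fs) s (search_time n)
     (\<lambda>s'. base s' \<and> unchanged {d, p} s s' \<and>
        search_result (fst s x) (\<lambda>v. \<forall>f\<in>set fs. \<not> E (fst s f) v) (arr s' d) (arr s' p))"
proof -
  let ?src = "fst s x" and ?X = "\<lambda>v. \<forall>f\<in>set fs. \<not> E (fst s f) v"
  let ?gs = "[Equal (Cell d (Reg 21)) (Reg 20), Equal (Cell d (Reg 22)) (Reg 0), Adj 21 22] @
      map (\<lambda>f. Equal (Adj f 22) (Const 0)) fs"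
  let ?body = "guards ?gs (Seq (Put d (Reg 22) (Add (Reg 20) (Const 1))) (Put p (Reg 22) (Reg 21)))"
  define G where "G s' \<longleftrightarrow> base s' \<and> unchanged {d, p} s s'" for s'
  have G_arr: "G (set_arr c v y s') = G s'" if "v < S" "c = d \<or> c = p" "G s'" for c v y s'
    using that dp unfolding G_def by (auto intro: unchanged_set_arr)
  have G_reg: "G (set_reg y v s') = G s'" if "1 < y" for y v s'
    using that unfolding G_def by simp
  have n0: "0 < n" using x by simp
  have sumfs: "sum_list (map ((\<lambda>e. Suc (cost e)) \<circ> (\<lambda>f. Equal (Adj f 22) (Const 0))) fs) = 36"
    using fs(2) by (simp add: comp_def sum_list_triv)
  define I where "I k u v s' \<longleftrightarrow> G s' \<and> search_inv ?src ?X (search_done k u v) k (arr s' d) (arr s' p)" for k u v s'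
  \<comment> \<open>The bound 78 consists of 61 for the seven tests, 16 for the two stores and 1 for
    a \<open>Skip\<close>.\<close>
  have body: "runs W ?body s' 78 (\<lambda>s''. I k u (Suc v) (set_reg 22 (Suc v) s''))"
    if I: "I k u v s'" and r: "fst s' 20 = k" "fst s' 21 = u" "fst s' 22 = v" "k < n" "u < n" "v < n"
      and fr: "\<And>y. y < 20 \<Longrightarrow> fst s' y = fst s y" for k u v s'
  proof -
    have bs: "base s'" "fst s' 0 = n" using I by (auto simp: I_def G_def base_def)
    have kW: "k + 1 < W" "1 < W" using r S_bounds by linarith+
    have sb: "u < S" "v < S" using r S_bounds by linarith+
    have fsn: "fst s' f = fst s f \<and> fst s f < n" if "f \<in> set fs" for f using that fs fr by auto
    have ev: "(\<forall>e\<in>set ?gs. eval W s' e \<noteq> 0) \<longleftrightarrow>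
          arr s' d u = k \<and> arr s' d v = n \<and> E u v \<and> ?X v"
      using bs r dp sb fsn kW by auto
    show ?thesis
    proof (rule runs_guards[where T = 16])
      assume "\<forall>e\<in>set ?gs. eval W s' e \<noteq> 0"
      then have upd: "arr s' d u = k" "arr s' d v = n" "E u v" "?X v" using ev by blast+
      have inv: "search_inv ?src ?X (search_done k u (Suc v)) k ((arr s' d)(v := Suc k)) ((arr s' p)(v := u))"
        by (rule search_inv_step) (use I upd r x in \<open>auto simp: I_def\<close>)
      have "I k u (Suc v) (set_reg 22 (Suc v) (set_arr p v u (set_arr d v (Suc k) s')))"
        unfolding I_def
      proof
        show "search_inv ?src ?X (search_done k u (Suc v)) k
             (arr (set_reg 22 (Suc v) (set_arr p v u (set_arr d v (Suc k) s'))) d)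
             (arr (set_reg 22 (Suc v) (set_arr p v u (set_arr d v (Suc k) s'))) p)"
          by (rule search_inv_cong[OF inv]) (use dp sb x S_bounds in auto)
        show "G (set_reg 22 (Suc v) (set_arr p v u (set_arr d v (Suc k) s')))"
          using I sb by (simp add: I_def G_reg G_arr)
      qed
      then show "runs W (Seq (Put d (Reg 22) (Add (Reg 20) (Const 1))) (Put p (Reg 22) (Reg 21))) s' 16
          (\<lambda>s''. I k u (Suc v) (set_reg 22 (Suc v) s''))"
        by (intro runs_Seq[where ?T1.0 = 9 and ?T2.0 = 7] runs_Put) (use bs dp r sb kW in simp_all)
    next
      assume "\<not> (\<forall>e\<in>set ?gs. eval W s' e \<noteq> 0)"
      then have no: "\<not> (arr s' d u = k \<and> arr s' d v = n \<and> E u v \<and> ?X v)" using ev by blast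
      have "search_inv ?src ?X (search_done k u (Suc v)) k (arr s' d) (arr s' p)"
        by (rule search_inv_skip) (use I r no in \<open>auto simp: I_def\<close>)
      then show "I k u (Suc v) (set_reg 22 (Suc v) s')"
        using I by (simp add: I_def G_reg)
    qed (simp add: sumfs)
  qed
  have W: "n < W" using S_bounds by simp
  have b0: "fst s' 0 = n" if "G s'" for s' using that by (simp add: G_def base_def)
  have inner: "runs W (For 22 (Reg 0) ?body) s' (n * 86 + 6) (\<lambda>s''. I k (Suc u) 0 (set_reg 21 (Suc u) s''))"
    if I: "I k u 0 s'" and r: "fst s' 20 = k" "fst s' 21 = u" "k < n" "u < n"
      and fr: "\<And>y. y < 20 \<Longrightarrow> fst s' y = fst s y" for k u s'
  proof (rule runs_For[where I = "\<lambda>v s'. I k u v s'" and B = 78 and N = n])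
    show "I k u 0 (set_reg 22 0 s')" using I by (simp add: I_def G_reg)
    show "eval W s'' (Reg 0) = n" if "I k u i s''" for i s'' using that b0 by (simp add: I_def)
    show "runs W ?body s'' 78 (\<lambda>s'''. I k u (Suc i) (set_reg 22 (Suc i) s'''))"
      if "I k u i s''" "i < n" "fst s'' 22 = i" "same_regs_but 22 ?body s' s''" for i s''
      by (rule body) (use that r fr in auto)
    fix s'' assume "I k u n s''"
    then show "I k (Suc u) 0 (set_reg 21 (Suc u) s'')"
      using x by (auto simp: I_def G_reg elim!: search_inv_cong)
  qed (use W in auto)
  have middle: "runs W (For 21 (Reg 0) (For 22 (Reg 0) ?body)) s' (n * (n * 86 + 14) + 6) (\<lambda>s''. I (Suc k) 0 0 (set_reg 20 (Suc k) s''))"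
    if I: "I k 0 0 s'" and r: "fst s' 20 = k" "k < n"
      and fr: "\<And>y. y < 20 \<Longrightarrow> fst s' y = fst s y" for k s'
  proof (rule runs_For[where I = "\<lambda>u s'. I k u 0 s'" and B = "n * 86 + 6" and N = n])
    show "I k 0 0 (set_reg 21 0 s')" using I by (simp add: I_def G_reg)
    show "eval W s'' (Reg 0) = n" if "I k i 0 s''" for i s'' using that b0 by (simp add: I_def)
    show "runs W (For 22 (Reg 0) ?body) s'' (n * 86 + 6) (\<lambda>s'''. I k (Suc i) 0 (set_reg 21 (Suc i) s'''))"
      if "I k i 0 s''" "i < n" "fst s'' 21 = i" "same_regs_but 21 (For 22 (Reg 0) ?body) s' s''" for i s''
      by (rule inner) (use that r fr in auto)
    fix s'' assume "I k n 0 s''"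
    then show "I (Suc k) 0 0 (set_reg 20 (Suc k) s'')"
      using x by (auto simp: I_def G_reg elim!: search_inv_cong)
  qed (use W in auto)
  have outer: "runs W (For 20 (Reg 0) (For 21 (Reg 0) (For 22 (Reg 0) ?body))) s' (n * (n * (n * 86 + 14) + 14) + 6) (I n 0 0)"
    if I: "I 0 0 0 s'" and fr: "\<And>y. y < 20 \<Longrightarrow> fst s' y = fst s y" for s'
  proof (rule runs_For[where I = "\<lambda>k s'. I k 0 0 s'" and B = "n * (n * 86 + 14) + 6" and N = n])
    show "I 0 0 0 (set_reg 20 0 s')" using I by (simp add: I_def G_reg)
    show "eval W s'' (Reg 0) = n" if "I i 0 0 s''" for i s'' using that b0 by (simp add: I_def)
    show "runs W (For 21 (Reg 0) (For 22 (Reg 0) ?body)) s'' (n * (n * 86 + 14) + 6) (\<lambda>s'''. I (Suc i) 0 0 (set_reg 20 (Suc i) s'''))"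
      if "I i 0 0 s''" "i < n" "fst s'' 20 = i" "same_regs_but 20 (For 21 (Reg 0) (For 22 (Reg 0) ?body)) s' s''" for i s''
      by (rule middle) (use that fr in auto)
  qed (use W in auto)
  define J where "J i s' \<longleftrightarrow> G s' \<and> (\<forall>v<i. arr s' d v = n \<and> arr s' p v = 0)" for i s'
  have init: "runs W (For 22 (Reg 0) (Seq (Put d (Reg 22) (Reg 0)) (Put p (Reg 22) (Const 0)))) s (n * 22 + 6) (J n)"
  proof (rule runs_For[where I = J and B = 14 and N = n])
    show "J 0 (set_reg 22 0 s)" using b by (simp add: J_def G_def)
    show "eval W s' (Reg 0) = n" if "J i s'" for i s' using that b0 by (simp add: J_def)
    fix i s' assume J: "J i s'" "i < n" "fst s' 22 = i"
    have iS: "i < S" using J S_bounds by linarith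
    have bs: "base s'" using J by (simp add: J_def G_def)
    have "J (Suc i) (set_reg 22 (Suc i) (set_arr p i 0 (set_arr d i n s')))"
      unfolding J_def
    proof (intro conjI allI impI)
      show "G (set_reg 22 (Suc i) (set_arr p i 0 (set_arr d i n s')))"
        using J iS by (simp add: J_def G_reg G_arr)
      fix v assume "v < Suc i"
      moreover then have "v < S" using J S_bounds by linarith
      ultimately show "arr (set_reg 22 (Suc i) (set_arr p i 0 (set_arr d i n s'))) d v = n"
        "arr (set_reg 22 (Suc i) (set_arr p i 0 (set_arr d i n s'))) p v = 0"
        using J iS dp by (auto simp: J_def less_Suc_eq)
    qed
    then show "runs W (Seq (Put d (Reg 22) (Reg 0)) (Put p (Reg 22) (Const 0))) s' 14 (\<lambda>s''. J (Suc i) (set_reg 22 (Suc i) s''))"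
      by (intro runs_Seq[where ?T1.0 = 7 and ?T2.0 = 7] runs_Put) (use bs dp J iS b0[of s'] in \<open>simp_all add: J_def\<close>)
  qed (use W in auto)
  show ?thesis unfolding search_def seqs_simps
  proof (rule runs_Seq'[OF init])
    fix s1 assume J: "J n s1" and fr1: "same_regs (For 22 (Reg 0) (Seq (Put d (Reg 22) (Reg 0)) (Put p (Reg 22) (Const 0)))) s s1"
    have s1x: "fst s1 x = ?src" "?src < S" using fr1 x S_bounds by auto
    let ?s2 = "set_arr d ?src 0 s1"
    have b1: "base s1" using J by (simp add: J_def G_def)
    have I0: "I 0 0 0 ?s2"
      unfolding I_def
    proof
      show "G ?s2" using J s1x by (simp add: J_def G_arr)
      have "v < S" if "v < n" for v using that S_bounds by linarith
      then show "search_inv ?src ?X (search_done 0 0 0) 0 (arr ?s2 d) (arr ?s2 p)"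
        using J s1x dp n0 x by (auto simp: search_inv_def J_def)
    qed
    show "runs W (Seq (Put d (Reg x) (Const 0)) (Seq (For 20 (Reg 0) (For 21 (Reg 0) (For 22 (Reg 0) ?body))) Skip)) s1
        (7 + ((n * (n * (n * 86 + 14) + 14) + 6) + 1))
        (\<lambda>s'. base s' \<and> unchanged {d, p} s s' \<and> search_result ?src ?X (arr s' d) (arr s' p))"
    proof (rule runs_Seq[OF runs_Put[where T = 7]])
      show "runs W (Seq (For 20 (Reg 0) (For 21 (Reg 0) (For 22 (Reg 0) ?body))) Skip) (set_arr d (eval W s1 (Reg x)) (eval W s1 (Const 0)) s1)
         ((n * (n * (n * 86 + 14) + 14) + 6) + 1)
         (\<lambda>s'. base s' \<and> unchanged {d, p} s s' \<and> search_result ?src ?X (arr s' d) (arr s' p))"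
      proof (rule runs_Seq'[OF outer])
        show "I 0 0 0 (set_arr d (eval W s1 (Reg x)) (eval W s1 (Const 0)) s1)" using I0 s1x by simp
        show "\<And>y. y < 20 \<Longrightarrow> fst (set_arr d (eval W s1 (Reg x)) (eval W s1 (Const 0)) s1) y = fst s y"
          using fr1 by auto
        \<comment> \<open>With the round counter at \<open>n\<close>, the inspected edges are those
          with \<open>D u < n\<close>, that is, the edges leaving reached vertices.\<close>
        fix s' assume "I n 0 0 s'"
        then have "search_result ?src ?X (arr s' d) (arr s' p)" "G s'"
          unfolding I_def search_inv_def search_result_def by blast+
        then show "runs W Skip s' 1 (\<lambda>s'. base s' \<and> unchanged {d, p} s s' \<and> search_result ?src ?X (arr s' d) (arr s' p))"
          by (intro runs_Skip) (auto simp: G_def)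
      qed simp
    qed (use b1 dp s1x in auto)
  qed (simp add: search_time_def)
qed

end

section \<open>Testing one choice of ends and middle vertices\<close>

text \<open>For \<open>i < 3\<close>, registers \<open>2 + i\<close>, \<open>5 + i\<close>, \<open>8 + i\<close> hold the ends and the middle vertex of the
  \<open>i\<close>-th path, arrays \<open>1 + i\<close>, \<open>4 + i\<close> the distances from its two ends, and arrays \<open>7 + i\<close>, \<open>10 + i\<close> the
  corresponding predecessors. The path itself goes to array \<open>13 + i\<close> and half of its length to
  register \<open>11 + i\<close>. Array 16 and register 14 hold the best prism so far and its size, where
  size \<open>S\<close> means that there is none. Register 15 is the flag of the test.\<close>

definition leg :: "nat \<Rightarrow> nat \<Rightarrow> expr \<Rightarrow> nat \<Rightarrow> prog" where
  "leg q p ix e = For 20 (Add (Reg e) (Const 1)) (Seq (Put q ix (Reg 24)) (Assign 24 (Cell p (Reg 24))))"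

definition fill :: "nat \<Rightarrow> prog" where
  "fill i = seqs
     [Assign (11 + i) (Cell (1 + i) (Reg (8 + i))), Assign 24 (Reg (8 + i)),
      leg (13 + i) (7 + i) (Sub (Reg (11 + i)) (Reg 20)) (11 + i), Assign 24 (Reg (8 + i)),
      leg (13 + i) (10 + i) (Add (Reg (11 + i)) (Reg 20)) (11 + i)]"

definition fill_time :: "nat \<Rightarrow> nat" where
  "fill_time n = 2 * (n * 26 + 8) + 12"

lemma writes_leg [simp]: "writes (leg q p ix e) = {20, 24}"
  by (auto simp: leg_def)

lemma writes_fill [simp]: "writes (fill i) = {11 + i, 20, 24}"
  by (auto simp: fill_def)

definition odd_size :: "nat \<Rightarrow> expr" where
  "odd_size i = Add (Add (Reg (11 + i)) (Reg (11 + i))) (Const 1)"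

lemma cost_odd_size [simp]: "cost (odd_size i) = 5" by (simp add: odd_size_def)

definition same_test :: "nat \<Rightarrow> nat \<Rightarrow> expr" where
  "same_test i j = (if i = j then Equal (Reg 20) (Reg 21) else Const 0)"

text \<open>Sum and product stand for disjunction and conjunction of truth values. The sum must not
  become 2, so the disjuncts have to exclude each other; in the second case they do because half
  lengths are positive.\<close>

definition edge_test :: "nat \<Rightarrow> nat \<Rightarrow> expr" where
  "edge_test i j = (if i = j
     then Add (Equal (Add (Reg 20) (Const 1)) (Reg 21)) (Equal (Add (Reg 21) (Const 1)) (Reg 20))
     else Add (Mul (Equal (Reg 20) (Const 0)) (Equal (Reg 21) (Const 0)))
       (Mul (Equal (Reg 20) (Add (Reg (11 + i)) (Reg (11 + i)))) (Equal (Reg 21) (Add (Reg (11 + j)) (Reg (11 + j))))))"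

text \<open>Equality of truth values expresses the two equivalences in \<open>fits\<close>. Register
  15 is only ever cleared, so in the end it tells whether all pairs have passed.\<close>

definition check_pair :: "nat \<Rightarrow> nat \<Rightarrow> prog" where
  "check_pair i j = seqs [Assign 24 (Cell (13 + i) (Reg 20)), Assign 25 (Cell (13 + j) (Reg 21)),
     Cond (Equal (Equal (Reg 24) (Reg 25)) (same_test i j))
       (Cond (Equal (Adj 24 25) (edge_test i j)) Skip (Assign 15 (Const 0)))
       (Assign 15 (Const 0))]"

definition check :: "nat \<Rightarrow> nat \<Rightarrow> prog" where
  "check i j = For 20 (odd_size i) (For 21 (odd_size j) (check_pair i j))"

definition check_time :: "nat \<Rightarrow> nat" where
  "check_time n = 2 * n * (2 * n * 64 + 22) + 10"

lemma writes_check_pair [simp]: "writes (check_pair i j) = {15, 24, 25}"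
  by (auto simp: check_pair_def)

lemma writes_check [simp]: "writes (check i j) = {15, 20, 21, 24, 25}"
  by (auto simp: check_def)

definition append_path :: "nat \<Rightarrow> prog" where
  "append_path i = For 20 (odd_size i)
     (Seq (Put 16 (Reg 23) (Cell (13 + i) (Reg 20))) (Assign 23 (Add (Reg 23) (Const 1))))"

lemma writes_append_path [simp]: "writes (append_path i) = {20, 23}"
  by (auto simp: append_path_def)

context machine begin

lemma S_mono: "x < n \<Longrightarrow> x < S" "x < n \<Longrightarrow> x < W" "x \<le> 2 * n \<Longrightarrow> x < S" "x \<le> 2 * n \<Longrightarrow> x < W"
  "x \<le> 6 * n + 3 \<Longrightarrow> x < S" "x \<le> 6 * n + 3 \<Longrightarrow> x < W"
  using S_bounds by linarith+

text \<open>The loop takes one predecessor step beyond the last vertex it stores; the bound on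
  predecessors, assumed for every vertex, keeps that step inside the array. The last conjunct
  preserves what an earlier leg has written.\<close>

lemma runs_leg:
  assumes b: "base s" and q: "0 < q" "q < 31" "p < 31" "p \<noteq> q" and e: "e < 20"
    and L: "fst s e < n" "fst s 24 = m" "m < n" and P: "\<And>v. v < n \<Longrightarrow> arr s p v < n"
    and ix: "\<And>s' j. fst s' e = fst s e \<Longrightarrow> fst s' 20 = j \<Longrightarrow> j \<le> fst s e \<Longrightarrow> eval W s' ix = f j" "cost ix = 3"
    and f: "\<And>j. j \<le> fst s e \<Longrightarrow> f j < S" "inj_on f {..fst s e}"
  shows "runs W (leg q p ix e) s (n * 26 + 8) (\<lambda>s'. base s' \<and> unchanged {q} s s' \<and>
     (\<forall>j\<le>fst s e. arr s' q (f j) = (arr s p ^^ j) m) \<and>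
     (\<forall>v<S. v \<notin> f ` {..fst s e} \<longrightarrow> arr s' q v = arr s q v))"
proof -
  let ?L = "fst s e"
  have Pm: "(arr s p ^^ j) m < n" for j using L P by (induction j) auto
  define I where "I j s' \<longleftrightarrow> base s' \<and> unchanged {q} s s' \<and> fst s' 24 = (arr s p ^^ j) m \<and>
     (\<forall>i<j. arr s' q (f i) = (arr s p ^^ i) m) \<and> (\<forall>v<S. v \<notin> f ` {..?L} \<longrightarrow> arr s' q v = arr s q v)" for j s'
  show ?thesis
    unfolding leg_def
  proof (rule runs_For[where I = I and B = 16 and N = "Suc ?L"])
    show "Suc ?L < W" using L S_mono by simp
    show "I 0 (set_reg 20 0 s)" using b L by (simp add: I_def)
    show "eval W s' (Add (Reg e) (Const 1)) = Suc ?L"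
      if "same_regs_but 20 (Seq (Put q ix (Reg 24)) (Assign 24 (Cell p (Reg 24)))) s s'" for s'
      using that e L S_mono(2)[of "Suc ?L"] S_bounds by (auto simp: Suc_lessI)
    fix j s' assume I: "I j s'" and j: "j < Suc ?L" "fst s' 20 = j"
      and fr: "same_regs_but 20 (Seq (Put q ix (Reg 24)) (Assign 24 (Cell p (Reg 24)))) s s'"
    have ixj: "eval W s' ix = f j" using ix(1) fr e j by auto
    have fj: "f j < S" using f j by simp
    have r24: "fst s' 24 = (arr s p ^^ j) m" using I by (simp add: I_def)
    let ?s = "set_arr q (f j) ((arr s p ^^ j) m) s'"
    have bs: "base s'" "base ?s" using I fj q by (auto simp: I_def)
    have ap: "arr ?s p v = arr s p v" if "v < n" for v
      using I fj q S_mono(1)[OF that] by (auto simp: I_def unchanged_def)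
    have ev: "eval W ?s (Cell p (Reg 24)) = (arr s p ^^ Suc j) m"
      using bs q r24 Pm[of j] S_mono ap by simp
    have nf: "f i \<noteq> f j" if "i < j" for i using inj_onD[OF f(2), of i j] that j by auto
    have "I (Suc j) (set_reg 20 (Suc j) (set_reg 24 ((arr s p ^^ Suc j) m) ?s))"
      unfolding I_def
    proof (intro conjI allI impI)
      show "unchanged {q} s (set_reg 20 (Suc j) (set_reg 24 ((arr s p ^^ Suc j) m) ?s))"
        using I fj by (simp add: I_def unchanged_set_arr)
      show "arr (set_reg 20 (Suc j) (set_reg 24 ((arr s p ^^ Suc j) m) ?s)) q (f i) = (arr s p ^^ i) m" if "i < Suc j" for i
        using I that fj f(1)[of i] j nf[of i] by (auto simp: I_def less_Suc_eq)
      show "arr (set_reg 20 (Suc j) (set_reg 24 ((arr s p ^^ Suc j) m) ?s)) q v = arr s q v"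
        if "v < S" "v \<notin> f ` {..?L}" for v
        using I that fj j by (auto simp: I_def)
    qed (use bs in auto)
    then show "runs W (Seq (Put q ix (Reg 24)) (Assign 24 (Cell p (Reg 24)))) s' 16 (\<lambda>s''. I (Suc j) (set_reg 20 (Suc j) s''))"
      by (intro runs_Seq[where ?T1.0 = 9 and ?T2.0 = 7] runs_Put runs_Assign)
        (use bs q ixj fj r24 ev ix(2) in simp_all)
  next
    have "Suc ?L * 26 \<le> n * 26" using L by simp
    then show "Suc ?L * (16 + 7 + cost (Add (Reg e) (Const 1))) + 5 + cost (Add (Reg e) (Const 1)) \<le> n * 26 + 8" by simp
  qed (use e in \<open>auto simp: I_def\<close>)
qed

text \<open>The first leg goes down from the middle position, the second goes up from it. Both write
  the middle vertex there, so the overlap is harmless.\<close>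

lemma runs_fill:
  assumes b: "base s" and i: "i < 3" and m: "fst s (8 + i) < n" "arr s (1 + i) (fst s (8 + i)) < n"
    and P: "\<And>v. v < n \<Longrightarrow> arr s (7 + i) v < n" "\<And>v. v < n \<Longrightarrow> arr s (10 + i) v < n"
  shows "runs W (fill i) s (fill_time n) (\<lambda>s'. base s' \<and> unchanged {13 + i} s s' \<and>
     fst s' (11 + i) = arr s (1 + i) (fst s (8 + i)) \<and>
     (\<forall>k\<le>2 * fst s' (11 + i). arr s' (13 + i) k =
        route (fst s (8 + i)) (fst s' (11 + i)) (arr s (7 + i)) (arr s (10 + i)) k))"
proof -
  let ?m = "fst s (8 + i)" and ?q = "13 + i" and ?e = "11 + i"
  let ?L = "arr s (1 + i) ?m" and ?l1 = "leg (13 + i) (7 + i) (Sub (Reg (11 + i)) (Reg 20)) (11 + i)"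
    and ?l2 = "leg (13 + i) (10 + i) (Add (Reg (11 + i)) (Reg 20)) (11 + i)"
  define s1 where "s1 = set_reg 24 ?m (set_reg ?e ?L s)"
  have ev: "eval W s (Cell (1 + i) (Reg (8 + i))) = ?L" using b i m S_mono by simp
  have b1: "base s1" using b i by (simp add: s1_def)
  have r1: "fst s1 ?e = ?L" "fst s1 24 = ?m" "arr s1 = arr s" using i by (auto simp: s1_def)
  have leg1: "runs W ?l1 s1 (n * 26 + 8) (\<lambda>s'. base s' \<and> unchanged {?q} s1 s' \<and>
     (\<forall>j\<le>fst s1 ?e. arr s' ?q (fst s1 ?e - j) = (arr s1 (7 + i) ^^ j) ?m) \<and>
     (\<forall>v<S. v \<notin> (\<lambda>j. fst s1 ?e - j) ` {..fst s1 ?e} \<longrightarrow> arr s' ?q v = arr s1 ?q v))"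
    by (rule runs_leg) (use b1 i r1 m P S_mono in \<open>auto simp: inj_on_def less_imp_diff_less\<close>)
  let ?Q = "\<lambda>s'. base s' \<and> unchanged {?q} s s' \<and> fst s' ?e = ?L \<and>
     (\<forall>k\<le>2 * fst s' ?e. arr s' ?q k = route ?m (fst s' ?e) (arr s (7 + i)) (arr s (10 + i)) k)"
  have main: "runs W (Seq ?l1 (Seq (Assign 24 (Reg (8 + i))) (Seq ?l2 Skip))) s1
      ((n * 26 + 8) + (2 + ((n * 26 + 8) + 1))) ?Q"
  proof (rule runs_Seq'[OF leg1])
    fix s2 assume s2: "base s2 \<and> unchanged {?q} s1 s2 \<and>
        (\<forall>j\<le>fst s1 ?e. arr s2 ?q (fst s1 ?e - j) = (arr s1 (7 + i) ^^ j) ?m) \<and>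
        (\<forall>v<S. v \<notin> (\<lambda>j. fst s1 ?e - j) ` {..fst s1 ?e} \<longrightarrow> arr s2 ?q v = arr s1 ?q v)"
      and fr: "same_regs ?l1 s1 s2"
    define s3 where "s3 = set_reg 24 ?m s2"
    have r2: "fst s2 ?e = ?L" "fst s2 (8 + i) = ?m" using fr r1 i by (auto simp: s1_def)
    have r3: "fst s3 ?e = ?L" "fst s3 24 = ?m" "base s3" "arr s3 = arr s2"
      using r2 s2 i by (auto simp: s3_def)
    have p3: "arr s3 (10 + i) v = arr s (10 + i) v" if "v < n" for v
      using s2 S_mono(1)[OF that] r3 r1 by (simp add: unchanged_def)
    have leg2: "runs W ?l2 s3 (n * 26 + 8) (\<lambda>s'. base s' \<and> unchanged {?q} s3 s' \<and>
       (\<forall>j\<le>fst s3 ?e. arr s' ?q (fst s3 ?e + j) = (arr s3 (10 + i) ^^ j) ?m) \<and>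
       (\<forall>v<S. v \<notin> (\<lambda>j. fst s3 ?e + j) ` {..fst s3 ?e} \<longrightarrow> arr s' ?q v = arr s3 ?q v))"
      by (rule runs_leg) (use i r3 m P p3 S_mono in \<open>auto simp: inj_on_def\<close>)
    show "runs W (Seq (Assign 24 (Reg (8 + i))) (Seq ?l2 Skip)) s2 (2 + ((n * 26 + 8) + 1)) ?Q"
    proof (rule runs_Seq[OF runs_Assign[where T = 2]])
      show "runs W (Seq ?l2 Skip) (set_reg 24 (eval W s2 (Reg (8 + i))) s2) ((n * 26 + 8) + 1) ?Q"
        unfolding eval.simps r2 s3_def[symmetric]
      proof (rule runs_Seq'[OF leg2])
        fix s4 assume s4: "base s4 \<and> unchanged {?q} s3 s4 \<and>
           (\<forall>j\<le>fst s3 ?e. arr s4 ?q (fst s3 ?e + j) = (arr s3 (10 + i) ^^ j) ?m) \<and>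
           (\<forall>v<S. v \<notin> (\<lambda>j. fst s3 ?e + j) ` {..fst s3 ?e} \<longrightarrow> arr s4 ?q v = arr s3 ?q v)"
          and fr4: "same_regs ?l2 s3 s4"
        have e4: "fst s4 ?e = ?L" using fr4 r3 i by auto
        have pw: "(arr s3 (10 + i) ^^ j) ?m = (arr s (10 + i) ^^ j) ?m \<and> (arr s (10 + i) ^^ j) ?m < n" for j
          by (induction j) (use m p3 P in auto)
        have "arr s4 ?q k = route ?m ?L (arr s (7 + i)) (arr s (10 + i)) k" if k: "k \<le> 2 * ?L" for k
        proof (cases "k \<le> ?L")
          case True
          have a: "arr s2 ?q (?L - (?L - k)) = (arr s1 (7 + i) ^^ (?L - k)) ?m"
            using s2 unfolding r1 by (metis diff_le_self)
          show ?thesis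
          proof (cases "k = ?L")
            case True
            have "arr s4 ?q (?L + 0) = (arr s3 (10 + i) ^^ 0) ?m" using s4 unfolding r3 by blast
            then show ?thesis using True by (simp add: route_def)
          next
            case False
            then have "k \<notin> (\<lambda>j. ?L + j) ` {..?L}" using True by auto
            moreover have "k < S" using True m S_mono(1) by (meson le_less_trans)
            ultimately have "arr s4 ?q k = arr s2 ?q k" using s4 unfolding r3 by blast
            then show ?thesis using a True r1 by (simp add: route_def)
          qed
        next
          case False
          have "arr s4 ?q (?L + (k - ?L)) = (arr s3 (10 + i) ^^ (k - ?L)) ?m"
            using s4 k unfolding r3 by (metis le_diff_conv mult_2)
          then show ?thesis using False pw by (simp add: route_def)
        qed
        moreover have "unchanged {?q} s s4"
          using s2 s4 r1 r3 by (auto simp: unchanged_def)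
        ultimately show "runs W Skip s4 1 ?Q" using s4 e4 by (intro runs_Skip) auto
      qed simp
    qed auto
  qed simp
  have main2: "runs W (Seq (Assign 24 (Reg (8 + i))) (Seq ?l1 (Seq (Assign 24 (Reg (8 + i))) (Seq ?l2 Skip))))
      (set_reg ?e ?L s) (2 + ((n * 26 + 8) + (2 + ((n * 26 + 8) + 1)))) ?Q"
    using main unfolding s1_def by (intro runs_Seq[OF runs_Assign[where T = 2] order_refl]) simp_all
  show ?thesis
    unfolding fill_def seqs_simps
    by (rule runs_Seq[OF runs_Assign[where T = 7],
        where ?T2.0 = "2 + ((n * 26 + 8) + (2 + ((n * 26 + 8) + 1)))"])
      (use main2 ev in \<open>simp_all add: fill_time_def\<close>)
qed

end

text \<open>In a minimum even prism both searches find the middle vertex at half the length of the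
  path, by \<open>replace_route\<close>. Distance \<open>n\<close> marks an unreached vertex, and
  excluding it keeps \<open>fill\<close> inside its array.\<close>

definition tests :: "nat \<Rightarrow> expr list" where
  "tests i = [Equal (Cell (1 + i) (Reg (8 + i))) (Cell (4 + i) (Reg (8 + i))),
     Less (Const 0) (Cell (1 + i) (Reg (8 + i))), Less (Cell (1 + i) (Reg (8 + i))) (Reg 0)]"

definition checks :: "(nat \<times> nat) list \<Rightarrow> prog" where
  "checks ps = seqs (map (\<lambda>(i, j). check i j) ps)"

definition store_best :: prog where
  "store_best = seqs [Assign 23 (Const 0), append_path 0, append_path 1, append_path 2, Assign 14 (Reg 23)]"

definition store_time :: "nat \<Rightarrow> nat" where
  "store_time n = 3 * (2 * n * 28 + 10) + 10"

definition total_size :: expr where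
  "total_size = Add (Add (odd_size 0) (odd_size 1)) (odd_size 2)"

definition all_pairs :: "(nat \<times> nat) list" where
  "all_pairs = [(0,0), (0,1), (0,2), (1,0), (1,1), (1,2), (2,0), (2,1), (2,2)]"

definition attempt :: prog where
  "attempt = guards (tests 0 @ tests 1 @ tests 2)
     (seqs [fill 0, fill 1, fill 2, Assign 15 (Const 1), checks all_pairs,
        guards [Equal (Reg 15) (Const 1), Less total_size (Reg 14)] store_best])"

definition attempt_time :: "nat \<Rightarrow> nat" where
  "attempt_time n = 3 * fill_time n + 9 * check_time n + store_time n + 200"

lemma writes_checks: "writes (checks ps) \<subseteq> {15, 20, 21, 24, 25}"
  by (auto simp: checks_def split: prod.splits)

lemma writes_store_best [simp]: "writes store_best = {14, 20, 23}"
  by (auto simp: store_best_def)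

lemma writes_attempt: "writes attempt \<subseteq> {11..15} \<union> {20..25}"
  using writes_checks[of all_pairs] by (auto simp: attempt_def)

context machine begin

definition slots :: "state \<Rightarrow> nat \<Rightarrow> nat \<Rightarrow> nat" where
  "slots s i = arr s (13 + i)"

definition halves :: "state \<Rightarrow> nat \<Rightarrow> nat" where
  "halves s i = fst s (11 + i)"

abbreviation pair_fits :: "state \<Rightarrow> nat \<Rightarrow> nat \<Rightarrow> bool" where
  "pair_fits s i j \<equiv> \<forall>x\<le>2 * halves s i. \<forall>y\<le>2 * halves s j. fits E (slots s) (halves s) i j x y"

lemma eval_same_test:
  "eval W s (same_test i j) = of_bool (i = j \<and> fst s 20 = fst s 21)"
  by (simp add: same_test_def)

lemma eval_edge_test:
  assumes "fst s 20 \<le> 2 * n" "fst s 21 \<le> 2 * n" "halves s i < n" "halves s j < n" "0 < halves s i"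
  shows "eval W s (edge_test i j) = of_bool (if i = j then Suc (fst s 20) = fst s 21 \<or> Suc (fst s 21) = fst s 20
    else fst s 20 = 0 \<and> fst s 21 = 0 \<or> fst s 20 = 2 * halves s i \<and> fst s 21 = 2 * halves s j)"
proof -
  have w: "Suc (fst s 20) < W" "Suc (fst s 21) < W" "2 * halves s i < W" "2 * halves s j < W" "2 < W" "1 < W" "Suc 0 < W"
    using assms S_bounds by linarith+
  have d: "halves s i + halves s i = 2 * halves s i" for i by simp
  show ?thesis
    using w assms(5) by (auto simp: edge_test_def halves_def[symmetric] d)
qed

lemma eval_odd_size:
  assumes "halves s i < n" shows "eval W s (odd_size i) = 2 * halves s i + 1"
proof -
  have "2 * halves s i + 1 < W" "2 * halves s i < W" "1 < W" using assms S_bounds by linarith+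
  then show ?thesis by (simp add: odd_size_def halves_def mult_2)
qed

lemma runs_check_pair:
  assumes b: "base s" and ij: "i < 3" "j < 3" and h: "halves s i < n" "halves s j < n" "0 < halves s i"
    and x: "fst s 20 \<le> 2 * halves s i" and y: "fst s 21 \<le> 2 * halves s j"
    and q: "slots s i (fst s 20) < n" "slots s j (fst s 21) < n"
  shows "runs W (check_pair i j) s 52 (\<lambda>s'. base s' \<and> snd s' = snd s \<and>
     (fst s' 15 = 1 \<longleftrightarrow> fst s 15 = 1 \<and> fits E (slots s) (halves s) i j (fst s 20) (fst s 21)))"
proof -
  let ?test = "Cond (Equal (Equal (Reg 24) (Reg 25)) (same_test i j))
       (Cond (Equal (Adj 24 25) (edge_test i j)) Skip (Assign 15 (Const 0))) (Assign 15 (Const 0))"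
  let ?u = "slots s i (fst s 20)" and ?v = "slots s j (fst s 21)"
  define s1 where "s1 = set_reg 24 ?u s"
  define s2 where "s2 = set_reg 25 ?v s1"
  have xS: "fst s 20 < S" "fst s 21 < S" "fst s 20 \<le> 2 * n" "fst s 21 \<le> 2 * n"
    using x y h S_bounds by linarith+
  have e1: "eval W s (Cell (13 + i) (Reg 20)) = ?u" using b ij xS by (simp add: slots_def)
  have e2: "eval W s1 (Cell (13 + j) (Reg 21)) = ?v" using b ij xS by (simp add: slots_def s1_def)
  have b2: "base s2" using b by (simp add: s2_def s1_def)
  have r2: "fst s2 24 = ?u" "fst s2 25 = ?v" "fst s2 20 = fst s 20" "fst s2 21 = fst s 21" "fst s2 15 = fst s 15" "snd s2 = snd s"
    by (simp_all add: s2_def s1_def)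
  have h2: "halves s2 i = halves s i" "halves s2 j = halves s j"
    using ij by (simp_all add: halves_def s2_def s1_def)
  have t1: "eval W s2 (Equal (Equal (Reg 24) (Reg 25)) (same_test i j)) \<noteq> 0 \<longleftrightarrow>
      (?u = ?v \<longleftrightarrow> i = j \<and> fst s 20 = fst s 21)"
    using eval_same_test[of s2 i j] r2 by auto
  have "eval W s2 (Adj 24 25) = of_bool (E ?u ?v)" using b2 q r2 by simp
  then have t2: "eval W s2 (Equal (Adj 24 25) (edge_test i j)) \<noteq> 0 \<longleftrightarrow>
      (E ?u ?v \<longleftrightarrow> (if i = j then Suc (fst s 20) = fst s 21 \<or> Suc (fst s 21) = fst s 20
        else fst s 20 = 0 \<and> fst s 21 = 0 \<or> fst s 20 = 2 * halves s i \<and> fst s 21 = 2 * halves s j))"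
    using eval_edge_test[of s2 i j] r2 h2 h xS by auto
  let ?Q = "\<lambda>s'. base s' \<and> snd s' = snd s \<and>
     (fst s' 15 = 1 \<longleftrightarrow> fst s 15 = 1 \<and> fits E (slots s) (halves s) i j (fst s 20) (fst s 21))"
  have no: "runs W (Assign 15 (Const 0)) s2 2 ?Q" if "\<not> fits E (slots s) (halves s) i j (fst s 20) (fst s 21)"
    by (rule runs_Assign) (use that b2 r2 in auto)
  have ce: "cost (same_test i j) \<le> 3" "cost (edge_test i j) \<le> 19"
    by (auto simp: same_test_def edge_test_def)
  have cond: "runs W ?test s2 37 ?Q"
  proof (rule runs_Cond[where ?T1.0 = 29])
    assume 1: "eval W s2 (Equal (Equal (Reg 24) (Reg 25)) (same_test i j)) \<noteq> 0"
    show "runs W (Cond (Equal (Adj 24 25) (edge_test i j)) Skip (Assign 15 (Const 0))) s2 29 ?Q"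
    proof (rule runs_Cond[where ?T1.0 = 2])
      assume "eval W s2 (Equal (Adj 24 25) (edge_test i j)) \<noteq> 0"
      then have "fits E (slots s) (halves s) i j (fst s 20) (fst s 21)"
        using 1 unfolding t1 t2 fits_def by blast
      then show "runs W Skip s2 2 ?Q" using b2 r2 by (intro runs_Skip) auto
    next
      assume "eval W s2 (Equal (Adj 24 25) (edge_test i j)) = 0"
      then show "runs W (Assign 15 (Const 0)) s2 2 ?Q"
        using t2 by (intro no) (auto simp: fits_def)
    qed (use ce in simp)
  next
    assume "eval W s2 (Equal (Equal (Reg 24) (Reg 25)) (same_test i j)) = 0"
    then have "\<not> fits E (slots s) (halves s) i j (fst s 20) (fst s 21)" using t1 unfolding fits_def by blast
    then show "runs W (Assign 15 (Const 0)) s2 29 ?Q" by (intro runs_conseq[OF no]) auto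
  qed (use ce in simp)
  have "runs W (Seq ?test Skip) s2 38 ?Q"
    by (rule runs_Seq'[OF cond]) (auto intro: runs_Skip)
  then have "runs W (Seq (Assign 25 (Cell (13 + j) (Reg 21))) (Seq ?test Skip)) s1 45 ?Q"
    by - (rule runs_Seq[OF runs_Assign[where T = 7], where ?T2.0 = 38]; simp add: e2 s2_def)
  then show ?thesis
    unfolding check_pair_def seqs_simps
    by - (rule runs_Seq[OF runs_Assign[where T = 7], where ?T2.0 = 45]; simp add: e1 s1_def)
qed

lemma runs_check:
  assumes b: "base s" and ij: "i < 3" "j < 3" and h: "halves s i < n" "halves s j < n" "0 < halves s i"
    and q: "\<And>x. x \<le> 2 * halves s i \<Longrightarrow> slots s i x < n" "\<And>y. y \<le> 2 * halves s j \<Longrightarrow> slots s j y < n"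
  shows "runs W (check i j) s (check_time n) (\<lambda>s'. base s' \<and> snd s' = snd s \<and>
     (fst s' 15 = 1 \<longleftrightarrow> fst s 15 = 1 \<and>
       pair_fits s i j))"
proof -
  define F where "F x y \<longleftrightarrow> fits E (slots s) (halves s) i j x y" for x y
  have hW: "2 * halves s k + 1 < W" if "halves s k < n" for k using that S_bounds by linarith
  have fc: "fits E (slots s') (halves s') i j x y \<longleftrightarrow> F x y"
    if "snd s' = snd s" "halves s' i = halves s i" "halves s' j = halves s j" for s' x y
    using that by (simp add: F_def fits_def slots_def arr_def)
  have sl: "slots s' = slots s" if "snd s' = snd s" for s'
    using that by (simp add: slots_def arr_def fun_eq_iff)
  define I where "I x s' \<longleftrightarrow> base s' \<and> snd s' = snd s \<and> (fst s' 15 = 1 \<longleftrightarrow> fst s 15 = 1 \<and>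
      (\<forall>x'<x. \<forall>y\<le>2 * halves s j. F x' y))" for x s'
  show ?thesis
    unfolding check_def
  proof (rule runs_For[where I = I and N = "2 * halves s i + 1" and B = "2 * n * 64 + 10"])
    show "2 * halves s i + 1 < W" using hW h by blast
    show "I 0 (set_reg 20 0 s)" using b by (simp add: I_def)
    show "eval W s' (odd_size i) = 2 * halves s i + 1"
      if "same_regs_but 20 (For 21 (odd_size j) (check_pair i j)) s s'" for s'
      using eval_odd_size[of s' i] that ij h by (simp add: halves_def)
    fix x s1 assume I: "I x s1" "x < 2 * halves s i + 1" "fst s1 20 = x"
      and fr1: "same_regs_but 20 (For 21 (odd_size j) (check_pair i j)) s s1"
    have h1: "halves s1 i = halves s i" "halves s1 j = halves s j" using fr1 ij by (simp_all add: halves_def)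
    define J where "J y s' \<longleftrightarrow> base s' \<and> snd s' = snd s \<and> (fst s' 15 = 1 \<longleftrightarrow> fst s1 15 = 1 \<and>
      (\<forall>y'<y. F x y'))" for y s'
    show "runs W (For 21 (odd_size j) (check_pair i j)) s1 (2 * n * 64 + 10) (\<lambda>s''. I (Suc x) (set_reg 20 (Suc x) s''))"
    proof (rule runs_For[where I = J and N = "2 * halves s j + 1" and B = 52])
      show "2 * halves s j + 1 < W" using hW h by blast
      show "J 0 (set_reg 21 0 s1)" using I by (simp add: I_def J_def)
      show "eval W s' (odd_size j) = 2 * halves s j + 1"
        if "same_regs_but 21 (check_pair i j) s1 s'" for s'
        using eval_odd_size[of s' j] that ij h h1 by (simp add: halves_def)
      fix y s2 assume J: "J y s2" "y < 2 * halves s j + 1" "fst s2 21 = y"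
        and fr2: "same_regs_but 21 (check_pair i j) s1 s2"
      have h2: "halves s2 i = halves s i" "halves s2 j = halves s j" using fr2 h1 ij by (simp_all add: halves_def)
      have m2: "snd s2 = snd s" "base s2" "fst s2 20 = x" using J fr2 I by (auto simp: J_def)
      have cp: "runs W (check_pair i j) s2 52 (\<lambda>s'. base s' \<and> snd s' = snd s2 \<and>
         (fst s' 15 = 1 \<longleftrightarrow> fst s2 15 = 1 \<and> fits E (slots s2) (halves s2) i j (fst s2 20) (fst s2 21)))"
        by (rule runs_check_pair) (use m2 ij h2 h I J q sl[OF m2(1)] in auto)
      show "runs W (check_pair i j) s2 52 (\<lambda>s''. J (Suc y) (set_reg 21 (Suc y) s''))"
      proof (rule runs_conseq[OF cp order_refl])
        fix s' assume "base s' \<and> snd s' = snd s2 \<and>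
         (fst s' 15 = 1 \<longleftrightarrow> fst s2 15 = 1 \<and> fits E (slots s2) (halves s2) i j (fst s2 20) (fst s2 21))"
        then show "J (Suc y) (set_reg 21 (Suc y) s')"
          using fc[OF m2(1) h2] m2 J by (auto simp: J_def All_less_Suc)
      qed
    next
      fix s' assume "J (2 * halves s j + 1) s'"
      then have "base s'" "snd s' = snd s" "fst s' 15 = 1 \<longleftrightarrow> fst s1 15 = 1 \<and> (\<forall>y\<le>2 * halves s j. F x y)"
        by (simp_all add: J_def less_Suc_eq_le)
      moreover have "fst s1 15 = 1 \<longleftrightarrow> fst s 15 = 1 \<and> (\<forall>x'<x. \<forall>y\<le>2 * halves s j. F x' y)"
        using I by (simp add: I_def)
      ultimately show "I (Suc x) (set_reg 20 (Suc x) s')"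
        unfolding I_def All_less_Suc by simp blast
    next
      \<comment> \<open>A round costs 52 for the body and \<open>7 + 5\<close> for the loop, 5 being
        the cost of \<open>odd_size\<close>. As \<open>halves s j < n\<close>, there are fewer than
        \<open>2 * n\<close> rounds.\<close>
      have "(2 * halves s j + 1) * 64 \<le> (2 * n) * 64" by (rule mult_right_mono) (use h in auto)
      then show "(2 * halves s j + 1) * (52 + 7 + cost (odd_size j)) + 5 + cost (odd_size j) \<le> 2 * n * 64 + 10" by simp
    qed simp
  next
    fix s' assume "I (2 * halves s i + 1) s'"
    then show "base s' \<and> snd s' = snd s \<and> (fst s' 15 = 1 \<longleftrightarrow> fst s 15 = 1 \<and>
       pair_fits s i j)"
      by (simp add: I_def F_def less_Suc_eq_le)
  next
    have "(2 * halves s i + 1) * (2 * n * 64 + 22) \<le> (2 * n) * (2 * n * 64 + 22)"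
      by (rule mult_right_mono) (use h in auto)
    then show "(2 * halves s i + 1) * (2 * n * 64 + 10 + 7 + cost (odd_size i)) + 5 + cost (odd_size i) \<le> check_time n"
      by (simp add: check_time_def algebra_simps)
  qed simp
qed

lemma runs_checks:
  assumes "base s" "set ps \<subseteq> {..<3} \<times> {..<3}" "\<And>i. i < 3 \<Longrightarrow> halves s i < n \<and> 0 < halves s i"
    and "\<And>i x. i < 3 \<Longrightarrow> x \<le> 2 * halves s i \<Longrightarrow> slots s i x < n"
  shows "runs W (checks ps) s (length ps * check_time n + 1) (\<lambda>s'. base s' \<and> snd s' = snd s \<and>
     (fst s' 15 = 1 \<longleftrightarrow> fst s 15 = 1 \<and> (\<forall>(i, j)\<in>set ps.
       pair_fits s i j)))"
  using assms
proof (induction ps arbitrary: s)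
  case Nil
  then show ?case by (auto simp: checks_def intro: runs_Skip)
next
  case (Cons p ps)
  obtain i j where p: "p = (i, j)" by fastforce
  then have ij: "i < 3" "j < 3" using Cons.prems by auto
  have c: "checks (p # ps) = Seq (check i j) (checks ps)" by (simp add: checks_def p)
  show ?case unfolding c
  proof (rule runs_Seq'[OF runs_check[OF Cons.prems(1) ij]])
    fix s1 assume s1: "base s1 \<and> snd s1 = snd s \<and>
     (fst s1 15 = 1 \<longleftrightarrow> fst s 15 = 1 \<and>
       pair_fits s i j)"
      and fr: "same_regs (check i j) s s1"
    have sl: "slots s1 = slots s" using s1 by (simp add: slots_def arr_def fun_eq_iff)
    have h: "halves s1 k = halves s k" if "k < 3" for k using fr that by (simp add: halves_def)
    have cs: "runs W (checks ps) s1 (length ps * check_time n + 1) (\<lambda>s'. base s' \<and> snd s' = snd s1 \<and>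
     (fst s' 15 = 1 \<longleftrightarrow> fst s1 15 = 1 \<and> (\<forall>(i, j)\<in>set ps.
       pair_fits s1 i j)))"
      by (rule Cons.IH) (use Cons.prems s1 sl h in auto)
    have eq: "(\<forall>(i, j)\<in>set ps. pair_fits s1 i j) \<longleftrightarrow>
      (\<forall>(i, j)\<in>set ps. pair_fits s i j)"
      by (rule ball_cong[OF refl]) (use Cons.prems(2) h sl in \<open>auto simp: fits_def\<close>)
    show "runs W (checks ps) s1 (length ps * check_time n + 1) (\<lambda>s'. base s' \<and> snd s' = snd s \<and>
     (fst s' 15 = 1 \<longleftrightarrow> fst s 15 = 1 \<and> (\<forall>(i, j)\<in>set (p # ps).
       pair_fits s i j)))"
      by (rule runs_conseq[OF cs[unfolded eq] order_refl]) (use s1 in \<open>auto simp: p\<close>)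
  qed (use Cons.prems ij in auto)
qed

text \<open>The output is a set of vertices, so the invariant follows images of initial segments and
  not the order of the entries.\<close>

lemma runs_append_path:
  assumes b: "base s" and i: "i < 3" and h: "halves s i < n" and z: "fst s 23 = z" "z \<le> 4 * n"
  shows "runs W (append_path i) s (2 * n * 28 + 10) (\<lambda>s'. base s' \<and> unchanged {16} s s' \<and>
     fst s' 23 = z + (2 * halves s i + 1) \<and>
     arr s' 16 ` {..<z + (2 * halves s i + 1)} = arr s 16 ` {..<z} \<union> slots s i ` {..2 * halves s i})"
proof -
  let ?N = "2 * halves s i + 1"
  define I where "I x s' \<longleftrightarrow> base s' \<and> unchanged {16} s s' \<and> fst s' 23 = z + x \<and>
     arr s' 16 ` {..<z + x} = arr s 16 ` {..<z} \<union> slots s i ` {..<x}" for x s'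
  have bound: "z + x < S" "z + x < W" "x < S" if "x \<le> ?N" for x
    using that z h S_bounds by linarith+
  show ?thesis
    unfolding append_path_def
  proof (rule runs_For[where I = I and N = ?N and B = 16])
    show "?N < W" using bound[of ?N] by simp
    show "I 0 (set_reg 20 0 s)" using b z by (simp add: I_def)
    show "eval W s' (odd_size i) = ?N"
      if "same_regs_but 20 (Seq (Put 16 (Reg 23) (Cell (13 + i) (Reg 20))) (Assign 23 (Add (Reg 23) (Const 1)))) s s'" for s'
      using eval_odd_size[of s' i] that i h by (simp add: halves_def)
    fix x s' assume I: "I x s'" and x: "x < ?N" "fst s' 20 = x"
    have bx: "z + x < S" "z + Suc x < W" "x < S" using bound[of x] bound[of "Suc x"] x by auto
    have b': "base s'" and z': "fst s' 23 = z + x" using I by (auto simp: I_def)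
    have ev: "eval W s' (Cell (13 + i) (Reg 20)) = slots s i x"
      using b' i x bx I by (simp add: I_def slots_def unchanged_def)
    let ?s = "set_arr 16 (z + x) (slots s i x) s'"
    have eq: "arr ?s 16 k = arr s' 16 k" if "k < z + x" for k using that bx by simp
    have "arr ?s 16 ` {..<z + Suc x} = insert (arr ?s 16 (z + x)) (arr ?s 16 ` {..<z + x})"
      by (simp add: lessThan_Suc)
    also have "\<dots> = insert (slots s i x) (arr s' 16 ` {..<z + x})"
      using eq bx by (auto simp: image_def)
    also have "\<dots> = arr s 16 ` {..<z} \<union> slots s i ` {..<Suc x}"
      using I by (auto simp: I_def lessThan_Suc)
    finally have im: "arr ?s 16 ` {..<z + Suc x} = arr s 16 ` {..<z} \<union> slots s i ` {..<Suc x}" .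
    have "I (Suc x) (set_reg 20 (Suc x) (set_reg 23 (z + Suc x) ?s))"
      unfolding I_def using I bx im by (simp add: I_def unchanged_set_arr)
    then show "runs W (Seq (Put 16 (Reg 23) (Cell (13 + i) (Reg 20))) (Assign 23 (Add (Reg 23) (Const 1)))) s' 16
        (\<lambda>s''. I (Suc x) (set_reg 20 (Suc x) s''))"
      by (intro runs_Seq[where ?T1.0 = 12 and ?T2.0 = 4] runs_Put runs_Assign)
        (use b' z' bx ev in simp_all)
  next
    fix s' assume "I ?N s'"
    moreover have "{..<?N} = {..2 * halves s i}" by auto
    ultimately show "base s' \<and> unchanged {16} s s' \<and> fst s' 23 = z + ?N \<and>
       arr s' 16 ` {..<z + ?N} = arr s 16 ` {..<z} \<union> slots s i ` {..2 * halves s i}"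
      by (simp add: I_def)
  next
    have "?N * 28 \<le> (2 * n) * 28" by (rule mult_right_mono) (use h in auto)
    then show "?N * (16 + 7 + cost (odd_size i)) + 5 + cost (odd_size i) \<le> 2 * n * 28 + 10" by simp
  qed simp
qed

end

lemma fits_all_cong:
  assumes "\<And>i. i < 3 \<Longrightarrow> e i = e' i" "\<And>i x. i < 3 \<Longrightarrow> x \<le> 2 * e i \<Longrightarrow> Q i x = Q' i x"
  shows "fits_all E Q e \<longleftrightarrow> fits_all E Q' e'"
  using assms unfolding fits_all_def fits_def by simp

lemma all_pairs_iff: "(\<forall>(i, j)\<in>set all_pairs. B i j) \<longleftrightarrow> (\<forall>i<3. \<forall>j<3. B i j)"
  unfolding all3 all_pairs_def by auto

section \<open>Soundness and effect of one attempt\<close>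

locale prism_machine = machine n S W E + odd_hole_free "{..<n}" E
  for n S W :: nat and E :: "nat \<Rightarrow> nat \<Rightarrow> bool"
begin

lemma fits_all_even_prism:
  assumes f: "fits_all E Q e" and e: "\<And>i. i < 3 \<Longrightarrow> 0 < e i" and Q: "\<And>i x. i < 3 \<Longrightarrow> x \<le> 2 * e i \<Longrightarrow> Q i x < n"
  shows "even_prism_of {..<n} E (Q 0 ` {..2 * e 0} \<union> Q 1 ` {..2 * e 1} \<union> Q 2 ` {..2 * e 2})"
    and "card (Q 0 ` {..2 * e 0} \<union> Q 1 ` {..2 * e 1} \<union> Q 2 ` {..2 * e 2}) = (2 * e 0 + 1) + (2 * e 1 + 1) + (2 * e 2 + 1)"
proof -
  have "prism E (path_list Q e 0) (path_list Q e 1) (path_list Q e 2)" using fits_all_prism e f by blast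
  then have K: "even_prism_paths (path_list Q e 0) (path_list Q e 1) (path_list Q e 2)"
    using Q unfolding even_prism_paths_def set_path_list by auto
  then show "even_prism_of {..<n} E (Q 0 ` {..2 * e 0} \<union> Q 1 ` {..2 * e 1} \<union> Q 2 ` {..2 * e 2})"
    unfolding even_prism_of_iff set_path_list[symmetric] by blast
  show "card (Q 0 ` {..2 * e 0} \<union> Q 1 ` {..2 * e 1} \<union> Q 2 ` {..2 * e 2}) = (2 * e 0 + 1) + (2 * e 1 + 1) + (2 * e 2 + 1)"
    using card_even_prism_paths[OF K] unfolding set_path_list length_path_list .
qed

lemma runs_store_best:
  assumes b: "base s" and h: "\<And>i. i < 3 \<Longrightarrow> halves s i < n"
    and N: "N = (2 * halves s 0 + 1) + (2 * halves s 1 + 1) + (2 * halves s 2 + 1)"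
  shows "runs W store_best s (store_time n) (\<lambda>s'. base s' \<and> unchanged {16} s s' \<and> fst s' 14 = N \<and>
     arr s' 16 ` {..<N} = slots s 0 ` {..2 * halves s 0} \<union> slots s 1 ` {..2 * halves s 1} \<union> slots s 2 ` {..2 * halves s 2})"
    (is "runs W _ _ _ ?Q")
proof -
  let ?h = "halves s" and ?T = "2 * n * 28 + 10"
  define z1 z2 where "z1 = 2 * ?h 0 + 1" and "z2 = z1 + (2 * ?h 1 + 1)"
  have z: "z1 \<le> 4 * n" "z2 \<le> 4 * n" "N = z2 + (2 * ?h 2 + 1)"
    using h[of 0] h[of 1] by (simp_all add: z1_def z2_def N)
  have sl: "slots s' i ` {..2 * ?h i} = slots s i ` {..2 * ?h i}" if "unchanged {16} s s'" "i < 3" for s' i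
  proof (rule image_cong[OF refl])
    fix x assume "x \<in> {..2 * ?h i}"
    then have "x \<le> 2 * ?h i" by simp
    then have "x < S" using h[OF that(2)] S_bounds(3) by linarith
    then show "slots s' i x = slots s i x" using that by (simp add: slots_def unchanged_def)
  qed
  define s0 where "s0 = set_reg 23 0 s"
  have s0: "base s0" "arr s0 = arr s" "slots s0 = slots s" "fst s0 23 = 0" "\<And>i. i < 3 \<Longrightarrow> halves s0 i = ?h i"
    using b by (simp_all add: s0_def halves_def slots_def fun_eq_iff)
  have u0: "unchanged {16} s0 s' = unchanged {16} s s'" for s' by (simp add: unchanged_def s0)
  have hf: "halves s' i = halves s'' i" if "same_regs (append_path k) s'' s'" "i < 3" for s' s'' i k
    using that by (simp add: halves_def)
  have A3: "runs W (Seq (append_path 2) (Seq (Assign 14 (Reg 23)) Skip)) s2 (?T + 3) ?Q"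
    if s2: "base s2" "unchanged {16} s s2" "fst s2 23 = z2" "\<And>i. i < 3 \<Longrightarrow> halves s2 i = ?h i"
      "arr s2 16 ` {..<z2} = slots s 0 ` {..2 * ?h 0} \<union> slots s 1 ` {..2 * ?h 1}" for s2
  proof (rule runs_Seq'[OF runs_append_path[where z = z2]])
    fix s3 assume s3: "base s3 \<and> unchanged {16} s2 s3 \<and> fst s3 23 = z2 + (2 * halves s2 2 + 1) \<and>
       arr s3 16 ` {..<z2 + (2 * halves s2 2 + 1)} = arr s2 16 ` {..<z2} \<union> slots s2 2 ` {..2 * halves s2 2}"
    have "?Q (set_reg 14 (fst s3 23) s3)"
      using s3 s2 z sl[OF s2(2)] unchanged_trans[OF s2(2), of "{16}" s3 "{16}"] by simp
    then show "runs W (Seq (Assign 14 (Reg 23)) Skip) s3 3 ?Q"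
      by - (rule runs_Seq[OF runs_Assign[where T = 2], where ?T2.0 = 1]; simp add: runs_Skip)
  qed (use s2 z h in auto)
  have A2: "runs W (Seq (append_path 1) (Seq (append_path 2) (Seq (Assign 14 (Reg 23)) Skip))) s1 (?T + (?T + 3)) ?Q"
    if s1: "base s1" "unchanged {16} s s1" "fst s1 23 = z1" "\<And>i. i < 3 \<Longrightarrow> halves s1 i = ?h i"
      "arr s1 16 ` {..<z1} = slots s 0 ` {..2 * ?h 0}" for s1
  proof (rule runs_Seq'[OF runs_append_path[where z = z1]])
    fix s2 assume s2: "base s2 \<and> unchanged {16} s1 s2 \<and> fst s2 23 = z1 + (2 * halves s1 1 + 1) \<and>
       arr s2 16 ` {..<z1 + (2 * halves s1 1 + 1)} = arr s1 16 ` {..<z1} \<union> slots s1 1 ` {..2 * halves s1 1}"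
      and fr: "same_regs (append_path 1) s1 s2"
    show "runs W (Seq (append_path 2) (Seq (Assign 14 (Reg 23)) Skip)) s2 (?T + 3) ?Q"
      by (rule A3) (use s2 s1 hf[OF fr] sl[OF s1(2)] unchanged_trans[OF s1(2), of "{16}" s2 "{16}"] in \<open>auto simp: z2_def\<close>)
  qed (use s1 z h in auto)
  have A1: "runs W (Seq (append_path 0) (Seq (append_path 1) (Seq (append_path 2) (Seq (Assign 14 (Reg 23)) Skip)))) s0
     (?T + (?T + (?T + 3))) ?Q"
  proof (rule runs_Seq'[OF runs_append_path[where z = 0]])
    fix s1 assume s1: "base s1 \<and> unchanged {16} s0 s1 \<and> fst s1 23 = 0 + (2 * halves s0 0 + 1) \<and>
       arr s1 16 ` {..<0 + (2 * halves s0 0 + 1)} = arr s0 16 ` {..<0} \<union> slots s0 0 ` {..2 * halves s0 0}"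
      and fr: "same_regs (append_path 0) s0 s1"
    show "runs W (Seq (append_path 1) (Seq (append_path 2) (Seq (Assign 14 (Reg 23)) Skip))) s1 (?T + (?T + 3)) ?Q"
      by (rule A2) (use s1 s0 u0 hf[OF fr] in \<open>auto simp: z1_def\<close>)
  qed (use s0 h in auto)
  show ?thesis
    unfolding store_best_def seqs_simps
    by (rule runs_Seq[OF runs_Assign[where T = 2], where ?T2.0 = "?T + (?T + (?T + 3))"])
      (use A1 in \<open>simp_all add: s0_def store_time_def\<close>)
qed

text \<open>The soundness invariant. It does not mention the search tables and hence survives their
  recomputation. The cardinality makes register 14, which counts list entries, the true size of the
  prism.\<close>

definition state_inv :: "state \<Rightarrow> bool" where
  "state_inv s \<longleftrightarrow> base s \<and> fst s 14 \<le> S \<and> (fst s 14 < S \<longrightarrow>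
     even_prism_of {..<n} E (arr s 16 ` {..<fst s 14}) \<and> card (arr s 16 ` {..<fst s 14}) = fst s 14)"

definition mid_dist :: "state \<Rightarrow> nat \<Rightarrow> nat" where
  "mid_dist s i = arr s (1 + i) (fst s (8 + i))"

definition routes :: "state \<Rightarrow> nat \<Rightarrow> nat \<Rightarrow> nat" where
  "routes s i = route (fst s (8 + i)) (mid_dist s i) (arr s (7 + i)) (arr s (10 + i))"

definition middles_ok :: "state \<Rightarrow> bool" where
  "middles_ok s \<longleftrightarrow> (\<forall>i<3. mid_dist s i = arr s (4 + i) (fst s (8 + i)) \<and> 0 < mid_dist s i \<and> mid_dist s i < n)"

definition size3 :: "(nat \<Rightarrow> nat) \<Rightarrow> nat" where
  "size3 e = (2 * e 0 + 1) + (2 * e 1 + 1) + (2 * e 2 + 1)"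

text \<open>Everything is measured against the state \<open>s\<close> before the first
  \<open>fill\<close>, because no \<open>fill\<close> changes what \<open>routes s\<close> and
  \<open>mid_dist s\<close> read. Register 15 is exempt so that raising the flag preserves the
  predicate.\<close>

definition filled :: "state \<Rightarrow> nat set \<Rightarrow> state \<Rightarrow> bool" where
  "filled s A s' \<longleftrightarrow> base s' \<and> unchanged {13, 14, 15} s s' \<and>
     (\<forall>x. x \<notin> {11, 12, 13, 15, 20, 24} \<longrightarrow> fst s' x = fst s x) \<and>
     (\<forall>i\<in>A. halves s' i = mid_dist s i \<and> (\<forall>k\<le>2 * mid_dist s i. slots s' i k = routes s i k))"

lemma runs_fill_next:
  assumes f: "filled s A s1" and i: "i < 3" "A \<subseteq> {..<3}" "i \<notin> A" and ok: "middles_ok s"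
    and m: "\<And>i. i < 3 \<Longrightarrow> fst s (8 + i) < n"
    and P: "\<And>i v. i < 3 \<Longrightarrow> v < n \<Longrightarrow> arr s (7 + i) v < n \<and> arr s (10 + i) v < n"
  shows "runs W (fill i) s1 (fill_time n) (filled s (insert i A))"
proof -
  have un: "arr s1 c v = arr s c v" if "v < n" "c < 13" for c v
    using f that S_mono(1) by (simp add: filled_def unchanged_def)
  have r: "fst s1 (8 + i) = fst s (8 + i)" using f i by (simp add: filled_def)
  have dn: "mid_dist s i < n" "0 < mid_dist s i" if "i < 3" for i
    using ok that unfolding middles_ok_def by blast+
  have d: "arr s1 (1 + i) (fst s (8 + i)) = mid_dist s i" "mid_dist s i < n"
    using un[OF m] i dn by (simp_all add: mid_dist_def)
  have pw: "((arr s1 c ^^ j) (fst s (8 + i))) = ((arr s c ^^ j) (fst s (8 + i))) \<and> ((arr s c ^^ j) (fst s (8 + i))) < n"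
    if "c = 7 + i \<or> c = 10 + i" for j c
    by (induction j) (use that m P i un in auto)
  have rt: "route (fst s (8 + i)) (mid_dist s i) (arr s1 (7 + i)) (arr s1 (10 + i)) k = routes s i k" for k
    using pw by (simp add: routes_def route_def)
  show ?thesis
  proof (rule runs_conseq[OF runs_fill[of s1 i] order_refl])
    fix s2 assume s2: "base s2 \<and> unchanged {13 + i} s1 s2 \<and> fst s2 (11 + i) = arr s1 (1 + i) (fst s1 (8 + i)) \<and>
      (\<forall>k\<le>2 * fst s2 (11 + i). arr s2 (13 + i) k =
        route (fst s1 (8 + i)) (fst s2 (11 + i)) (arr s1 (7 + i)) (arr s1 (10 + i)) k)"
      and fr: "same_regs (fill i) s1 s2"
    have "i = 0 \<or> i = 1 \<or> i = 2" using i by auto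
    then have "{13 + i} \<subseteq> {13, 14, 15}" "11 + i \<in> {11, 12, 13}" by auto
    show "filled s (insert i A) s2"
      unfolding filled_def
    proof (intro conjI allI impI ballI)
      show "base s2" using s2 by blast
      show "unchanged {13, 14, 15} s s2"
        using f s2 \<open>{13 + i} \<subseteq> {13, 14, 15}\<close> unchanged_trans[of "{13, 14, 15}" s s1 "{13 + i}" s2 "{13, 14, 15}"]
        unfolding filled_def by auto
      show "fst s2 x = fst s x" if "x \<notin> {11, 12, 13, 15, 20, 24}" for x
      proof -
        have "x \<notin> writes (fill i)" using that \<open>11 + i \<in> {11, 12, 13}\<close> by auto
        then show ?thesis using fr f that unfolding filled_def by simp
      qed
      fix j assume j: "j \<in> insert i A"
      have new: "halves s2 i = mid_dist s i" "\<forall>k\<le>2 * mid_dist s i. slots s2 i k = routes s i k"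
        using s2 r d rt by (simp_all add: halves_def slots_def)
      have old: "halves s2 j = halves s1 j" "\<forall>k\<le>2 * mid_dist s j. slots s2 j k = slots s1 j k" if "j \<in> A"
      proof -
        have ji: "j \<noteq> i" "j < 3" using that i by auto
        then show "halves s2 j = halves s1 j" using fr by (simp add: halves_def)
        have "k < S" if "k \<le> 2 * mid_dist s j" for k
          using that dn[OF ji(2)] S_mono(3)[of k] by simp
        then show "\<forall>k\<le>2 * mid_dist s j. slots s2 j k = slots s1 j k"
          using s2 ji by (simp add: slots_def unchanged_def)
      qed
      show "halves s2 j = mid_dist s j" using j new old f by (auto simp: filled_def)
      show "slots s2 j k = routes s j k" if "k \<le> 2 * mid_dist s j" for k
        using j new old f that by (auto simp: filled_def)
    qed
  qed (use f i m r d P un in \<open>auto simp: filled_def\<close>)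
qed

lemma eval_tests:
  assumes "base s" "\<And>i. i < 3 \<Longrightarrow> fst s (8 + i) < n"
  shows "(\<forall>e\<in>set (tests 0 @ tests 1 @ tests 2). eval W s e \<noteq> 0) \<longleftrightarrow> middles_ok s"
proof -
  have "(\<forall>e\<in>set (tests i). eval W s e \<noteq> 0) \<longleftrightarrow>
     mid_dist s i = arr s (4 + i) (fst s (8 + i)) \<and> 0 < mid_dist s i \<and> mid_dist s i < n" if "i < 3" for i
  proof -
    have r: "fst s 0 = n" "fst s (8 + i) < S" using assms that S_mono(1) by (simp_all add: base_def)
    show ?thesis using assms(1) r that by (auto simp: tests_def mid_dist_def)
  qed
  then show ?thesis unfolding middles_ok_def all3 by (simp add: ball_Un)
qed

text \<open>\<open>state_inv\<close> carries soundness, the last conjunct progress: a candidate that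
  passes leaves register 14 at most at its size, whether it is stored or a smaller prism was
  known.\<close>

lemma runs_attempt:
  assumes s: "state_inv s" and m: "\<And>i. i < 3 \<Longrightarrow> fst s (8 + i) < n"
    and P: "\<And>i v. i < 3 \<Longrightarrow> v < n \<Longrightarrow> arr s (7 + i) v < n \<and> arr s (10 + i) v < n"
  shows "runs W attempt s (attempt_time n) (\<lambda>s'. state_inv s' \<and> unchanged {13, 14, 15, 16} s s' \<and> fst s' 14 \<le> fst s 14 \<and>
     (middles_ok s \<and> fits_all E (routes s) (mid_dist s) \<longrightarrow> fst s' 14 \<le> size3 (mid_dist s)))"
    (is "runs W _ _ _ ?Q")
proof -
  have b: "base s" using s by (simp add: state_inv_def)
  have rn: "routes s i k < n" if "i < 3" for i k
  proof -
    have "(arr s (7 + i) ^^ j) (fst s (8 + i)) < n" "(arr s (10 + i) ^^ j) (fst s (8 + i)) < n" for j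
      by (induction j) (use that m P in auto)
    then show ?thesis by (simp add: routes_def route_def)
  qed
  have et: "(\<forall>e\<in>set (tests 0 @ tests 1 @ tests 2). eval W s e \<noteq> 0) \<longleftrightarrow> middles_ok s"
    by (rule eval_tests[OF b]) (rule m)
  let ?tl = "guards [Equal (Reg 15) (Const 1), Less total_size (Reg 14)] store_best"
  let ?T = "fill_time n"
  show ?thesis
    unfolding attempt_def
  proof (rule runs_guards[where T = "?T + (?T + (?T + (2 + ((9 * check_time n + 1) + (store_time n + 26)))))"])
    assume "\<not> (\<forall>e\<in>set (tests 0 @ tests 1 @ tests 2). eval W s e \<noteq> 0)"
    then have "\<not> middles_ok s" unfolding et .
    then show "?Q s" using s by simp
  next
    assume "\<forall>e\<in>set (tests 0 @ tests 1 @ tests 2). eval W s e \<noteq> 0"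
    then have ok: "middles_ok s" unfolding et .
    have finish: "runs W (Seq ?tl Skip) s5 (store_time n + 26) ?Q"
      if f: "filled s {0, 1, 2} s4" and s5: "base s5" "snd s5 = snd s4"
        "fst s5 15 = 1 \<longleftrightarrow> fits_all E (slots s4) (halves s4)" "\<And>x. x \<le> 14 \<Longrightarrow> fst s5 x = fst s4 x" for s4 s5
    proof -
      have h: "halves s5 i = mid_dist s i" if "i < 3" for i
        using f s5(4)[of "11 + i"] that by (auto simp: filled_def halves_def numeral_3_eq_3 numeral_2_eq_2 less_Suc_eq)
      have arr5: "arr s5 = arr s4" using s5(2) by (simp add: arr_def fun_eq_iff)
      have sl: "slots s5 i k = routes s i k" if "i < 3" "k \<le> 2 * mid_dist s i" for i k
        using f that arr5 by (auto simp: filled_def slots_def numeral_3_eq_3 numeral_2_eq_2 less_Suc_eq)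
      have hn: "mid_dist s i < n" "0 < mid_dist s i" if "i < 3" for i
        using ok that unfolding middles_ok_def by blast+
      have r14: "fst s5 14 = fst s 14" using f s5(4)[of 14] by (simp add: filled_def)
      have u: "unchanged {13, 14, 15} s s5" using f arr5 by (simp add: filled_def unchanged_def)
      have "fits_all E (slots s4) (halves s4) \<longleftrightarrow> fits_all E (routes s) (mid_dist s)"
        by (rule fits_all_cong) (use f in \<open>auto simp: filled_def numeral_3_eq_3 numeral_2_eq_2 less_Suc_eq\<close>)
      then have r15: "fst s5 15 = 1 \<longleftrightarrow> fits_all E (routes s) (mid_dist s)" using s5(3) by simp
      have ev: "eval W s5 total_size = size3 (mid_dist s)"
      proof -
        have "eval W s5 (odd_size i) = 2 * mid_dist s i + 1" if "i < 3" for i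
          using eval_odd_size[of s5 i] h hn that by simp
        moreover have "size3 (mid_dist s) < W" "(2 * mid_dist s 0 + 1) + (2 * mid_dist s 1 + 1) < W"
          using hn[of 0] hn[of 1] hn[of 2] S_bounds unfolding size3_def by linarith+
        ultimately show ?thesis by (simp add: total_size_def size3_def)
      qed
      have st: "runs W store_best s5 (store_time n) (\<lambda>s'. base s' \<and> unchanged {16} s5 s' \<and> fst s' 14 = size3 (mid_dist s) \<and>
        arr s' 16 ` {..<size3 (mid_dist s)} = slots s5 0 ` {..2 * halves s5 0} \<union> slots s5 1 ` {..2 * halves s5 1} \<union> slots s5 2 ` {..2 * halves s5 2})"
        by (rule runs_store_best) (use s5 h hn in \<open>auto simp: size3_def\<close>)
      have ims: "slots s5 i ` {..2 * halves s5 i} = routes s i ` {..2 * mid_dist s i}" if "i < 3" for i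
        unfolding h[OF that] by (rule image_cong) (use sl that in auto)
      have gd: "runs W ?tl s5 (store_time n + 25) ?Q"
      proof (rule runs_guards[where T = "store_time n"])
        assume "\<forall>e\<in>set [Equal (Reg 15) (Const 1), Less total_size (Reg 14)]. eval W s5 e \<noteq> 0"
        then have fa: "fits_all E (routes s) (mid_dist s)" and lt: "size3 (mid_dist s) < fst s 14"
          using r15 r14 ev S_bounds by (auto split: if_splits)
        show "runs W store_best s5 (store_time n) ?Q"
        proof (rule runs_conseq[OF st order_refl])
          fix s' assume s': "base s' \<and> unchanged {16} s5 s' \<and> fst s' 14 = size3 (mid_dist s) \<and>
            arr s' 16 ` {..<size3 (mid_dist s)} = slots s5 0 ` {..2 * halves s5 0} \<union> slots s5 1 ` {..2 * halves s5 1} \<union> slots s5 2 ` {..2 * halves s5 2}"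
          have "unchanged {13, 14, 15, 16} s s'" by (rule unchanged_trans[OF u, of "{16}"]) (use s' in auto)
          moreover have "state_inv s'"
            unfolding state_inv_def using s' lt s fits_all_even_prism[OF fa hn(2) rn] ims[of 0] ims[of 1] ims[of 2]
            by (auto simp: state_inv_def size3_def)
          ultimately show "?Q s'" using s' lt by simp
        qed
      next
        assume "\<not> (\<forall>e\<in>set [Equal (Reg 15) (Const 1), Less total_size (Reg 14)]. eval W s5 e \<noteq> 0)"
        then have no: "fits_all E (routes s) (mid_dist s) \<Longrightarrow> fst s 14 \<le> size3 (mid_dist s)"
          using r15 r14 ev S_bounds by (auto split: if_splits)
        have "arr s5 16 v = arr s 16 v" if "v < S" for v using u that by (simp add: unchanged_def)
        then have "state_inv s5" using s s5(1) r14 unfolding state_inv_def by (simp add: image_def)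
        moreover have "unchanged {13, 14, 15, 16} s s5" using u by (auto simp: unchanged_def)
        ultimately show "?Q s5" using r14 no by simp
      qed (simp add: total_size_def)
      show ?thesis by (rule runs_Seq'[OF gd]) (auto intro: runs_Skip)
    qed
    have f0: "filled s {} s" using b by (simp add: filled_def)
    have check: "runs W (Seq (Assign 15 (Const 1)) (Seq (checks all_pairs) (Seq ?tl Skip))) s3
        (2 + ((9 * check_time n + 1) + (store_time n + 26))) ?Q" if f: "filled s {0, 1, 2} s3" for s3
    proof -
      let ?s4 = "set_reg 15 1 s3"
      have f4: "filled s {0, 1, 2} ?s4"
        using f by (simp add: filled_def halves_def slots_def)
      have h: "halves ?s4 i < n \<and> 0 < halves ?s4 i" "halves ?s4 i = mid_dist s i" if "i < 3" for i
      proof -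
        show "halves ?s4 i = mid_dist s i"
          using f4 that by (auto simp: filled_def numeral_3_eq_3 numeral_2_eq_2 less_Suc_eq)
        then show "halves ?s4 i < n \<and> 0 < halves ?s4 i" using ok that unfolding middles_ok_def by metis
      qed
      have sl: "slots ?s4 i x < n" if "i < 3" "x \<le> 2 * halves ?s4 i" for i x
      proof -
        have "slots ?s4 i x = routes s i x"
          using f4 that h[OF that(1)] by (auto simp: filled_def numeral_3_eq_3 numeral_2_eq_2 less_Suc_eq)
        then show ?thesis using rn that by simp
      qed
      have len9: "length all_pairs = 9" by (simp add: all_pairs_def)
      have cs: "runs W (checks all_pairs) ?s4 (9 * check_time n + 1) (\<lambda>s'. base s' \<and> snd s' = snd ?s4 \<and>
         (fst s' 15 = 1 \<longleftrightarrow> fst ?s4 15 = 1 \<and> (\<forall>(i, j)\<in>set all_pairs.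
           pair_fits ?s4 i j)))"
        by (rule runs_checks[of ?s4 all_pairs, unfolded len9])
          (use f4 h(1) sl in \<open>auto simp: all_pairs_def filled_def\<close>)
      have ap: "(\<forall>(i, j)\<in>set all_pairs. pair_fits ?s4 i j)
         \<longleftrightarrow> fits_all E (slots ?s4) (halves ?s4)"
        unfolding fits_all_def by (rule all_pairs_iff)
      have fin: "runs W (Seq (checks all_pairs) (Seq ?tl Skip)) ?s4 ((9 * check_time n + 1) + (store_time n + 26)) ?Q"
      proof (rule runs_Seq'[OF cs[unfolded ap]])
        fix s5 assume s5: "base s5 \<and> snd s5 = snd ?s4 \<and>
            (fst s5 15 = 1 \<longleftrightarrow> fst ?s4 15 = 1 \<and> fits_all E (slots ?s4) (halves ?s4))"
          and fr: "same_regs (checks all_pairs) ?s4 s5"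
        show "runs W (Seq ?tl Skip) s5 (store_time n + 26) ?Q"
        proof (rule finish[OF f4])
          fix x :: nat assume "x \<le> 14"
          then have "x \<notin> writes (checks all_pairs)" using writes_checks[of all_pairs] by auto
          then show "fst s5 x = fst ?s4 x" using fr by blast
        qed (use s5 in auto)
      qed simp
      show ?thesis
        by (rule runs_Seq[OF runs_Assign[where T = 2], where ?T2.0 = "(9 * check_time n + 1) + (store_time n + 26)"])
          (use fin S_bounds in simp_all)
    qed
    show "runs W (seqs [fill 0, fill 1, fill 2, Assign 15 (Const 1), checks all_pairs, ?tl]) s
       (?T + (?T + (?T + (2 + ((9 * check_time n + 1) + (store_time n + 26)))))) ?Q"
      unfolding seqs_simps
    proof (rule runs_Seq'[OF runs_fill_next[OF f0 _ _ _ ok m P]])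
      fix s1 assume "filled s {0} s1"
      then show "runs W (Seq (fill 1) (Seq (fill 2) (Seq (Assign 15 (Const 1)) (Seq (checks all_pairs) (Seq ?tl Skip))))) s1
         (?T + (?T + (2 + ((9 * check_time n + 1) + (store_time n + 26))))) ?Q"
      proof (rule runs_Seq'[OF runs_fill_next[OF _ _ _ _ ok m P]])
        fix s2 assume "filled s {1, 0} s2"
        then show "runs W (Seq (fill 2) (Seq (Assign 15 (Const 1)) (Seq (checks all_pairs) (Seq ?tl Skip)))) s2
         (?T + (2 + ((9 * check_time n + 1) + (store_time n + 26)))) ?Q"
        proof (rule runs_Seq'[OF runs_fill_next[OF _ _ _ _ ok m P]])
          fix s3 assume "filled s {2, 1, 0} s3"
          moreover have "{2, 1, 0} = {0, 1, 2 :: nat}" by auto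
          ultimately show "runs W (Seq (Assign 15 (Const 1)) (Seq (checks all_pairs) (Seq ?tl Skip))) s3
            (2 + ((9 * check_time n + 1) + (store_time n + 26))) ?Q"
            using check by simp
        qed auto
      qed auto
    qed auto
  qed (simp add: attempt_time_def tests_def)
qed

end

section \<open>Enumeration\<close>

text \<open>The registers of the ends of the two paths other than \<open>i\<close>, matching
  \<open>four_ends\<close>.\<close>

definition others :: "nat \<Rightarrow> nat list" where
  "others i = [2 + (i + 1) mod 3, 2 + (i + 2) mod 3, 5 + (i + 1) mod 3, 5 + (i + 2) mod 3]"

context prism_machine begin

lemma search_result_cong:
  assumes "search_result src X D P" "\<And>v. v < n \<Longrightarrow> D' v = D v" "\<And>v. v < n \<Longrightarrow> P' v = P v" "src < n"
  shows "search_result src X D' P'"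
  using assms unfolding search_result_def by (metis (no_types, lifting))

text \<open>Induction along the admissible path \<open>p\<close> bounds the distance of
  \<open>p k\<close> by \<open>k\<close>, so \<open>h < n\<close> ensures that \<open>p h\<close> is
  reached. Each predecessor step then lowers the distance by one until it is 0, which for a reached
  vertex means \<open>src\<close>.\<close>

lemma search_result_path:
  assumes R: "search_result src X D P" and p: "p 0 = src" "\<And>k. k \<le> h \<Longrightarrow> p k < n"
    "\<And>k. k < h \<Longrightarrow> E (p k) (p (Suc k))" "\<And>k. 0 < k \<Longrightarrow> k \<le> h \<Longrightarrow> X (p k)" and h: "h < n"
  shows "D (p h) \<le> h" "(P ^^ D (p h)) (p h) = src"
    "\<And>k. k < D (p h) \<Longrightarrow> E ((P ^^ k) (p h)) ((P ^^ Suc k) (p h)) \<and> X ((P ^^ k) (p h))"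
proof -
  have "D (p k) \<le> k" if "k \<le> h" for k
    using that
  proof (induction k)
    case 0
    then show ?case using R p by (simp add: search_result_def)
  next
    case (Suc k)
    then have k: "D (p k) \<le> k" "D (p k) < n" using h by auto
    have "D (p (Suc k)) \<le> Suc (D (p k))"
      using R p(2)[of k] p(2)[of "Suc k"] p(3)[of k] p(4)[of "Suc k"] Suc.prems k(2)
      unfolding search_result_def by (meson Suc_leD Suc_le_lessD zero_less_Suc)
    then show ?case using k by simp
  qed
  then show le: "D (p h) \<le> h" by simp
  have tree: "v = src \<and> D v = 0 \<or> Suc (D (P v)) = D v \<and> E (P v) v \<and> X v" if "v < n" "D v < n" for v
    using R that unfolding search_result_def by blast
  have Pn: "P v < n" if "v < n" for v using R that unfolding search_result_def by blast
  let ?m = "p h"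
  have descent: "(P ^^ k) ?m < n \<and> D ((P ^^ k) ?m) = D ?m - k" if "k \<le> D ?m" for k
    using that
  proof (induction k)
    case 0
    then show ?case using p by simp
  next
    case (Suc k)
    let ?v = "(P ^^ k) ?m"
    have v: "?v < n" "D ?v = D ?m - k" using Suc by auto
    then have "D ?v < n" "D ?v \<noteq> 0" using le h Suc.prems by auto
    then show ?case using tree[of ?v] v Pn by auto
  qed
  show "(P ^^ D ?m) ?m = src"
    using descent[of "D ?m"] tree[of "(P ^^ D ?m) ?m"] h by force
  fix k assume k: "k < D ?m"
  have "(P ^^ k) ?m < n" "D ((P ^^ k) ?m) = D ?m - k" using descent[of k] k by auto
  then have "E (P ((P ^^ k) ?m)) ((P ^^ k) ?m) \<and> X ((P ^^ k) ?m)"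
    using tree[of "(P ^^ k) ?m"] k le h by auto
  then show "E ((P ^^ k) ?m) ((P ^^ Suc k) ?m) \<and> X ((P ^^ k) ?m)" using sym by auto
qed

text \<open>The halves of \<open>p\<close> are themselves admissible for the searches, which bounds
  both distances by \<open>h\<close>; equality then comes from minimality, through
  \<open>replace_route\<close>.\<close>

lemma min_prism_search:
  assumes K: "min_prism p q r" and h: "length p = 2 * h + 1"
    and R: "search_result (hd p) X D P" and R': "search_result (last p) X D' P'"
    and X: "\<And>v. X v \<longleftrightarrow> (\<forall>x\<in>four_ends q r. \<not> E x v)"
  shows "D (p ! h) = h \<and> D' (p ! h) = h \<and> 0 < h \<and> h < n \<and>
    min_prism (map (route (p ! h) h P P') [0..<2 * h + 1]) q r \<and>
    hd (map (route (p ! h) h P P') [0..<2 * h + 1]) = hd p \<and>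
    last (map (route (p ! h) h P P') [0..<2 * h + 1]) = last p"
proof -
  have pr: "prism E p q r" and V: "set p \<subseteq> {..<n}" using K by (auto simp: min_prism_def even_prism_paths_def)
  have cp: "chordless_path E p" and lk: "linked E p q" "linked E p r" and l2: "2 \<le> length p"
    and ne: "q \<noteq> []" "r \<noteq> []" using pr by (auto simp: prism_def)
  have pne: "p \<noteq> []" and dp: "distinct p" using cp by (auto simp: chordless_path_def)
  have h0: "0 < h" using l2 h by auto
  have "card (set p) \<le> n" using card_mono[OF _ V] by simp
  then have hn: "h < n" using h dp by (simp add: distinct_card)
  have pn: "p ! k < n" if "k \<le> 2 * h" for k using V that h by (auto dest!: subsetD[of _ _ "p ! k"])
  have ends: "hd p = p ! 0" "last p = p ! (2 * h)" using pne h by (auto simp: hd_conv_nth last_conv_nth)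
  have edge: "E (p ! k) (p ! Suc k)" "E (p ! Suc k) (p ! k)" if "k < 2 * h" for k
    using cp that h unfolding chordless_path_def by auto
  have inner: "X (p ! k)" if "0 < k" "k < 2 * h" for k
    unfolding X
  proof
    have "p ! k \<noteq> hd p" "p ! k \<noteq> last p" using that dp h by (auto simp: ends nth_eq_iff_index_eq)
    moreover have "p ! k \<in> set p" using that h by simp
    ultimately have "\<not> E (p ! k) x" if "x \<in> set q \<union> set r" for x using linked_no_edge lk that by blast
    moreover fix x assume "x \<in> four_ends q r"
    then have "x \<in> set q \<union> set r" using ne by auto
    ultimately show "\<not> E x (p ! k)" using sym by blast
  qed
  have A: "D (p ! h) \<le> h" "(P ^^ D (p ! h)) (p ! h) = hd p"
    "\<And>k. k < D (p ! h) \<Longrightarrow> E ((P ^^ k) (p ! h)) ((P ^^ Suc k) (p ! h)) \<and> X ((P ^^ k) (p ! h))"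
    using search_result_path[OF R, of "\<lambda>k. p ! k" h] pn edge inner hn h0 ends by auto
  have idx: "2 * h - h = h" by simp
  have B: "D' (p ! h) \<le> h" "(P' ^^ D' (p ! h)) (p ! h) = last p"
    "\<And>k. k < D' (p ! h) \<Longrightarrow> E ((P' ^^ k) (p ! h)) ((P' ^^ Suc k) (p ! h)) \<and> X ((P' ^^ k) (p ! h))"
  proof -
    \<comment> \<open>The search from \<open>last p\<close> meets the second half of
      \<open>p\<close> backwards.\<close>
    have e: "E (p ! (2 * h - k)) (p ! (2 * h - Suc k))" if "k < h" for k
    proof -
      have "2 * h - k = Suc (2 * h - Suc k)" using that by simp
      then show ?thesis using edge(2)[of "2 * h - Suc k"] that by simp
    qed
    have x: "X (p ! (2 * h - k))" if "0 < k" "k \<le> h" for k using inner[of "2 * h - k"] that by simp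
    have s0: "p ! (2 * h - 0) = last p" using ends by simp
    have b: "p ! (2 * h - k) < n" for k using pn by simp
    note * = search_result_path[OF R', of "\<lambda>k. p ! (2 * h - k)" h, OF s0 b e x hn, unfolded idx]
    show "D' (p ! h) \<le> h" "(P' ^^ D' (p ! h)) (p ! h) = last p"
      "\<And>k. k < D' (p ! h) \<Longrightarrow> E ((P' ^^ k) (p ! h)) ((P' ^^ Suc k) (p ! h)) \<and> X ((P' ^^ k) (p ! h))"
      using * by blast+
  qed
  have Xs: "\<not> E v x" if "X v" "x \<in> four_ends q r" for v x
    using that X sym by blast
  show ?thesis
    using replace_route[OF K h refl A(2,1) _ _ B(2,1)] A(3) B(3) Xs h0 hn by blast
qed

definition allowed :: "state \<Rightarrow> nat \<Rightarrow> nat \<Rightarrow> bool" where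
  "allowed s i v \<longleftrightarrow> (\<forall>f\<in>set (others i). \<not> E (fst s f) v)"

text \<open>For \<open>j < 3\<close> this is the search from the first end of path \<open>j\<close>,
  for \<open>3 \<le> j\<close> the one from the last end of path \<open>j - 3\<close>.\<close>

definition table :: "state \<Rightarrow> nat \<Rightarrow> bool" where
  "table s j \<longleftrightarrow> search_result (fst s (2 + j)) (allowed s (j mod 3)) (arr s (1 + j)) (arr s (7 + j))"

definition corners_lt :: "state \<Rightarrow> bool" where
  "corners_lt s \<longleftrightarrow> (\<forall>j<6. fst s (2 + j) < n)"

definition ready :: "state \<Rightarrow> bool" where
  "ready s \<longleftrightarrow> state_inv s \<and> corners_lt s \<and> (\<forall>j<6. table s j)"

text \<open>A fixed target assignment \<open>g\<close> for the registers 2 to 10, used in proofs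
  only. The lists have odd length, so \<open>length p div 2\<close> is the middle position.\<close>

definition minimum_tuple :: "(nat \<Rightarrow> nat) \<Rightarrow> nat \<Rightarrow> bool" where
  "minimum_tuple g N \<longleftrightarrow> (\<exists>p q r. min_prism p q r \<and> N = length p + length q + length r \<and>
     g 2 = hd p \<and> g 3 = hd q \<and> g 4 = hd r \<and> g 5 = last p \<and> g 6 = last q \<and> g 7 = last r \<and>
     g 8 = p ! (length p div 2) \<and> g 9 = q ! (length q div 2) \<and> g 10 = r ! (length r div 2))"

text \<open>The three paths are exchanged in turn, each being rotated to the front. The tables
  depend on the ends alone, and these are kept, so the same tables serve for the prism after each
  exchange.\<close>

lemma minimum_tuple_fits:
  assumes t: "\<forall>j<6. table s j" and g: "minimum_tuple g N" and eq: "\<And>x. 2 \<le> x \<Longrightarrow> x \<le> 10 \<Longrightarrow> fst s x = g x"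
  shows "middles_ok s" "fits_all E (routes s) (mid_dist s)" "size3 (mid_dist s) = N"
proof -
  obtain p q r where K: "min_prism p q r" and N: "N = length p + length q + length r"
    and c: "g 2 = hd p" "g 3 = hd q" "g 4 = hd r" "g 5 = last p" "g 6 = last q" "g 7 = last r"
      "g 8 = p ! (length p div 2)" "g 9 = q ! (length q div 2)" "g 10 = r ! (length r div 2)"
    using g unfolding minimum_tuple_def by blast
  have "odd (length p)" "odd (length q)" "odd (length r)"
    using K by (auto simp: min_prism_def even_prism_paths_def)
  then obtain h0 h1 h2 where h: "length p = 2 * h0 + 1" "length q = 2 * h1 + 1" "length r = 2 * h2 + 1"
    by (auto elim!: oddE)
  have m: "fst s 8 = p ! h0" "fst s 9 = q ! h1" "fst s 10 = r ! h2" using c h eq by auto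
  have o: "others 0 = [3, 4, 6, 7]" "others 1 = [4, 2, 7, 5]" "others 2 = [2, 3, 5, 6]"
    by (simp_all add: others_def)
  have a: "allowed s 0 v \<longleftrightarrow> (\<forall>x\<in>four_ends q r. \<not> E x v)"
    "allowed s 1 v \<longleftrightarrow> (\<forall>x\<in>four_ends r p. \<not> E x v)"
    "allowed s 2 v \<longleftrightarrow> (\<forall>x\<in>four_ends p q. \<not> E x v)" for v
    unfolding allowed_def o using eq c by auto
  have T: "search_result (hd p) (allowed s 0) (arr s 1) (arr s 7)" "search_result (hd q) (allowed s 1) (arr s 2) (arr s 8)"
    "search_result (hd r) (allowed s 2) (arr s 3) (arr s 9)" "search_result (last p) (allowed s 0) (arr s 4) (arr s 10)"
    "search_result (last q) (allowed s 1) (arr s 5) (arr s 11)" "search_result (last r) (allowed s 2) (arr s 6) (arr s 12)"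
    using t[rule_format, of 0] t[rule_format, of 1] t[rule_format, of 2] t[rule_format, of 3] t[rule_format, of 4] t[rule_format, of 5]
      eq c by (simp_all add: table_def flip: numeral_2_eq_2)
  let ?p = "map (route (p ! h0) h0 (arr s 7) (arr s 10)) [0..<2 * h0 + 1]"
  let ?q = "map (route (q ! h1) h1 (arr s 8) (arr s 11)) [0..<2 * h1 + 1]"
  let ?r = "map (route (r ! h2) h2 (arr s 9) (arr s 12)) [0..<2 * h2 + 1]"
  have 1: "arr s 1 (p ! h0) = h0 \<and> arr s 4 (p ! h0) = h0 \<and> 0 < h0 \<and> h0 < n \<and> min_prism ?p q r \<and> hd ?p = hd p \<and> last ?p = last p"
    by (rule min_prism_search[OF K h(1) T(1) T(4) a(1)])
  then have hp: "hd ?p = hd p" "last ?p = last p" by blast+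
  from 1 have K1: "min_prism q r ?p" using min_prism_rotate by blast
  have 2: "arr s 2 (q ! h1) = h1 \<and> arr s 5 (q ! h1) = h1 \<and> 0 < h1 \<and> h1 < n \<and> min_prism ?q r ?p \<and> hd ?q = hd q \<and> last ?q = last q"
    by (rule min_prism_search[OF K1 h(2) T(2) T(5)]) (simp only: hp a(2))
  then have hq: "hd ?q = hd q" "last ?q = last q" by blast+
  from 2 have K2: "min_prism r ?p ?q" using min_prism_rotate by blast
  have 3: "arr s 3 (r ! h2) = h2 \<and> arr s 6 (r ! h2) = h2 \<and> 0 < h2 \<and> h2 < n \<and> min_prism ?r ?p ?q \<and> hd ?r = hd r \<and> last ?r = last r"
    by (rule min_prism_search[OF K2 h(3) T(3) T(6)]) (simp only: hp hq a(3))
  then have K3: "prism E ?p ?q ?r"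
    using min_prism_rotate unfolding min_prism_def even_prism_paths_def by blast
  have hs: "arr s 1 (p ! h0) = h0" "arr s 2 (q ! h1) = h1" "arr s 3 (r ! h2) = h2"
    "arr s 4 (p ! h0) = h0" "arr s 5 (q ! h1) = h1" "arr s 6 (r ! h2) = h2"
    "0 < h0 \<and> h0 < n" "0 < h1 \<and> h1 < n" "0 < h2 \<and> h2 < n"
    using 1 2 3 by blast+
  have d: "mid_dist s 0 = h0" "mid_dist s 1 = h1" "mid_dist s 2 = h2"
    using hs m by (simp_all add: mid_dist_def flip: numeral_2_eq_2)
  then show "size3 (mid_dist s) = N" by (simp add: size3_def N h)
  show mo: "middles_ok s" unfolding middles_ok_def all3 using d hs m by simp
  have pl: "path_list (routes s) (mid_dist s) 0 = ?p" "path_list (routes s) (mid_dist s) 1 = ?q" "path_list (routes s) (mid_dist s) 2 = ?r"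
    unfolding path_list_def routes_def d using m by simp_all
  show "fits_all E (routes s) (mid_dist s)"
  proof (subst fits_all_prism)
    show "0 < mid_dist s i" if "i < 3" for i using mo that unfolding middles_ok_def by blast
    show "prism E (path_list (routes s) (mid_dist s) 0) (path_list (routes s) (mid_dist s) 1) (path_list (routes s) (mid_dist s) 2)"
      unfolding pl by (rule K3)
  qed
qed

end

definition search_prog :: "nat \<Rightarrow> prog" where
  "search_prog j = search (1 + j) (7 + j) (2 + j) (others (j mod 3))"

definition loops :: "nat list \<Rightarrow> prog \<Rightarrow> prog" where
  "loops xs c = foldr (\<lambda>x c. For x (Reg 0) c) xs c"

text \<open>The constants are those of \<open>runs_For\<close> for the bound \<open>Reg 0\<close>,
  which has cost 1.\<close>

fun loop_time :: "nat \<Rightarrow> nat \<Rightarrow> nat \<Rightarrow> nat" where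
  "loop_time n 0 T = T"
| "loop_time n (Suc k) T = n * (loop_time n k T + 8) + 6"

definition six_prog :: prog where
  "six_prog = Seq (seqs (map search_prog [0, 1, 2, 3, 4, 5])) (loops [8, 9, 10] attempt)"

definition six_time :: "nat \<Rightarrow> nat" where
  "six_time n = (6 * search_time n + 1) + loop_time n 3 (attempt_time n)"

definition output_prog :: prog where
  "output_prog = Cond (Less (Reg 14) (Reg 1))
     (Seq (For 20 (Reg 14) (Put 0 (Reg 20) (Cell 16 (Reg 20)))) (Assign 0 (Reg 14)))
     (Assign 0 (Const 0))"

definition main_prog :: prog where
  "main_prog = seqs [Assign 1 (Mul (Add (Reg 0) (Const 4)) (Add (Reg 0) (Const 4))), Assign 14 (Reg 1),
     loops [2, 3, 4, 5, 6, 7] six_prog, output_prog]"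

definition main_time :: "nat \<Rightarrow> nat" where
  "main_time n = loop_time n 6 (six_time n) + (n * 20 + 50)"

lemma loops_simps [simp]: "loops [] c = c" "loops (x # xs) c = For x (Reg 0) (loops xs c)"
  by (simp_all add: loops_def)

lemma writes_loops [simp]: "writes (loops xs c) = set xs \<union> writes c"
  by (induction xs) auto

lemma writes_search_prog [simp]: "writes (search_prog j) = {20, 21, 22}"
  by (simp add: search_prog_def)

lemma writes_six: "writes six_prog \<subseteq> {8..15} \<union> {20..25}"
  using writes_attempt by (auto simp: six_prog_def)

context prism_machine begin

lemma set_others: "set (others j) \<subseteq> {2..7}"
proof -
  have "(j + k) mod 3 \<le> 2" for k using mod_less_divisor[of 3 "j + k"] by linarith
  from this[of 1] this[of 2] show ?thesis by (auto simp: others_def)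
qed

lemma inv_cong:
  assumes "state_inv s" "base s'" "unchanged A s s'" "16 \<notin> A" "fst s' 14 = fst s 14"
  shows "state_inv s'"
proof -
  have "arr s' 16 v = arr s 16 v" if "v < S" for v using assms(3,4) that by (simp add: unchanged_def)
  then have "arr s' 16 ` {..<fst s 14} = arr s 16 ` {..<fst s 14}"
    using assms(1) by (intro image_cong) (auto simp: state_inv_def)
  then show ?thesis using assms by (simp add: state_inv_def)
qed

lemma allowed_cong:
  assumes "\<And>x. 2 \<le> x \<Longrightarrow> x \<le> 7 \<Longrightarrow> fst s' x = fst s x"
  shows "allowed s' (j mod 3) = allowed s (j mod 3)"
proof -
  have "fst s' f = fst s f" if "f \<in> set (others (j mod 3))" for f
    using assms set_others[of "j mod 3"] that by auto
  then show ?thesis by (simp add: allowed_def fun_eq_iff)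
qed

lemma table_cong:
  assumes "table s j" "j < 6" "corners_lt s" "\<And>x. 2 \<le> x \<Longrightarrow> x \<le> 7 \<Longrightarrow> fst s' x = fst s x"
    and "unchanged A s s'" "1 + j \<notin> A" "7 + j \<notin> A"
  shows "table s' j"
proof -
  have al: "allowed s' (j mod 3) = allowed s (j mod 3)" by (rule allowed_cong) (rule assms(4))
  show ?thesis
    unfolding table_def al
  proof (rule search_result_cong)
  show "search_result (fst s' (2 + j)) (allowed s (j mod 3)) (arr s (1 + j)) (arr s (7 + j))"
    using assms(1,2,4) by (simp add: table_def)
  show "fst s' (2 + j) < n" using assms(2,3,4) by (simp add: corners_lt_def)
qed (use assms(5-7) S_mono(1) in \<open>auto simp: unchanged_def\<close>)
qed

text \<open>Search \<open>j\<close> writes only arrays \<open>1 + j\<close> and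
  \<open>7 + j\<close>, which differ for different \<open>j < 6\<close>, so the finished tables in
  \<open>A\<close> stay valid.\<close>

lemma runs_search_prog:
  assumes s: "state_inv s" "corners_lt s" and A: "A \<subseteq> {..<6}" "\<forall>j\<in>A. table s j" and j: "j < 6" "j \<notin> A"
  shows "runs W (search_prog j) s (search_time n) (\<lambda>s'. state_inv s' \<and> (\<forall>k\<in>insert j A. table s' k) \<and> fst s' 14 = fst s 14)"
proof -
  have fs: "fst s f < n" if "f \<in> set (others (j mod 3))" for f
  proof -
    have "2 \<le> f" "f \<le> 7" using set_others[of "j mod 3"] that by auto
    then have "f = 2 + (f - 2)" "f - 2 < 6" by auto
    then show ?thesis using s(2) unfolding corners_lt_def by metis
  qed
  have rs: "runs W (search_prog j) s (search_time n)
     (\<lambda>s'. base s' \<and> unchanged {1 + j, 7 + j} s s' \<and>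
        search_result (fst s (2 + j)) (\<lambda>v. \<forall>f\<in>set (others (j mod 3)). \<not> E (fst s f) v) (arr s' (1 + j)) (arr s' (7 + j)))"
    unfolding search_prog_def
  proof (rule runs_search)
    show "set (others (j mod 3)) \<subseteq> {..<20}" using set_others[of "j mod 3"] by auto
    show "fst s (2 + j) < n" using s(2) j by (simp add: corners_lt_def)
    show "length (others (j mod 3)) = 4" by (simp add: others_def)
  qed (use s j fs in \<open>auto simp: state_inv_def\<close>)
  show ?thesis
  proof (rule runs_conseq[OF rs order_refl])
    fix s' assume s': "base s' \<and> unchanged {1 + j, 7 + j} s s' \<and>
        search_result (fst s (2 + j)) (\<lambda>v. \<forall>f\<in>set (others (j mod 3)). \<not> E (fst s f) v) (arr s' (1 + j)) (arr s' (7 + j))"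
      and fr: "same_regs (search_prog j) s s'"
    have r: "fst s' x = fst s x" if "2 \<le> x" "x \<le> 7" for x using fr that by simp
    have "allowed s' (j mod 3) = allowed s (j mod 3)" by (rule allowed_cong) (rule r)
    then have "allowed s' (j mod 3) = (\<lambda>v. \<forall>f\<in>set (others (j mod 3)). \<not> E (fst s f) v)"
      by (simp add: allowed_def fun_eq_iff)
    then have "table s' j" using s' r[of "2 + j"] j by (simp add: table_def)
    moreover have "table s' k" if "k \<in> A" for k
      by (rule table_cong[where A = "{1 + j, 7 + j}" and s = s]) (use that A j s s' r in auto)
    moreover have "fst s' 14 = fst s 14" using fr by simp
    moreover have "state_inv s'"
      by (rule inv_cong[OF s(1), where A = "{1 + j, 7 + j}"]) (use s' j fr in auto)
    ultimately show "state_inv s' \<and> (\<forall>k\<in>insert j A. table s' k) \<and> fst s' 14 = fst s 14" by blast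
  qed
qed

lemma runs_search_progs:
  assumes "state_inv s" "corners_lt s" "A \<subseteq> {..<6}" "\<forall>j\<in>A. table s j" "set js \<subseteq> {..<6}" "distinct js" "set js \<inter> A = {}"
  shows "runs W (seqs (map search_prog js)) s (length js * search_time n + 1)
     (\<lambda>s'. state_inv s' \<and> (\<forall>k\<in>A \<union> set js. table s' k) \<and> fst s' 14 = fst s 14)"
  using assms
proof (induction js arbitrary: s A)
  case Nil
  then show ?case by (auto intro: runs_Skip)
next
  case (Cons j js)
  show ?case unfolding list.map seqs_simps
  proof (rule runs_Seq'[OF runs_search_prog[OF Cons.prems(1-4)]])
    fix s1 assume s1: "state_inv s1 \<and> (\<forall>k\<in>insert j A. table s1 k) \<and> fst s1 14 = fst s 14"
      and fr: "same_regs (search_prog j) s s1"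
    have c: "corners_lt s1" using Cons.prems(2) fr by (simp add: corners_lt_def)
    have "runs W (seqs (map search_prog js)) s1 (length js * search_time n + 1)
     (\<lambda>s'. state_inv s' \<and> (\<forall>k\<in>insert j A \<union> set js. table s' k) \<and> fst s' 14 = fst s1 14)"
      by (rule Cons.IH) (use s1 c Cons.prems in auto)
    then show "runs W (seqs (map search_prog js)) s1 (length js * search_time n + 1)
     (\<lambda>s'. state_inv s' \<and> (\<forall>k\<in>A \<union> set (j # js). table s' k) \<and> fst s' 14 = fst s 14)"
      using s1 by simp
  qed (use Cons.prems in auto)
qed

text \<open>The tuple \<open>g\<close> of a minimum even prism with \<open>N\<close> vertices, if there is one, is met once the
  registers in \<open>R\<close> agree with it; afterwards register 14 is at most \<open>N\<close>.\<close>

abbreviation improves :: "(nat \<Rightarrow> nat) \<Rightarrow> nat \<Rightarrow> nat set \<Rightarrow> state \<Rightarrow> state \<Rightarrow> bool" where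
  "improves g N R s s' \<equiv> fst s' 14 \<le> fst s 14 \<and>
     (minimum_tuple g N \<and> (\<forall>r\<in>R. fst s r = g r) \<longrightarrow> fst s' 14 \<le> N)"

text \<open>\<open>R\<close> collects the registers set by the enclosing loops. Each loop removes
  its own register from \<open>R\<close>, until for the empty set no agreement with \<open>g\<close>
  is left to assume.\<close>

definition spec :: "(nat \<Rightarrow> nat) \<Rightarrow> nat \<Rightarrow> (state \<Rightarrow> bool) \<Rightarrow> prog \<Rightarrow> nat \<Rightarrow> nat set \<Rightarrow> bool" where
  "spec g N B c T R \<longleftrightarrow> (\<forall>s. B s \<longrightarrow> (\<forall>r\<in>R. fst s r < n) \<longrightarrow>
     runs W c s T (\<lambda>s'. B s' \<and> improves g N R s s'))"

lemma spec_For: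
  assumes c: "spec g N B c T (insert x R)" and x: "x \<notin> writes c" "x \<noteq> 14" "x \<notin> R" "R \<inter> writes c = {}"
    and B: "\<And>v s. B (set_reg x v s) = B s" "\<And>s. B s \<Longrightarrow> fst s 0 = n"
    and g: "minimum_tuple g N \<Longrightarrow> g x < n"
  shows "spec g N B (For x (Reg 0) c) (n * (T + 8) + 6) R"
  unfolding spec_def
proof (intro allI impI)
  fix s assume s: "B s" "\<forall>r\<in>R. fst s r < n"
  define M where "M \<longleftrightarrow> minimum_tuple g N \<and> (\<forall>r\<in>R. fst s r = g r)"
  \<comment> \<open>The bound \<open>N\<close> is gained in the round where the counter equals
    \<open>g x\<close> and is kept afterwards, as register 14 never grows.\<close>
  define I where "I i s' \<longleftrightarrow> B s' \<and> fst s' 14 \<le> fst s 14 \<and> (M \<and> g x < i \<longrightarrow> fst s' 14 \<le> N)" for i s'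
  show "runs W (For x (Reg 0) c) s (n * (T + 8) + 6) (\<lambda>s'. B s' \<and> improves g N R s s')"
  proof (rule runs_For[where I = I and N = n and B = T])
    show "I 0 (set_reg x 0 s)" using s B x by (simp add: I_def)
    show "eval W s' (Reg 0) = n" if "I i s'" for i s' using that B by (simp add: I_def)
    fix i s' assume I: "I i s'" "i < n" "fst s' x = i" and fr: "same_regs_but x c s s'"
    have R: "fst s' r = fst s r" if "r \<in> R" for r using fr x that by auto
    have body: "runs W c s' T (\<lambda>s''. B s'' \<and> improves g N (insert x R) s' s'')"
      by (rule c[unfolded spec_def, rule_format]) (use I R s in \<open>auto simp: I_def\<close>)
    show "runs W c s' T (\<lambda>s''. I (Suc i) (set_reg x (Suc i) s''))"
    proof (rule runs_conseq[OF body order_refl])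
      fix s'' assume s'': "B s'' \<and> improves g N (insert x R) s' s''"
      have "fst s'' 14 \<le> N" if "M" "g x < Suc i"
      proof (cases "g x = i")
        case True
        then show ?thesis using s'' that I R unfolding M_def by simp
      next
        case False
        then have "fst s' 14 \<le> N" using I that by (simp add: I_def)
        then show ?thesis using s'' by linarith
      qed
      then show "I (Suc i) (set_reg x (Suc i) s'')"
        using s'' I x B by (auto simp: I_def)
    qed
  next
    fix s' assume "I n s'"
    then show "B s' \<and> improves g N R s s'"
      using g by (auto simp: I_def M_def)
  qed (use x S_bounds in auto)
qed

lemma spec_loops:
  assumes "spec g N B c T (set xs \<union> R)" "distinct xs" "set xs \<inter> R = {}" "(set xs \<union> R) \<inter> writes c = {}" "14 \<notin> set xs"
    and "\<And>x v s. x \<in> set xs \<Longrightarrow> B (set_reg x v s) = B s" "\<And>s. B s \<Longrightarrow> fst s 0 = n"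
    and "\<And>x. minimum_tuple g N \<Longrightarrow> x \<in> set xs \<Longrightarrow> g x < n"
  shows "spec g N B (loops xs c) (loop_time n (length xs) T) R"
  using assms
proof (induction xs arbitrary: R)
  case Nil
  then show ?case by simp
next
  case (Cons x xs)
  have "spec g N B (loops xs c) (loop_time n (length xs) T) (insert x R)"
    by (rule Cons.IH) (use Cons.prems in auto)
  then show ?case unfolding loops_simps
    using Cons.prems by (auto intro!: spec_For)
qed

text \<open>Guarantees that every loop does reach the value prescribed by \<open>g\<close>.\<close>

lemma minimum_tuple_lt:
  assumes "minimum_tuple g N" "2 \<le> x" "x \<le> 10" shows "g x < n"
proof -
  obtain p q r where K: "min_prism p q r"
    and c: "g 2 = hd p" "g 3 = hd q" "g 4 = hd r" "g 5 = last p" "g 6 = last q" "g 7 = last r"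
      "g 8 = p ! (length p div 2)" "g 9 = q ! (length q div 2)" "g 10 = r ! (length r div 2)"
    using assms(1) unfolding minimum_tuple_def by blast
  have ne: "p \<noteq> []" "q \<noteq> []" "r \<noteq> []" and V: "set p \<subseteq> {..<n}" "set q \<subseteq> {..<n}" "set r \<subseteq> {..<n}"
    using K by (auto simp: min_prism_def even_prism_paths_def prism_def)
  have m: "hd l < n \<and> last l < n \<and> l ! (length l div 2) < n" if "l \<noteq> []" "set l \<subseteq> {..<n}" for l
  proof -
    have "hd l \<in> set l" "last l \<in> set l" "l ! (length l div 2) \<in> set l" using that(1) by auto
    then show ?thesis using that(2) by blast
  qed
  have "x = 2 \<or> x = 3 \<or> x = 4 \<or> x = 5 \<or> x = 6 \<or> x = 7 \<or> x = 8 \<or> x = 9 \<or> x = 10" using assms by auto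
  then show ?thesis using c m[OF ne(1) V(1)] m[OF ne(2) V(2)] m[OF ne(3) V(3)] by auto
qed

lemma spec_attempt: "spec g N ready attempt (attempt_time n) {2..10}"
  unfolding spec_def
proof (intro allI impI)
  fix s assume s: "ready s" "\<forall>r\<in>{2..10}. fst s r < n"
  have P: "arr s (7 + i) v < n \<and> arr s (10 + i) v < n" if "i < 3" "v < n" for i v
  proof -
    have "table s i" "table s (3 + i)" using s that by (simp_all add: ready_def)
    then show ?thesis using that unfolding table_def search_result_def by (simp add: add.assoc[symmetric])
  qed
  have at: "runs W attempt s (attempt_time n) (\<lambda>s'. state_inv s' \<and> unchanged {13, 14, 15, 16} s s' \<and> fst s' 14 \<le> fst s 14 \<and>
     (middles_ok s \<and> fits_all E (routes s) (mid_dist s) \<longrightarrow> fst s' 14 \<le> size3 (mid_dist s)))"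
    by (rule runs_attempt) (use s P in \<open>auto simp: ready_def\<close>)
  show "runs W attempt s (attempt_time n) (\<lambda>s'. ready s' \<and> improves g N {2..10} s s')"
  proof (rule runs_conseq[OF at order_refl])
    fix s' assume s': "state_inv s' \<and> unchanged {13, 14, 15, 16} s s' \<and> fst s' 14 \<le> fst s 14 \<and>
     (middles_ok s \<and> fits_all E (routes s) (mid_dist s) \<longrightarrow> fst s' 14 \<le> size3 (mid_dist s))"
      and fr: "same_regs attempt s s'"
    have r: "fst s' x = fst s x" if "x \<le> 10" for x
      using fr that writes_attempt by fastforce
    have "corners_lt s'" using s r by (simp add: corners_lt_def ready_def)
    moreover have "table s' j" if "j < 6" for j
      by (rule table_cong[where s = s and A = "{13, 14, 15, 16}"]) (use s s' that r in \<open>auto simp: ready_def\<close>)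
    ultimately have "ready s'" using s' by (simp add: ready_def)
    moreover have "fst s' 14 \<le> N" if "minimum_tuple g N" "\<forall>r\<in>{2..10}. fst s r = g r"
    proof -
      have t: "\<forall>j<6. table s j" using s by (simp add: ready_def)
      have e: "\<And>x. 2 \<le> x \<Longrightarrow> x \<le> 10 \<Longrightarrow> fst s x = g x" using that by simp
      have "middles_ok s" "fits_all E (routes s) (mid_dist s)" "size3 (mid_dist s) = N"
        by (rule minimum_tuple_fits[OF t that(1)]; rule e; assumption)+
      then show ?thesis using s' by simp
    qed
    ultimately show "ready s' \<and> improves g N {2..10} s s'" using s' by blast
  qed
qed

lemma inv_set_reg: "1 < x \<Longrightarrow> x \<noteq> 14 \<Longrightarrow> state_inv (set_reg x v s) = state_inv s"
  by (simp add: state_inv_def)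

lemma ready_set_reg:
  assumes "8 \<le> x" "x \<le> 10" shows "ready (set_reg x v s) = ready s"
proof -
  have "allowed (set_reg x v s) (j mod 3) = allowed s (j mod 3)" for j
    by (rule allowed_cong) (use assms in auto)
  then have "table (set_reg x v s) j = table s j" if "j < 6" for j
    using that assms by (simp add: table_def)
  then show ?thesis using assms inv_set_reg[of x v s] by (simp add: ready_def corners_lt_def)
qed

lemma base_reg0: "state_inv s \<Longrightarrow> fst s 0 = n" by (simp add: state_inv_def base_def)

text \<open>The tables do not depend on the middle vertices, so \<open>ready\<close> is invariant in
  the three inner loops. Outside, where the ends change, only \<open>state_inv\<close>
  persists.\<close>

lemma spec_six: "spec g N state_inv six_prog (six_time n) {2..7}"
proof -
  have sp: "spec g N ready (loops [8, 9, 10] attempt) (loop_time n (length [8, 9, 10 :: nat]) (attempt_time n)) {2..7}"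
  proof (rule spec_loops)
    have "set [8, 9, 10] \<union> {2..7} = {2..10 :: nat}" by auto
    then show "spec g N ready attempt (attempt_time n) (set [8, 9, 10] \<union> {2..7})"
      using spec_attempt by simp
    show "(set [8, 9, 10] \<union> {2..7}) \<inter> writes attempt = {}" using writes_attempt by auto
    show "ready (set_reg x v s) = ready s" if "x \<in> set [8, 9, 10]" for x v s
      by (rule ready_set_reg) (use that in auto)
    show "fst s 0 = n" if "ready s" for s using that base_reg0 by (simp add: ready_def)
    show "g x < n" if "minimum_tuple g N" "x \<in> set [8, 9, 10]" for x
      by (rule minimum_tuple_lt[OF that(1)]) (use that in auto)
  qed auto
  show ?thesis
    unfolding spec_def six_prog_def
  proof (intro allI impI)
    fix s assume s: "state_inv s" "\<forall>r\<in>{2..7}. fst s r < n"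
    have c: "corners_lt s" using s by (simp add: corners_lt_def)
    have pre: "runs W (seqs (map search_prog [0, 1, 2, 3, 4, 5])) s (length [0, 1, 2, 3, 4, 5 :: nat] * search_time n + 1)
       (\<lambda>s'. state_inv s' \<and> (\<forall>k\<in>{} \<union> set [0, 1, 2, 3, 4, 5]. table s' k) \<and> fst s' 14 = fst s 14)"
      by (rule runs_search_progs) (use s c in auto)
    show "runs W (Seq (seqs (map search_prog [0, 1, 2, 3, 4, 5])) (loops [8, 9, 10] attempt)) s (six_time n)
       (\<lambda>s'. state_inv s' \<and> improves g N {2..7} s s')"
    proof (rule runs_Seq'[OF pre])
      fix s1 assume s1: "state_inv s1 \<and> (\<forall>k\<in>{} \<union> set [0, 1, 2, 3, 4, 5]. table s1 k) \<and> fst s1 14 = fst s 14"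
        and fr: "same_regs (seqs (map search_prog [0, 1, 2, 3, 4, 5])) s s1"
      have r: "fst s1 x = fst s x" if "x \<le> 7" for x using fr that by simp
      have "set [0, 1, 2, 3, 4, 5] = {..<6 :: nat}" by auto
      then have "\<forall>j<6. table s1 j" using s1 by (metis Un_iff lessThan_iff)
      then have rd: "ready s1" using s1 c r by (simp add: ready_def corners_lt_def)
      have l: "runs W (loops [8, 9, 10] attempt) s1 (loop_time n (length [8, 9, 10 :: nat]) (attempt_time n))
         (\<lambda>s'. ready s' \<and> improves g N {2..7} s1 s')"
        by (rule sp[unfolded spec_def, rule_format]) (use rd s(2) r in auto)
      show "runs W (loops [8, 9, 10] attempt) s1 (loop_time n 3 (attempt_time n))
         (\<lambda>s'. state_inv s' \<and> improves g N {2..7} s s')"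
        by (rule runs_conseq[OF l]) (use s1 r in \<open>auto simp: ready_def numeral_3_eq_3\<close>)
    qed (simp add: six_time_def)
  qed
qed

lemma spec_main_loops: "spec g N state_inv (loops [2, 3, 4, 5, 6, 7] six_prog) (loop_time n 6 (six_time n)) {}"
proof -
  have "spec g N state_inv (loops [2, 3, 4, 5, 6, 7] six_prog) (loop_time n (length [2, 3, 4, 5, 6, 7 :: nat]) (six_time n)) {}"
  proof (rule spec_loops)
    have "set [2, 3, 4, 5, 6, 7] \<union> {} = {2..7 :: nat}" by auto
    then show "spec g N state_inv six_prog (six_time n) (set [2, 3, 4, 5, 6, 7] \<union> {})" using spec_six by simp
    show "(set [2, 3, 4, 5, 6, 7] \<union> {}) \<inter> writes six_prog = {}" using writes_six by auto
    show "state_inv (set_reg x v s) = state_inv s" if "x \<in> set [2, 3, 4, 5, 6, 7]" for x v s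
      by (rule inv_set_reg) (use that in auto)
    show "g x < n" if "minimum_tuple g N" "x \<in> set [2, 3, 4, 5, 6, 7]" for x
      by (rule minimum_tuple_lt[OF that(1)]) (use that in auto)
  qed (auto simp: base_reg0)
  then show ?thesis by (simp add: eval_nat_numeral)
qed

end

context prism_machine begin

text \<open>A stored size counts distinct vertices; this keeps the copying loop of the output
  linear.\<close>

lemma inv_best_le:
  assumes "state_inv s" "fst s 14 < S" shows "fst s 14 \<le> n"
proof -
  have "even_prism_of {..<n} E (arr s 16 ` {..<fst s 14})" and c: "card (arr s 16 ` {..<fst s 14}) = fst s 14"
    using assms by (simp_all add: state_inv_def)
  then have "arr s 16 ` {..<fst s 14} \<subseteq> {..<n}" by (simp add: even_prism_of_def)
  from card_mono[OF _ this] c show ?thesis by simp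
qed

lemma runs_output:
  assumes s: "state_inv s"
  shows "runs W output_prog s (n * 20 + 30) (\<lambda>s'. if fst s 14 < S
     then fst s' 0 = fst s 14 \<and> snd s' ` {..<fst s 14} = arr s 16 ` {..<fst s 14} else fst s' 0 = 0)"
    (is "runs W _ _ _ ?Q")
proof -
  let ?b = "fst s 14" and ?c = "Put 0 (Reg 20) (Cell 16 (Reg 20))"
  have r1: "fst s 1 = S" using s by (simp add: state_inv_def base_def)
  show ?thesis
    unfolding output_prog_def
  proof (rule runs_Cond[where ?T1.0 = "n * 20 + 8"])
    assume "eval W s (Less (Reg 14) (Reg 1)) \<noteq> 0"
    then have b: "?b < S" using r1 by (auto split: if_splits)
    have bn: "?b \<le> n" using inv_best_le[OF s b] .
    \<comment> \<open>\<open>base\<close> cannot be part of this invariant, as the copying destroys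
      array 0. Array 16 is safe because fewer than \<open>S\<close> cells are written.\<close>
    define I where "I x s' \<longleftrightarrow> (\<forall>k<x. arr s' 0 k = arr s 16 k) \<and> (\<forall>k<S. arr s' 16 k = arr s 16 k)" for x s'
    have copy: "runs W (For 20 (Reg 14) ?c) s (n * 20 + 6) (\<lambda>s'. I ?b s' \<and> fst s' 14 = ?b)"
    proof (rule runs_For[where I = I and N = ?b and B = 12])
      show "?b < W" using bn S_bounds by linarith
      show "I 0 (set_reg 20 0 s)" by (simp add: I_def)
      fix x s' assume I: "I x s'" "x < ?b" "fst s' 20 = x" and fr: "same_regs_but 20 ?c s s'"
      have r: "fst s' 1 = S" using fr r1 by simp
      have x: "x < S" using I b by simp
      have k: "k < S" if "k < ?b" for k using that b by simp
      have "I (Suc x) (set_reg 20 (Suc x) (set_arr 0 x (arr s 16 x) s'))"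
        using I x k by (auto simp: I_def less_Suc_eq)
      moreover have "eval W s' (Cell 16 (Reg 20)) = arr s 16 x"
        using eval_Cell_reg[OF r, of 16 "Reg 20"] I x by (simp add: I_def)
      ultimately show "runs W ?c s' 12 (\<lambda>s''. I (Suc x) (set_reg 20 (Suc x) s''))"
        by - (rule runs_Put_reg[OF r]; use I x in simp)
    next
      show "?b * (12 + 7 + cost (Reg 14)) + 5 + cost (Reg 14) \<le> n * 20 + 6" using bn by simp
    qed auto
    show "runs W (Seq (For 20 (Reg 14) ?c) (Assign 0 (Reg 14))) s (n * 20 + 8) ?Q"
    proof (rule runs_Seq'[OF copy])
      fix s' assume s': "I ?b s' \<and> fst s' 14 = ?b"
      have "snd s' k = arr s 16 k" if "k < ?b" for k using s' that by (simp add: I_def arr_def)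
      then have "snd s' ` {..<?b} = arr s 16 ` {..<?b}" by (intro image_cong) auto
      then show "runs W (Assign 0 (Reg 14)) s' 2 ?Q" using s' b by (intro runs_Assign) auto
    qed simp
  next
    assume "eval W s (Less (Reg 14) (Reg 1)) = 0"
    then have "\<not> ?b < S" using r1 by (auto split: if_splits)
    then show "runs W (Assign 0 (Const 0)) s (n * 20 + 8) ?Q" by (intro runs_Assign) auto
  qed simp
qed

lemma minimum_tuple_exists:
  assumes "even_prism_of {..<n} E K"
  shows "\<exists>g N. minimum_tuple g N \<and> N < S \<and> (\<forall>K'. even_prism_of {..<n} E K' \<longrightarrow> N \<le> card K')"
proof -
  obtain K0 where K0: "even_prism_of {..<n} E K0" "\<And>K'. even_prism_of {..<n} E K' \<Longrightarrow> card K0 \<le> card K'"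
    using ex_has_least_nat[of "even_prism_of {..<n} E" K card] assms by blast
  then have "minimum_even_prism_of {..<n} E K0" by (simp add: minimum_even_prism_of_def)
  then obtain p q r where K: "min_prism p q r" "K0 = set p \<union> set q \<union> set r"
    unfolding minimum_even_prism_of_iff by blast
  \<comment> \<open>Two dummy entries in front make positions in the list agree with register
    numbers.\<close>
  define g where "g x = [0, 0, hd p, hd q, hd r, last p, last q, last r,
     p ! (length p div 2), q ! (length q div 2), r ! (length r div 2)] ! x" for x :: nat
  have c: "card K0 = length p + length q + length r"
    using K card_even_prism_paths unfolding min_prism_def by blast
  have "minimum_tuple g (card K0)"
    unfolding minimum_tuple_def
    by (intro exI[of _ p] exI[of _ q] exI[of _ r]) (use K(1) c in \<open>simp add: g_def\<close>)
  moreover have "card K0 < S"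
  proof -
    have "K0 \<subseteq> {..<n}" using K0(1) by (simp add: even_prism_of_def)
    from card_mono[OF _ this] show ?thesis using S_bounds by simp
  qed
  ultimately show ?thesis using K0(2) by blast
qed

text \<open>Ensures that an output of length 0 is never produced for an actual prism.\<close>

lemma even_prism_of_card_pos: "even_prism_of {..<n} E K \<Longrightarrow> 0 < card K"
  unfolding even_prism_of_iff using card_even_prism_paths
  by (auto simp: even_prism_paths_def prism_def)

lemma runs_main:
  "runs W main_prog (graph_input n E) (main_time n) (\<lambda>s.
     ((\<nexists>K. even_prism_of {..<n} E K) \<longrightarrow> prism_output s = None) \<and>
     ((\<exists>K. even_prism_of {..<n} E K) \<longrightarrow> (\<exists>K. prism_output s = Some K \<and> minimum_even_prism_of {..<n} E K)))"
    (is "runs W _ _ _ ?Q")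
proof -
  define s1 where "s1 = set_reg 1 S (graph_input n E)"
  define s2 where "s2 = set_reg 14 S s1"
  have W4: "4 + n < W" "n + 4 < W" using S_bounds by linarith+
  have ev: "eval W (graph_input n E) (Mul (Add (Reg 0) (Const 4)) (Add (Reg 0) (Const 4))) = S"
    using W4 S_bounds(6) S_bounds(4) by (simp add: graph_input_def S)
  have "arr s2 0 (u * n + v) = of_bool (E u v)" if "u < n" "v < n" for u v
    using index_bound[OF that] that by (simp add: arr_def s2_def s1_def graph_input_def)
  then have b: "base s2" by (simp add: base_def s2_def s1_def graph_input_def)
  have i2: "state_inv s2" unfolding state_inv_def using b by (simp add: s2_def)
  \<comment> \<open>If there is no even prism, \<open>g\<close> and \<open>N\<close> are arbitrary
    and \<open>spec\<close> contributes only its invariant.\<close>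
  obtain g N where gN: "(\<exists>K. even_prism_of {..<n} E K) \<Longrightarrow>
      minimum_tuple g N \<and> N < S \<and> (\<forall>K'. even_prism_of {..<n} E K' \<longrightarrow> N \<le> card K')"
    using minimum_tuple_exists by metis
  have lp: "runs W (loops [2, 3, 4, 5, 6, 7] six_prog) s2 (loop_time n 6 (six_time n))
      (\<lambda>s'. state_inv s' \<and> improves g N {} s2 s')"
    by (rule spec_main_loops[unfolded spec_def, rule_format]) (use i2 in auto)
  have rest: "runs W (Seq (loops [2, 3, 4, 5, 6, 7] six_prog) (Seq output_prog Skip)) s2
      (loop_time n 6 (six_time n) + (n * 20 + 30 + 1)) ?Q"
  proof (rule runs_Seq'[OF lp])
    fix s3 assume s3: "state_inv s3 \<and> improves g N {} s2 s3"
    then have i3: "state_inv s3" and best: "minimum_tuple g N \<Longrightarrow> fst s3 14 \<le> N" by auto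
    let ?K = "arr s3 16 ` {..<fst s3 14}"
    show "runs W (Seq output_prog Skip) s3 (n * 20 + 30 + 1) ?Q"
    proof (rule runs_Seq'[OF runs_output[OF i3]])
      fix s' :: state assume out: "if fst s3 14 < S then fst s' 0 = fst s3 14 \<and> snd s' ` {..<fst s3 14} = ?K else fst s' 0 = 0"
      have "?Q s'"
      proof (cases "\<exists>K. even_prism_of {..<n} E K")
        case True
        then have g: "minimum_tuple g N" "N < S" "\<And>K'. even_prism_of {..<n} E K' \<Longrightarrow> N \<le> card K'" using gN by blast+
        then have lt: "fst s3 14 < S" and le: "fst s3 14 \<le> N" using best by auto
        have K: "even_prism_of {..<n} E ?K" "card ?K = fst s3 14" using i3 lt by (simp_all add: state_inv_def)
        have "fst s3 14 \<noteq> 0" using even_prism_of_card_pos[OF K(1)] K(2) by linarith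
        then have "prism_output s' = Some ?K" using out lt by (simp add: prism_output_def)
        moreover have "minimum_even_prism_of {..<n} E ?K"
          unfolding minimum_even_prism_of_def using K g(3) le by (metis le_trans)
        ultimately show ?thesis using True by blast
      next
        case False
        then have "\<not> fst s3 14 < S" using i3 unfolding state_inv_def by blast
        then show ?thesis using out False by (simp add: prism_output_def)
      qed
      then show "runs W Skip s' 1 ?Q" by (intro runs_Skip) auto
    qed simp
  qed simp
  have r14: "runs W (Seq (Assign 14 (Reg 1)) (Seq (loops [2, 3, 4, 5, 6, 7] six_prog) (Seq output_prog Skip))) s1
      (2 + (loop_time n 6 (six_time n) + (n * 20 + 30 + 1))) ?Q"
    by (rule runs_Seq[OF runs_Assign[where T = 2] order_refl])
      (use rest in \<open>simp_all only: s2_def s1_def eval.simps set_reg_sel fun_upd_same cost.simps\<close>)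
  show ?thesis
    unfolding main_prog_def seqs_simps
    by (rule runs_Seq[OF runs_Assign[where T = 8],
        where ?T2.0 = "2 + (loop_time n 6 (six_time n) + (n * 20 + 30 + 1))"])
      (use r14 ev in \<open>simp_all only: s1_def cost.simps\<close>, simp_all add: main_time_def)
qed

end

section \<open>Time bound and word size\<close>

text \<open>The additive 8 and 6 of a loop are absorbed by a power that is at least 1, so each loop
  adds 14 to the constant and 1 to the exponent.\<close>

lemma loop_time_bound:
  assumes "T \<le> c * (n + 1) ^ d" shows "loop_time n k T \<le> (c + 14 * k) * (n + 1) ^ (d + k)"
proof (induction k)
  case 0
  then show ?case using assms by simp
next
  case (Suc k)
  let ?P = "(n + 1) ^ (d + k)"
  have P: "1 \<le> ?P" by simp
  have "loop_time n (Suc k) T \<le> n * ((c + 14 * k) * ?P + 8) + 6"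
    using Suc.IH by simp
  also have "\<dots> \<le> (n + 1) * ((c + 14 * k) * ?P + 8 * ?P) + 6 * ((n + 1) * ?P)"
  proof (rule add_mono)
    show "n * ((c + 14 * k) * ?P + 8) \<le> (n + 1) * ((c + 14 * k) * ?P + 8 * ?P)"
      using P by (intro mult_mono) auto
    have "1 * 1 \<le> (n + 1) * ?P" by (rule mult_mono) (use P in auto)
    then show "6 \<le> 6 * ((n + 1) * ?P)" by linarith
  qed
  also have "\<dots> = (c + 14 * Suc k) * (n + 1) ^ (d + Suc k)"
    by (simp add: algebra_simps)
  finally show ?case .
qed

text \<open>Three loops around a quadratic attempt dominate the cubic searches and give exponent 5;
  six more loops give 11. Of the constants, \<open>6042 = 6000 + 3 * 14\<close> and
  \<open>8084 = 8000 + 6 * 14\<close>. Powers of \<open>n + 1\<close> cover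
  \<open>n = 0\<close>.\<close>

lemma main_time_bound: "main_time n \<le> 30000 * (n + 1) ^ 11"
proof -
  have s: "search_time n \<le> 200 * (n + 1) ^ 3"
    by (simp add: search_time_def power3_eq_cube algebra_simps)
  have a: "attempt_time n \<le> 6000 * (n + 1) ^ 2"
    by (simp add: attempt_time_def fill_time_def check_time_def store_time_def power2_eq_square algebra_simps)
  have l3: "loop_time n 3 (attempt_time n) \<le> 6042 * (n + 1) ^ 5"
    using loop_time_bound[OF a, of 3] by simp
  have "(n + 1) ^ 3 \<le> (n + 1) ^ 5" "1 \<le> (n + 1) ^ 5" by (rule power_increasing) auto
  then have "six_time n \<le> 8000 * (n + 1) ^ 5"
    using s l3 unfolding six_time_def by linarith
  from loop_time_bound[OF this, of 6] have l6: "loop_time n 6 (six_time n) \<le> 8084 * (n + 1) ^ 11" by simp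
  have "(n + 1) ^ 1 \<le> (n + 1) ^ 11" by (rule power_increasing) auto
  then show ?thesis using l6 unfolding main_time_def by simp
qed

lemma main_time_bigo: "(\<lambda>n. real (main_time n)) \<in> O(\<lambda>n. real n ^ 11)"
\<comment> \<open>The factor \<open>2 ^ 11\<close> comes from \<open>n + 1 \<le> 2 * n\<close> for
  positive \<open>n\<close>.\<close>
proof (rule bigoI[where c = "30000 * 2 ^ 11"])
  show "eventually (\<lambda>n. norm (real (main_time n)) \<le> 30000 * 2 ^ 11 * norm (real n ^ 11)) sequentially"
    using eventually_ge_at_top[of 1]
  proof eventually_elim
    case (elim n)
    have "real (main_time n) \<le> real (30000 * (n + 1) ^ 11)"
      using main_time_bound[of n] by (rule of_nat_mono)
    also have "\<dots> = 30000 * (real n + 1) ^ 11" by (simp add: add.commute)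
    also have "\<dots> \<le> 30000 * (2 * real n) ^ 11"
      using elim by (intro mult_left_mono power_mono) auto
    finally show ?case by (simp add: power_mult_distrib)
  qed
qed

theorem mainTheorem12:
  "\<exists>(p :: prog) (k :: nat) (T :: nat \<Rightarrow> nat).
     0 < k \<and>
     (\<lambda>n. real (T n)) \<in> O(\<lambda>n. real n ^ 11) \<and>
     (\<forall>(n :: nat) (E :: nat \<Rightarrow> nat \<Rightarrow> bool).
        simple_graph {..<n} E \<and> \<not> contains_odd_hole {..<n} E \<longrightarrow>
        (\<exists>t s. exec ((n + 2) ^ k) p (graph_input n E) t s \<and> t \<le> T n \<and>
           ((\<nexists>S. even_prism_of {..<n} E S) \<longrightarrow> prism_output s = None) \<and>
           ((\<exists>S. even_prism_of {..<n} E S) \<longrightarrow>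
              (\<exists>S. prism_output s = Some S \<and> minimum_even_prism_of {..<n} E S))))"
proof (rule exI[of _ main_prog], rule exI[of _ 10], rule exI[of _ main_time], intro conjI allI impI)
  show "0 < (10 :: nat)" by simp
  show "(\<lambda>n. real (main_time n)) \<in> O(\<lambda>n. real n ^ 11)" by (rule main_time_bigo)
  fix n :: nat and E :: "nat \<Rightarrow> nat \<Rightarrow> bool"
  assume E: "simple_graph {..<n} E \<and> \<not> contains_odd_hole {..<n} E"
  \<comment> \<open>This is \<open>n + 4 \<le> 2 * (n + 2)\<close> squared. With
    \<open>32 * 4 = 2 ^ 7\<close>, seven more factors \<open>n + 2\<close> suffice, and an eighth
    makes the inequality strict; hence the exponent 10.\<close>
  have "(n + 4) * (n + 4) \<le> 4 * (n + 2) ^ 2" by (simp add: power2_eq_square algebra_simps)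
  then have "32 * ((n + 4) * (n + 4)) \<le> 2 ^ 7 * (n + 2) ^ 2" by simp
  also have "\<dots> \<le> (n + 2) ^ 7 * (n + 2) ^ 2" by (intro mult_right_mono power_mono) auto
  also have "\<dots> = (n + 2) ^ 9" by (simp flip: power_add)
  also have "\<dots> < (n + 2) ^ 10" by (rule power_strict_increasing) auto
  finally interpret prism_machine n "(n + 4) * (n + 4)" "(n + 2) ^ 10" E
    using E by unfold_locales auto
  show "\<exists>t s. exec ((n + 2) ^ 10) main_prog (graph_input n E) t s \<and> t \<le> main_time n \<and>
           ((\<nexists>S. even_prism_of {..<n} E S) \<longrightarrow> prism_output s = None) \<and>
           ((\<exists>S. even_prism_of {..<n} E S) \<longrightarrow>
              (\<exists>S. prism_output s = Some S \<and> minimum_even_prism_of {..<n} E S))"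
    using runs_main unfolding runs_def by blast
qed

end
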